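(* Let $K$ be a perfect field, $R$ a $K$-algebra, and $J$ an ideal of $R$. If $J$ and $R/J$ are both locally f.d.ss $K$-algebras, then $R$ is locally f.d.ss.
   Context: A field $K$ is perfect if every algebraic extension of $K$ is separable. All algebras are associative but not necessarily unital $K$-algebras; ideals are two-sided ring ideals that are also $K$-subspaces. A $K$-algebra $R$ is locally f.d.ss (locally finite dimensional semisimple) if every finite subset of $R$ is contained in a subalgebra of $R$ that is a finite dimensional semisimple $K$-algebra. *)

theory Defs
  imports "HOL-Computational_Algebra.Polynomial" "HOL-Computational_Algebra.Factorial_Ring"
begin

definition perfect_field :: "'k::field itself \<Rightarrow> bool" where
  "perfect_field _ \<longleftrightarrow>
     (\<forall>p :: 'k poly. irreducible p \<longrightarrow> coprime p (pderiv p))"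

text \<open>A (possibly non-unital, associative) K-algebra given by an explicit carrier and operations.\<close>
record ('k, 'a) kalg =
  acarrier :: "'a set"
  aadd :: "'a \<Rightarrow> 'a \<Rightarrow> 'a"
  amul :: "'a \<Rightarrow> 'a \<Rightarrow> 'a"
  azero :: "'a"
  aneg :: "'a \<Rightarrow> 'a"
  asmul :: "'k \<Rightarrow> 'a \<Rightarrow> 'a"

definition is_kalgebra :: "('k::field, 'a) kalg \<Rightarrow> bool" where
  "is_kalgebra A \<longleftrightarrow>
     azero A \<in> acarrier A \<and>
     (\<forall>x\<in>acarrier A. \<forall>y\<in>acarrier A. aadd A x y \<in> acarrier A) \<and>
     (\<forall>x\<in>acarrier A. \<forall>y\<in>acarrier A. amul A x y \<in> acarrier A) \<and>
     (\<forall>x\<in>acarrier A. aneg A x \<in> acarrier A) \<and>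
     (\<forall>c. \<forall>x\<in>acarrier A. asmul A c x \<in> acarrier A) \<and>
     (\<forall>x\<in>acarrier A. \<forall>y\<in>acarrier A. \<forall>z\<in>acarrier A.
        aadd A (aadd A x y) z = aadd A x (aadd A y z)) \<and>
     (\<forall>x\<in>acarrier A. \<forall>y\<in>acarrier A. aadd A x y = aadd A y x) \<and>
     (\<forall>x\<in>acarrier A. aadd A (azero A) x = x) \<and>
     (\<forall>x\<in>acarrier A. aadd A (aneg A x) x = azero A) \<and>
     (\<forall>x\<in>acarrier A. \<forall>y\<in>acarrier A. \<forall>z\<in>acarrier A.
        amul A (amul A x y) z = amul A x (amul A y z)) \<and>
     (\<forall>x\<in>acarrier A. \<forall>y\<in>acarrier A. \<forall>z\<in>acarrier A.
        amul A x (aadd A y z) = aadd A (amul A x y) (amul A x z)) \<and>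
     (\<forall>x\<in>acarrier A. \<forall>y\<in>acarrier A. \<forall>z\<in>acarrier A.
        amul A (aadd A x y) z = aadd A (amul A x z) (amul A y z)) \<and>
     (\<forall>x\<in>acarrier A. asmul A 1 x = x) \<and>
     (\<forall>a b. \<forall>x\<in>acarrier A. asmul A (a * b) x = asmul A a (asmul A b x)) \<and>
     (\<forall>a b. \<forall>x\<in>acarrier A. asmul A (a + b) x = aadd A (asmul A a x) (asmul A b x)) \<and>
     (\<forall>a. \<forall>x\<in>acarrier A. \<forall>y\<in>acarrier A.
        asmul A a (aadd A x y) = aadd A (asmul A a x) (asmul A a y)) \<and>
     (\<forall>a. \<forall>x\<in>acarrier A. \<forall>y\<in>acarrier A.
        asmul A a (amul A x y) = amul A (asmul A a x) y \<and>
        asmul A a (amul A x y) = amul A x (asmul A a y))"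

definition ksubspace :: "('k::field, 'a) kalg \<Rightarrow> 'a set \<Rightarrow> bool" where
  "ksubspace A S \<longleftrightarrow> S \<subseteq> acarrier A \<and> azero A \<in> S \<and>
     (\<forall>x\<in>S. \<forall>y\<in>S. aadd A x y \<in> S) \<and> (\<forall>x\<in>S. aneg A x \<in> S) \<and>
     (\<forall>c. \<forall>x\<in>S. asmul A c x \<in> S)"

definition subalgebra :: "('k::field, 'a) kalg \<Rightarrow> 'a set \<Rightarrow> bool" where
  "subalgebra A B \<longleftrightarrow> ksubspace A B \<and> (\<forall>x\<in>B. \<forall>y\<in>B. amul A x y \<in> B)"

definition kideal :: "('k::field, 'a) kalg \<Rightarrow> 'a set \<Rightarrow> bool" where
  "kideal A I \<longleftrightarrow> ksubspace A I \<and>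
     (\<forall>x\<in>acarrier A. \<forall>y\<in>I. amul A x y \<in> I \<and> amul A y x \<in> I)"

inductive_set lin_span :: "('k::field, 'a) kalg \<Rightarrow> 'a set \<Rightarrow> 'a set"
  for A :: "('k, 'a) kalg" and S :: "'a set" where
  span_zero: "azero A \<in> lin_span A S"
| span_base: "x \<in> S \<Longrightarrow> x \<in> lin_span A S"
| span_add: "x \<in> lin_span A S \<Longrightarrow> y \<in> lin_span A S \<Longrightarrow> aadd A x y \<in> lin_span A S"
| span_smul: "x \<in> lin_span A S \<Longrightarrow> asmul A c x \<in> lin_span A S"

definition fin_dim :: "('k::field, 'a) kalg \<Rightarrow> bool" where
  "fin_dim A \<longleftrightarrow> (\<exists>S. finite S \<and> S \<subseteq> acarrier A \<and> acarrier A \<subseteq> lin_span A S)"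

fun aprod :: "('k, 'a) kalg \<Rightarrow> 'a list \<Rightarrow> 'a" where
  "aprod A [x] = x"
| "aprod A (x # y # xs) = amul A x (aprod A (y # xs))"
| "aprod A [] = azero A"

definition nilpotent_ideal :: "('k::field, 'a) kalg \<Rightarrow> 'a set \<Rightarrow> bool" where
  "nilpotent_ideal A I \<longleftrightarrow>
     (\<exists>n>0. \<forall>xs. length xs = n \<and> set xs \<subseteq> I \<longrightarrow> aprod A xs = azero A)"

text \<open>Semisimple finite-dimensional algebra (Wedderburn): its radical, the largest nilpotent
  ideal, is zero, i.e. it has no nonzero nilpotent ideal.\<close>
definition semisimple :: "('k::field, 'a) kalg \<Rightarrow> bool" where
  "semisimple A \<longleftrightarrow> (\<forall>I. kideal A I \<and> nilpotent_ideal A I \<longrightarrow> I = {azero A})"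

definition fdss :: "('k::field, 'a) kalg \<Rightarrow> bool" where
  "fdss A \<longleftrightarrow> is_kalgebra A \<and> fin_dim A \<and> semisimple A"

definition locally_fdss :: "('k::field, 'a) kalg \<Rightarrow> bool" where
  "locally_fdss A \<longleftrightarrow>
     (\<forall>F. finite F \<and> F \<subseteq> acarrier A \<longrightarrow>
        (\<exists>B. subalgebra A B \<and> F \<subseteq> B \<and> fdss (A\<lparr>acarrier := B\<rparr>)))"

definition coset :: "('k, 'a) kalg \<Rightarrow> 'a set \<Rightarrow> 'a \<Rightarrow> 'a set" where
  "coset A J x = {aadd A x j | j. j \<in> J}"

definition quot_alg :: "('k::field, 'a) kalg \<Rightarrow> 'a set \<Rightarrow> ('k, 'a set) kalg" where
  "quot_alg A J = \<lparr>
     acarrier = coset A J ` acarrier A,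
     aadd = (\<lambda>X Y. \<Union>x\<in>X. \<Union>y\<in>Y. coset A J (aadd A x y)),
     amul = (\<lambda>X Y. \<Union>x\<in>X. \<Union>y\<in>Y. coset A J (amul A x y)),
     azero = coset A J (azero A),
     aneg = (\<lambda>X. \<Union>x\<in>X. coset A J (aneg A x)),
     asmul = (\<lambda>c X. \<Union>x\<in>X. coset A J (asmul A c x)) \<rparr>"

end

theory Submission
  imports Defs "HOL-Library.Poly_Mapping" "HOL-Library.Product_Plus" "HOL-Algebra.FiniteProduct"
begin

text \<open>
  Given a finite \<open>F \<subseteq> R\<close>, let \<open>A\<close> be the preimage of a finite dimensional semisimple subalgebra of \<open>R/J\<close> that
  contains the image of \<open>F\<close>. Let \<open>s\<close> be a linear projection of \<open>A\<close> to a complement \<open>W\<close> of \<open>J\<close>. The right ideal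
  of \<open>J\<close> generated by the defects \<open>xy - s(xy)\<close> with \<open>x, y \<in> W\<close> is \<open>gJ\<close> for an idempotent \<open>g\<close>, and it is stable
  under left multiplication by \<open>W\<close>; so \<open>C = (1 - g)W\<close> is a subalgebra that lifts \<open>A/J\<close>.

  Since \<open>K\<close> is perfect, \<open>C\<close> is separable. Averaging over a separability element, as in Maschke's theorem,
  gives an idempotent \<open>e \<in> J\<close> that commutes with \<open>C\<close> and is an identity for the \<open>J\<close>-components of \<open>F\<close>. For a
  finite dimensional semisimple \<open>T \<subseteq> J\<close> that contains \<open>e\<close>, \<open>eC\<close> and these components, \<open>C + eTe\<close> is the required
  subalgebra.

  Separability of \<open>C\<close> with centre \<open>Z\<close> has two parts. Over \<open>Z\<close> it holds for every field: the multiplication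
  algebra of \<open>C\<close> is semisimple, hence contains a projection of \<open>C\<close> onto \<open>Z\<close>, and it acts faithfully. For \<open>Z\<close>
  over \<open>K\<close>, every \<open>z \<in> Z\<close> is a root of a polynomial \<open>p\<close> coprime to \<open>p'\<close>, and the divided difference of \<open>p\<close>
  provides the separability element of \<open>K[z]\<close>.
\<close>

section \<open>Polynomials over a perfect field\<close>

text \<open>The classical splitting off of a nilpotent radical does not apply, since
  \<open>J\<close> is full of idempotents and may have infinite dimension. What replaces it: right
  ideals \<open>XJ\<close> with \<open>X\<close> finite are generated by idempotents, so a single
  factor \<open>1 - g\<close> removes all multiplicative defects at once. A local identity of
  \<open>J\<close> found in this way need not commute with \<open>C\<close>; without that,
  \<open>C + eTe\<close> might not be closed under multiplication, and averaging is there to enforce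
  it.

  Tensor products never appear. An element of \<open>C \<otimes> C\<^sup>o\<^sup>p\<close> is
  represented by the operator \<open>m \<mapsto> \<Sum> a\<^sub>i * m * b\<^sub>i\<close> on an
  ambient unital ring, and a separability element becomes an operator \<open>T\<close> in
  \<open>Mop C\<close> with \<open>T 1 = 1\<close> whose values commute with \<open>C\<close>. This,
  together with expressions such as \<open>1 - g\<close>, is why \<open>R\<close> is embedded into a
  ring of endomorphisms.

  Semisimplicity enters not through matrix algebras but through idempotent generators of one-sided
  ideals and von Neumann regularity, \<open>x = x * y * x\<close>, which also excludes nonzero
  ideals of square zero.\<close>

lemma poly_bezout:
  fixes p q :: "'k::field poly"
  assumes "coprime p q"
  obtains u v where "u * p + v * q = 1"
proof -
  let ?P = "\<lambda>d. d \<noteq> 0 \<and> (\<exists>u v. d = u * p + v * q)"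
  have "p \<noteq> 0 \<or> q \<noteq> 0" using assms by auto
  then have "?P p \<or> ?P q" by (metis add.right_neutral add.left_neutral mult_1 mult_zero_left)
  then obtain d where d: "?P d" "\<And>d'. ?P d' \<Longrightarrow> degree d \<le> degree d'"
    using ex_has_least_nat[of ?P _ degree] by metis
  then obtain u v where uv: "d = u * p + v * q" by blast
  \<comment> \<open>The remainder modulo \<open>d\<close> is again such a combination, so minimality
    of the degree makes it zero.\<close>
  have red: "d dvd w" if w: "w = a * p + b * q" for w a b
  proof (rule ccontr)
    assume "\<not> d dvd w"
    then have ne: "w mod d \<noteq> 0" by (simp add: dvd_eq_mod_eq_0)
    have "w mod d = w - (w div d) * d" by (simp add: minus_div_mult_eq_mod)
    also have "\<dots> = (a - (w div d) * u) * p + (b - (w div d) * v) * q"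
      by (simp add: w uv algebra_simps)
    finally have "degree d \<le> degree (w mod d)" using d(2) ne by blast
    then show False using degree_mod_less[of d w] d(1) ne by auto
  qed
  have "d dvd p" using red[of p 1 0] by simp
  moreover have "d dvd q" using red[of q 0 1] by simp
  ultimately have "is_unit d" using assms by (meson coprime_common_divisor)
  then obtain w where "1 = d * w" by (auto elim: dvdE)
  then have "(w * u) * p + (w * v) * q = 1" unfolding uv by (simp add: algebra_simps)
  with that show thesis by blast
qed

lemma poly_nonunit_irreducible_divisor:
  fixes d :: "'k::field poly"
  assumes "d \<noteq> 0" "\<not> is_unit d"
  obtains q where "irreducible q" "q dvd d"
proof -
  let ?P = "\<lambda>q. q dvd d \<and> \<not> is_unit q"
  have "?P d" using assms(2) by simp
  then obtain q where q: "?P q" "\<And>q'. ?P q' \<Longrightarrow> degree q \<le> degree q'"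
    using ex_has_least_nat[of ?P d degree] by metis
  have q0: "q \<noteq> 0" using q(1) assms(1) by auto
  have "irreducible q"
  proof (rule irreducibleI[OF q0])
    fix a b assume ab: "q = a * b"
    show "is_unit a \<or> is_unit b"
    proof (rule ccontr)
      assume H: "\<not> (is_unit a \<or> is_unit b)"
      have "a \<noteq> 0" "b \<noteq> 0" using ab q0 by auto
      moreover have "?P a" using H q(1) ab by (meson dvd_trans dvd_triv_left)
      ultimately have "degree b = 0" using q(2)[of a] ab by (simp add: degree_mult_eq)
      then show False using H \<open>b \<noteq> 0\<close> by (simp add: is_unit_iff_degree)
    qed
  qed (use q in blast)
  with q that show thesis by blast
qed

text \<open>An irreducible common factor \<open>q\<close> of \<open>p = q * r\<close> and its
  derivative divides \<open>pderiv q * r\<close>. Perfectness makes \<open>q\<close> coprime to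
  \<open>pderiv q\<close>, so \<open>q\<close> divides \<open>r\<close> and its square divides
  \<open>p\<close>.\<close>

lemma perfect_field_separable:
  fixes p :: "'k::field poly"
  assumes "perfect_field TYPE('k)" "p \<noteq> 0" "\<And>q s. p = q * q * s \<Longrightarrow> is_unit q"
  shows "coprime p (pderiv p)"
proof (rule coprimeI)
  fix d assume d: "d dvd p" "d dvd pderiv p"
  show "is_unit d"
  proof (rule ccontr)
    assume "\<not> is_unit d"
    moreover have "d \<noteq> 0" using d(1) assms(2) by auto
    ultimately obtain q where q: "irreducible q" "q dvd d"
      using poly_nonunit_irreducible_divisor by blast
    then obtain r where r: "p = q * r" using d(1) by (meson dvdE dvd_trans)
    have "q dvd pderiv q * r"
    proof -
      have "q dvd pderiv p" using q(2) d(2) by (rule dvd_trans)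
      moreover have "pderiv p = pderiv q * r + q * pderiv r" by (simp add: r pderiv_mult mult.commute)
      ultimately show ?thesis by (simp add: dvd_add_left_iff)
    qed
    moreover have cop: "coprime q (pderiv q)" using assms(1) q(1) by (simp add: perfect_field_def)
    obtain u v where "u * q + v * pderiv q = 1" using poly_bezout[OF cop] .
    then have "r = u * q * r + v * (pderiv q * r)" by (metis distrib_right mult.assoc mult_1)
    ultimately have "q dvd r" by (metis dvd_add dvd_mult dvd_mult2 dvd_refl)
    then obtain s where "p = q * q * s" using r by (auto simp: mult.assoc)
    then show False using assms(3) q(1) by (auto simp: irreducible_def)
  qed
qed

section \<open>Rings of additive endomorphisms\<close>

text \<open>Only additivity is imposed: the scalar action is a parameter of the later locale and not
  part of the type, and the scalars themselves are to be elements of the ring.\<close>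

typedef (overloaded) 'v endo = "{f :: 'v::ab_group_add \<Rightarrow> 'v. \<forall>x y. f (x + y) = f x + f y}"
  morphisms app Endo
  by (rule exI[of _ "\<lambda>x. x"]) simp

setup_lifting type_definition_endo

instantiation endo :: (ab_group_add) "{ring, monoid_mult}"
begin

lift_definition zero_endo :: "'a endo" is "\<lambda>x. 0" by simp
lift_definition one_endo :: "'a endo" is "\<lambda>x. x" by simp
lift_definition plus_endo :: "'a endo \<Rightarrow> 'a endo \<Rightarrow> 'a endo" is "\<lambda>f g x. f x + g x"
  by (simp add: algebra_simps)
lift_definition minus_endo :: "'a endo \<Rightarrow> 'a endo \<Rightarrow> 'a endo" is "\<lambda>f g x. f x - g x"
  by (simp add: algebra_simps)
lift_definition uminus_endo :: "'a endo \<Rightarrow> 'a endo" is "\<lambda>f x. - f x"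
  by (simp add: algebra_simps)
lift_definition times_endo :: "'a endo \<Rightarrow> 'a endo \<Rightarrow> 'a endo" is "\<lambda>f g x. f (g x)"
  by simp

instance
  by standard (transfer; simp add: algebra_simps fun_eq_iff)+

end

lemma endo_eqI: "(\<And>x. app f x = app g x) \<Longrightarrow> f = g"
  by (simp add: app_inject[symmetric] fun_eq_iff)

lemma app_add_right [simp]: "app f (x + y) = app f x + app f y"
  using app[of f] by simp

lemma app_Endo: "(\<And>x y. f (x + y) = f x + f y) \<Longrightarrow> app (Endo f) = f"
  by (simp add: Endo_inverse)

lemma app_simps [simp]:
  "app 0 x = 0" "app 1 x = x" "app (f + g) x = app f x + app g x"
  "app (f - g) x = app f x - app g x" "app (- f) x = - app f x" "app (f * g) x = app f (app g x)"
  by (transfer; simp)+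

lemma app_zero_right [simp]: "app f 0 = 0"
  using app_add_right[of f 0 0] by (simp del: app_add_right)

lemma app_minus_right [simp]: "app f (- x) = - app f x"
  using app_add_right[of f x "- x"] by (simp del: app_add_right add: eq_neg_iff_add_eq_0 add.commute)

lemma app_diff_right [simp]: "app f (x - y) = app f x - app f y"
  using app_add_right[of f x "- y"] by (simp del: app_add_right)

lemma app_sum_left: "app (sum f I) x = (\<Sum>i\<in>I. app (f i) x)"
  by (induction I rule: infinite_finite_induct) auto

section \<open>Finite dimensional semisimple algebras\<close>

text \<open>The sort \<open>{ring, monoid_mult}\<close> replaces \<open>ring_1\<close> because the endomorphism ring of a trivial group
  violates \<open>0 \<noteq> 1\<close>. The scalars need not be central: an element of \<open>'v endo\<close> is only additive, not
  \<open>K\<close>-linear. Therefore subalgebras are required to commute with the scalars.\<close>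

locale scalar_ring =
  fixes emb :: "'k::field \<Rightarrow> 'r::{ring,monoid_mult}"
  assumes emb_add: "emb (a + b) = emb a + emb b"
    and emb_mult: "emb (a * b) = emb a * emb b"
    and emb_one: "emb 1 = 1"
begin

definition scl :: "'k \<Rightarrow> 'r \<Rightarrow> 'r" where
  "scl c x = emb c * x"

sublocale vector_space scl
  by unfold_locales (simp_all add: scl_def emb_add emb_mult emb_one algebra_simps)

lemma scl_mult_left [simp]: "scl c x * y = scl c (x * y)"
  by (simp add: scl_def mult.assoc)

definition subalg :: "'r set \<Rightarrow> bool" where
  "subalg A \<longleftrightarrow> subspace A \<and> (\<forall>x\<in>A. \<forall>y\<in>A. x * y \<in> A) \<and> (\<forall>x\<in>A. \<forall>c. x * emb c = emb c * x)"

definition fd :: "'r set \<Rightarrow> bool" where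
  "fd A \<longleftrightarrow> (\<exists>S. finite S \<and> A \<subseteq> span S)"

definition left_ideal :: "'r set \<Rightarrow> 'r set \<Rightarrow> bool" where
  "left_ideal A L \<longleftrightarrow> subspace L \<and> L \<subseteq> A \<and> (\<forall>a\<in>A. \<forall>x\<in>L. a * x \<in> L)"

definition right_ideal :: "'r set \<Rightarrow> 'r set \<Rightarrow> bool" where
  "right_ideal A L \<longleftrightarrow> subspace L \<and> L \<subseteq> A \<and> (\<forall>a\<in>A. \<forall>x\<in>L. x * a \<in> L)"

text \<open>This amounts to the absence of nonzero nilpotent ideals: the last nonzero power of such
  an ideal has square zero.\<close>

definition square_free :: "'r set \<Rightarrow> bool" where
  "square_free A \<longleftrightarrow>
     (\<forall>I. left_ideal A I \<and> right_ideal A I \<and> (\<forall>x\<in>I. \<forall>y\<in>I. x * y = 0) \<longrightarrow> I \<subseteq> {0})"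

definition ssalg :: "'r set \<Rightarrow> bool" where
  "ssalg A \<longleftrightarrow> subalg A \<and> fd A \<and> square_free A"

lemma subalgD:
  assumes "subalg A"
  shows "subspace A" "x \<in> A \<Longrightarrow> y \<in> A \<Longrightarrow> x * y \<in> A" "x \<in> A \<Longrightarrow> x * emb c = emb c * x"
    "x \<in> A \<Longrightarrow> x * scl c y = scl c (x * y)"
  using assms by (auto simp: subalg_def scl_def mult.assoc[symmetric])

lemma left_idealD:
  assumes "left_ideal A L"
  shows "subspace L" "x \<in> L \<Longrightarrow> x \<in> A" "a \<in> A \<Longrightarrow> x \<in> L \<Longrightarrow> a * x \<in> L"
  using assms by (auto simp: left_ideal_def)

lemma right_idealD:
  assumes "right_ideal A L"
  shows "subspace L" "x \<in> L \<Longrightarrow> x \<in> A" "a \<in> A \<Longrightarrow> x \<in> L \<Longrightarrow> x * a \<in> L"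
  using assms by (auto simp: right_ideal_def)

lemma ssalgD:
  assumes "ssalg A"
  shows "subalg A" "fd A" "square_free A"
  using assms by (auto simp: ssalg_def)

lemma square_freeD:
  assumes "square_free A" "left_ideal A I" "right_ideal A I"
    "\<And>x y. x \<in> I \<Longrightarrow> y \<in> I \<Longrightarrow> x * y = 0" "x \<in> I"
  shows "x = 0"
  using assms unfolding square_free_def by blast

lemma fd_subset: "fd A \<Longrightarrow> B \<subseteq> A \<Longrightarrow> fd B"
  unfolding fd_def by blast

lemma fd_basis:
  assumes "fd A" "subspace A"
  obtains B where "finite B" "B \<subseteq> A" "independent B" "span B = A"
proof -
  obtain S where S: "finite S" "A \<subseteq> span S" using assms by (auto simp: fd_def)
  obtain B where B: "B \<subseteq> A" "independent B" "A \<subseteq> span B" "card B = dim A"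
    by (rule basis_exists[of A])
  have "finite B" using independent_span_bound[OF S(1) B(2)] B(1) S(2) by blast
  with B span_subspace[OF B(1,3) assms(2)] that show thesis by blast
qed

lemma dim_strict_mono:
  assumes "subspace U" "U \<subset> V" "fd V"
  shows "dim U < dim V"
proof -
  obtain S where S: "finite S" "V \<subseteq> span S" using assms by (auto simp: fd_def)
  obtain B where B: "B \<subseteq> U" "independent B" "U \<subseteq> span B" "card B = dim U"
    by (rule basis_exists[of U])
  have fB: "finite B" using independent_span_bound[OF S(1) B(2)] B(1) S(2) assms(2) by blast
  obtain B' where B': "B' \<subseteq> V" "independent B'" "V \<subseteq> span B'" "card B' = dim V"
    by (rule basis_exists[of V])
  have fB': "finite B'" using independent_span_bound[OF S(1) B'(2)] B'(1) S(2) by blast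
  obtain v where v: "v \<in> V" "v \<notin> U" using assms(2) by blast
  have "span B = U" using span_subspace[OF B(1,3) assms(1)] .
  then have "independent (insert v B)" using v B(2) by (simp add: independent_insertI)
  moreover have "insert v B \<subseteq> span B'" using v B(1) B'(3) assms(2) by blast
  ultimately have "card (insert v B) \<le> card B'"
    using independent_span_bound[OF fB'] by blast
  moreover have "v \<notin> B" using v B(1) by blast
  ultimately show ?thesis using fB B(4) B'(4) by simp
qed

text \<open>Stands in for the descending chain condition; a member of least dimension is minimal by
  \<open>dim_strict_mono\<close>.\<close>

lemma minimal_subspace:
  assumes "P U" and P: "\<And>U. P U \<Longrightarrow> subspace U \<and> fd U"
  obtains V where "P V" "\<And>W. P W \<Longrightarrow> W \<subseteq> V \<Longrightarrow> W = V"
proof -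
  obtain V where V: "P V" "\<And>W. P W \<Longrightarrow> dim V \<le> dim W"
    using ex_has_least_nat[of P U dim] assms(1) by blast
  have "W = V" if "P W" "W \<subseteq> V" for W
  proof (rule ccontr)
    assume "W \<noteq> V"
    then have "dim W < dim V" using that P V(1) by (intro dim_strict_mono) auto
    with V(2)[OF that(1)] show False by simp
  qed
  with V(1) that show thesis by blast
qed

section \<open>One-sided ideals, their idempotent generators, and von Neumann regularity\<close>

lemma subspace_right_mult:
  assumes "subspace L" shows "subspace ((\<lambda>y. y * x) ` L)"
proof (rule subspaceI)
  show "0 \<in> (\<lambda>y. y * x) ` L" using subspace_0[OF assms] by (force intro: image_eqI[of _ _ 0])
next
  fix u v assume "u \<in> (\<lambda>y. y * x) ` L" "v \<in> (\<lambda>y. y * x) ` L"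
  then show "u + v \<in> (\<lambda>y. y * x) ` L"
    using subspace_add[OF assms] by (force simp: distrib_right[symmetric])
next
  fix c u assume "u \<in> (\<lambda>y. y * x) ` L"
  then show "scl c u \<in> (\<lambda>y. y * x) ` L"
    using subspace_scale[OF assms] by (force simp: scl_mult_left[symmetric] simp del: scl_mult_left)
qed

lemma subspace_left_annihilated:
  assumes "subspace L" shows "subspace {y\<in>L. y * x = 0}"
  using assms by (auto simp: subspace_def distrib_right)

lemma subspace_right_annihilated:
  assumes "subspace L" "\<And>c. x * emb c = emb c * x" shows "subspace {y\<in>L. x * y = 0}"
proof -
  have "x * scl c y = scl c (x * y)" for c y
    using assms(2) by (simp add: scl_def mult.assoc[symmetric])
  then show ?thesis using assms by (auto simp: subspace_def distrib_left)
qed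

text \<open>If \<open>L\<close> has square zero, so has the two-sided ideal \<open>L + LA\<close>
  that it generates: in \<open>(x * a) * (y * b)\<close> the factor \<open>a * y\<close> lies in
  \<open>L\<close> and is killed by \<open>x\<close>.\<close>

lemma left_ideal_square_nonzero:
  assumes "subalg A" "square_free A" "left_ideal A L" "\<not> L \<subseteq> {0}"
  shows "\<exists>x\<in>L. \<exists>y\<in>L. x * y \<noteq> 0"
proof (rule ccontr)
  assume "\<not> ?thesis"
  then have LL: "x * y = 0" if "x \<in> L" "y \<in> L" for x y using that by blast
  note A = subalgD[OF assms(1)] and L = left_idealD[OF assms(3)]
  define G where "G = L \<union> {x * a |x a. x \<in> L \<and> a \<in> A}"
  define I where "I = span G"
  have GA: "G \<subseteq> A" using A L by (auto simp: G_def)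
  then have IA: "I \<subseteq> A" unfolding I_def using A(1) by (rule span_minimal)
  have aG: "a * g \<in> G" if aA: "a \<in> A" and gG: "g \<in> G" for a g
  proof (cases "g \<in> L")
    case True
    then show ?thesis using L(3) aA by (auto simp: G_def)
  next
    case False
    then obtain x b where "g = x * b" "x \<in> L" "b \<in> A" using gG by (auto simp: G_def)
    then have "a * g = (a * x) * b" "a * x \<in> L" using L(3) aA by (auto simp: mult.assoc)
    then show ?thesis using \<open>b \<in> A\<close> by (auto simp: G_def)
  qed
  have Ga: "g * a \<in> G" if aA: "a \<in> A" and gG: "g \<in> G" for a g
  proof (cases "g \<in> L")
    case True
    then show ?thesis using aA by (auto simp: G_def)
  next
    case False
    then obtain x b where "g = x * b" "x \<in> L" "b \<in> A" using gG by (auto simp: G_def)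
    then have "g * a = x * (b * a)" "b * a \<in> A" using A(2) aA by (auto simp: mult.assoc)
    then show ?thesis using \<open>x \<in> L\<close> by (auto simp: G_def)
  qed
  have LG: "x * h = 0" if "x \<in> L" "h \<in> G" for x h
    using that LL by (auto simp: G_def mult.assoc[symmetric])
  have GG: "g * h = 0" if gG: "g \<in> G" and hG: "h \<in> G" for g h
  proof (cases "g \<in> L")
    case True
    then show ?thesis using LG hG by blast
  next
    case False
    then obtain x b where "g = x * b" "x \<in> L" "b \<in> A" using gG by (auto simp: G_def)
    then show ?thesis using LG[OF \<open>x \<in> L\<close> aG[OF \<open>b \<in> A\<close> hG]] by (simp add: mult.assoc)
  qed
  have li: "left_ideal A I"
    unfolding left_ideal_def
  proof (intro conjI ballI IA)
    fix a x assume "a \<in> A" "x \<in> I"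
    from this(2) show "a * x \<in> I" unfolding I_def
    proof (induction rule: span_induct_alt)
      case base show ?case by (simp add: span_zero)
    next
      case (step c g y)
      then show ?case using aG[OF \<open>a \<in> A\<close>] A(4)[OF \<open>a \<in> A\<close>]
        by (auto simp: distrib_left intro!: span_add span_scale intro: span_base)
    qed
  qed (simp add: I_def)
  have ri: "right_ideal A I"
    unfolding right_ideal_def
  proof (intro conjI ballI IA)
    fix a x assume "a \<in> A" "x \<in> I"
    from this(2) show "x * a \<in> I" unfolding I_def
    proof (induction rule: span_induct_alt)
      case base show ?case by (simp add: span_zero)
    next
      case (step c g y)
      then show ?case using Ga[OF \<open>a \<in> A\<close>]
        by (auto simp: distrib_right intro!: span_add span_scale intro: span_base)
    qed
  qed (simp add: I_def)
  have GI: "g * x = 0" if "g \<in> G" "x \<in> I" for g x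
    using that(2) unfolding I_def
  proof (induction rule: span_induct_alt)
    case (step c h y)
    then show ?case using GG[OF that(1)] A(4)[of g] GA that(1) by (auto simp: distrib_left)
  qed simp
  have "y * x = 0" if "y \<in> I" "x \<in> I" for x y
    using that(1) unfolding I_def
  proof (induction rule: span_induct_alt)
    case (step c h y)
    then show ?case using GI that(2) by (auto simp: distrib_right)
  qed simp
  then have "x = 0" if "x \<in> I" for x using square_freeD[OF assms(2) li ri _ that] by blast
  moreover have "L \<subseteq> I" unfolding I_def G_def using span_superset by blast
  ultimately show False using assms(4) by blast
qed

text \<open>Brauer's argument: if \<open>M\<close> is a minimal left ideal and \<open>Mx \<noteq> 0\<close> for some \<open>x \<in> M\<close>, then the element
  \<open>e \<in> M\<close> with \<open>ex = x\<close> is idempotent.\<close>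

lemma left_ideal_contains_idempotent:
  assumes "ssalg A" "left_ideal A L" "\<not> L \<subseteq> {0}"
  obtains e where "e \<in> L" "e * e = e" "e \<noteq> 0"
proof -
  note ss = ssalgD[OF assms(1)]
  note A = subalgD[OF ss(1)]
  let ?P = "\<lambda>M. left_ideal A M \<and> M \<subseteq> L \<and> \<not> M \<subseteq> {0}"
  have fdM: "subspace M \<and> fd M" if "?P M" for M
    using that fd_subset[OF ss(2)] by (auto simp: left_ideal_def)
  obtain M where M: "?P M" "\<And>N. ?P N \<Longrightarrow> N \<subseteq> M \<Longrightarrow> N = M"
    using minimal_subspace[of ?P L] fdM assms(2,3) by blast
  then have lM: "left_ideal A M" by blast
  note LM = left_idealD[OF lM]
  obtain z x where zx: "z \<in> M" "x \<in> M" "z * x \<noteq> 0"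
    using left_ideal_square_nonzero[OF ss(1,3) lM] M(1) by blast
  let ?Mx = "(\<lambda>y. y * x) ` M"
  have "left_ideal A ?Mx"
    using subspace_right_mult[OF LM(1)] LM(3) LM(2) zx(2)
    by (auto simp: left_ideal_def mult.assoc[symmetric])
  moreover have "?Mx \<subseteq> M" using LM zx(2) by auto
  moreover have "\<not> ?Mx \<subseteq> {0}" using zx by auto
  ultimately have "?Mx = M" using M(2)[of ?Mx] M(1) by (meson subset_trans)
  then obtain e where e: "e \<in> M" "e * x = x" using zx(2) by (metis imageE)
  let ?N = "{y\<in>M. y * x = 0}"
  have "left_ideal A ?N"
    using subspace_left_annihilated[OF LM(1)] LM by (auto simp: left_ideal_def mult.assoc)
  moreover have "?N \<noteq> M" using zx by blast
  moreover have "?N \<subseteq> M" by blast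
  ultimately have N0: "?N \<subseteq> {0}" using M(2)[of ?N] M(1) by (meson subset_trans)
  have "e * e - e \<in> ?N"
    using e LM by (auto simp: left_diff_distrib mult.assoc e(2) intro!: subspace_diff)
  then have "e * e = e" using N0 by auto
  moreover have "e \<noteq> 0" using e zx by auto
  ultimately show thesis using that e(1) M(1) by blast
qed

text \<open>Among the idempotents \<open>e\<close> of \<open>L\<close>, one is chosen whose
  annihilator \<open>{y\<in>L. y * e = 0}\<close> is minimal. If it were nonzero, it would contain a
  nonzero idempotent \<open>f\<close>, and \<open>e + f - e * f\<close> would be an idempotent with
  a smaller annihilator, since it no longer kills \<open>f\<close>. A zero annihilator forces
  \<open>x = x * e\<close>.\<close>

lemma left_ideal_idempotent_generator:
  assumes "ssalg A" "left_ideal A L"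
  obtains e where "e \<in> L" "e * e = e" "\<And>x. x \<in> L \<Longrightarrow> x * e = x"
proof -
  note ss = ssalgD[OF assms(1)]
  note A = subalgD[OF ss(1)] and L = left_idealD[OF assms(2)]
  let ?N = "\<lambda>e. {y\<in>L. y * e = 0}"
  let ?P = "\<lambda>U. \<exists>e\<in>L. e * e = e \<and> U = ?N e"
  have lN: "left_ideal A (?N e)" for e
    using subspace_left_annihilated[OF L(1)] L by (auto simp: left_ideal_def mult.assoc)
  have "?P (?N 0)" using subspace_0[OF L(1)] by force
  moreover have fdU: "subspace U \<and> fd U" if "?P U" for U
    using that lN fd_subset[OF ss(2)] by (auto simp: left_ideal_def)
  ultimately obtain U where U: "?P U" "\<And>W. ?P W \<Longrightarrow> W \<subseteq> U \<Longrightarrow> W = U"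
    using minimal_subspace[of ?P "?N 0"] by blast
  then obtain e where e: "e \<in> L" "e * e = e" "U = ?N e" by blast
  have "?N e \<subseteq> {0}"
  proof (rule ccontr)
    assume "\<not> ?N e \<subseteq> {0}"
    then obtain f where f: "f \<in> ?N e" "f * f = f" "f \<noteq> 0"
      using left_ideal_contains_idempotent[OF assms(1) lN] by blast
    then have fe: "f * e = 0" and fL: "f \<in> L" by auto
    define e' where "e' = e + f - e * f"
    have fe': "f * (e * x) = 0" for x by (simp add: mult.assoc[symmetric] fe)
    have e'L: "e' \<in> L" unfolding e'_def using e(1) fL L by (intro subspace_diff subspace_add) auto
    have "e' * e' = e'"
      unfolding e'_def by (simp add: algebra_simps fe fe' f(2) e(2)) (simp add: mult.assoc[symmetric] f(2) e(2))
    moreover have e'e: "e' * e = e" unfolding e'_def by (simp add: algebra_simps fe e(2))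
    moreover have "?N e' \<subseteq> U"
    proof safe
      fix y assume y: "y \<in> L" "y * e' = 0"
      then have "y * (e' * e) = 0" by (metis mult.assoc mult_zero_left)
      then show "y \<in> U" using y e(3) e'e by simp
    qed
    ultimately have "?N e' = U" using U(2)[of "?N e'"] e'L by blast
    moreover have "f * e' = f" unfolding e'_def by (simp add: algebra_simps fe fe' f(2))
    ultimately show False using f fL fe e(3) by (metis (mono_tags, lifting) mem_Collect_eq)
  qed
  then have "x * e = x" if "x \<in> L" for x
  proof -
    have "x - x * e \<in> ?N e"
      using that e L by (auto simp: left_diff_distrib mult.assoc intro!: subspace_diff)
    with \<open>?N e \<subseteq> {0}\<close> show ?thesis by auto
  qed
  with e that show thesis by blast
qed

text \<open>A right unit \<open>u\<close> comes from \<open>A\<close> as a left ideal of itself.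
  Elements with \<open>u * x = 0\<close> satisfy \<open>a * x = (a * u) * x = 0\<close> for all
  \<open>a\<close>, so they form an ideal of square zero, and \<open>x - u * x\<close> is one of
  them.\<close>

lemma ssalg_unit:
  assumes "ssalg A"
  obtains u where "u \<in> A" "\<And>x. x \<in> A \<Longrightarrow> x * u = x" "\<And>x. x \<in> A \<Longrightarrow> u * x = x"
proof -
  note ss = ssalgD[OF assms(1)]
  note A = subalgD[OF ss(1)]
  have "left_ideal A A" using A by (auto simp: left_ideal_def)
  then obtain u where u: "u \<in> A" "\<And>x. x \<in> A \<Longrightarrow> x * u = x"
    using left_ideal_idempotent_generator[OF assms] by blast
  let ?U = "{x\<in>A. u * x = 0}"
  have zero: "a * x = 0" if "a \<in> A" "x \<in> ?U" for a x
  proof -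
    have "a * x = (a * u) * x" using u that by simp
    then show ?thesis using that by (simp add: mult.assoc)
  qed
  have sU: "subspace ?U" using subspace_right_annihilated[OF A(1)] A(3) u(1) by blast
  have "left_ideal A ?U"
    unfolding left_ideal_def
  proof (intro conjI ballI sU)
    fix a x assume "a \<in> A" "x \<in> ?U"
    then have "a * x = 0" by (rule zero)
    then show "a * x \<in> ?U" using subspace_0[OF A(1)] by simp
  qed auto
  moreover have "right_ideal A ?U"
    using sU A(2) by (auto simp: right_ideal_def mult.assoc[symmetric])
  ultimately have U0: "x = 0" if "x \<in> ?U" for x
    using square_freeD[OF ss(3) _ _ _ that] zero by blast
  have "u * x = x" if "x \<in> A" for x
  proof -
    have "x - u * x \<in> ?U"
      using that u A by (auto simp: right_diff_distrib mult.assoc[symmetric] intro!: subspace_diff)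
    with U0 show ?thesis by fastforce
  qed
  with u that show thesis by blast
qed

text \<open>The left ideal \<open>Ax\<close> contains \<open>x\<close> and has an idempotent
  generator \<open>e = y * x\<close>, so \<open>x = x * e\<close>. Being left-right symmetric,
  regularity carries results from left ideals to right ideals, and it reduces later semisimplicity
  proofs to computations with single elements.\<close>

lemma ssalg_regular:
  assumes "ssalg A" "x \<in> A"
  obtains y where "y \<in> A" "x * y * x = x"
proof -
  note A = subalgD[OF ssalgD(1)[OF assms(1)]]
  obtain u where u: "u \<in> A" "\<And>x. x \<in> A \<Longrightarrow> x * u = x" "\<And>x. x \<in> A \<Longrightarrow> u * x = x"
    by (rule ssalg_unit[OF assms(1)]) blast
  have "left_ideal A ((\<lambda>y. y * x) ` A)"
    using subspace_right_mult[OF A(1)] A(2) assms(2) by (auto simp: left_ideal_def mult.assoc[symmetric])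
  then obtain e where e: "e \<in> (\<lambda>y. y * x) ` A" "\<And>z. z \<in> (\<lambda>y. y * x) ` A \<Longrightarrow> z * e = z"
    using left_ideal_idempotent_generator[OF assms(1)] by metis
  then obtain y where y: "y \<in> A" "e = y * x" by blast
  have "x \<in> (\<lambda>y. y * x) ` A" using u(1) u(3)[OF assms(2)] by force
  then have "x * e = x" using e by blast
  with y that show thesis by (simp add: mult.assoc)
qed

text \<open>The minimality argument for left ideals again, except that the new idempotent comes from
  regularity: if \<open>y = y * z * y\<close> and \<open>e * y = 0\<close>, then
  \<open>f = y * z\<close> is an idempotent of \<open>L\<close> with
  \<open>e * f = 0\<close>.\<close>

lemma right_ideal_idempotent_generator:
  assumes "ssalg A" "right_ideal A L"
  obtains e where "e \<in> L" "e * e = e" "\<And>x. x \<in> L \<Longrightarrow> e * x = x"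
proof -
  note ss = ssalgD[OF assms(1)]
  note A = subalgD[OF ss(1)] and L = right_idealD[OF assms(2)]
  let ?N = "\<lambda>e. {y\<in>L. e * y = 0}"
  let ?P = "\<lambda>U. \<exists>e\<in>L. e * e = e \<and> U = ?N e"
  have sN: "subspace (?N e)" if "e \<in> L" for e
    using subspace_right_annihilated[OF L(1)] A(3) L(2) that by blast
  have "?P (?N 0)" using subspace_0[OF L(1)] by force
  moreover have fdU: "subspace U \<and> fd U" if "?P U" for U
    using that sN L(2) fd_subset[OF ss(2)] by (metis (no_types, lifting) mem_Collect_eq subsetI)
  ultimately obtain U where U: "?P U" "\<And>W. ?P W \<Longrightarrow> W \<subseteq> U \<Longrightarrow> W = U"
    using minimal_subspace[of ?P "?N 0"] by blast
  then obtain e where e: "e \<in> L" "e * e = e" "U = ?N e" by blast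
  have N0: "y = 0" if "y \<in> ?N e" for y
  proof (rule ccontr)
    assume "y \<noteq> 0"
    from that have y: "y \<in> L" "e * y = 0" by auto
    obtain z where z: "z \<in> A" "y * z * y = y" using ssalg_regular[OF assms(1) L(2)[OF y(1)]] by blast
    define f where "f = y * z"
    have fL: "f \<in> L" using L y z by (simp add: f_def)
    have ef: "e * f = 0" unfolding f_def by (simp add: mult.assoc[symmetric] y)
    have ff: "f * f = f" unfolding f_def by (simp add: mult.assoc[symmetric] z)
    have f0: "f \<noteq> 0" using z \<open>y \<noteq> 0\<close> by (auto simp: f_def)
    define e' where "e' = e + f - f * e"
    have ef': "e * (f * x) = 0" for x by (simp add: mult.assoc[symmetric] ef)
    have e'L: "e' \<in> L" unfolding e'_def using e(1) fL L by (intro subspace_diff subspace_add) auto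
    have "e' * e' = e'"
      unfolding e'_def by (simp add: algebra_simps ef ef' ff e(2)) (simp add: mult.assoc[symmetric] ff e(2))
    moreover have e'e: "e * e' = e" unfolding e'_def by (simp add: algebra_simps ef ef' e(2))
    moreover have "?N e' \<subseteq> U"
    proof safe
      fix y assume y: "y \<in> L" "e' * y = 0"
      then have "(e * e') * y = 0" by (simp add: mult.assoc)
      then show "y \<in> U" using y e(3) e'e by simp
    qed
    ultimately have "?N e' = U" using U(2)[of "?N e'"] e'L by blast
    moreover have "e' * f = f" unfolding e'_def by (simp add: algebra_simps ef ff mult.assoc)
    ultimately show False using ef fL f0 e(3) by (metis (mono_tags, lifting) mem_Collect_eq)
  qed
  have "e * x = x" if "x \<in> L" for x
  proof -
    have "x - e * x \<in> ?N e"
      using that e L by (auto simp: right_diff_distrib mult.assoc[symmetric] intro!: subspace_diff)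
    with N0 show ?thesis by fastforce
  qed
  with e that show thesis by blast
qed

text \<open>Left and right identity of \<open>I\<close> coincide, and \<open>e\<close> is central
  because \<open>a * e\<close> and \<open>e * a\<close> lie in \<open>I\<close> and both equal
  \<open>e * a * e\<close>.\<close>

lemma ideal_central_unit:
  assumes "ssalg A" "left_ideal A I" "right_ideal A I"
  obtains e where "e \<in> I" "\<And>x. x \<in> I \<Longrightarrow> e * x = x" "\<And>x. x \<in> I \<Longrightarrow> x * e = x"
    "\<And>a. a \<in> A \<Longrightarrow> a * e = e * a"
proof -
  obtain e where e: "e \<in> I" "\<And>x. x \<in> I \<Longrightarrow> x * e = x"
    by (rule left_ideal_idempotent_generator[OF assms(1,2)]) blast
  obtain e' where e': "e' \<in> I" "\<And>x. x \<in> I \<Longrightarrow> e' * x = x"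
    by (rule right_ideal_idempotent_generator[OF assms(1,3)]) blast
  have "e' = e" using e e' by metis
  then have l: "e * x = x" if "x \<in> I" for x using e' that by blast
  have "a * e = e * a" if "a \<in> A" for a
    using l[of "a * e"] e(2)[of "e * a"] left_idealD(3)[OF assms(2) that e(1)]
      right_idealD(3)[OF assms(3) that e(1)] by (simp add: mult.assoc)
  with e l that show thesis by blast
qed

section \<open>Separability\<close>

text \<open>The centraliser of the scalars; in a ring of endomorphisms, the \<open>K\<close>-linear
  maps. Averaging is claimed for arguments in this set, which need not lie in the algebra over which
  one averages.\<close>

definition KC :: "'r set" where
  "KC = {x. \<forall>c. x * emb c = emb c * x}"

lemma KC_scl: "x \<in> KC \<Longrightarrow> x * scl c y = scl c (x * y)"
  by (simp add: KC_def scl_def mult.assoc[symmetric])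

lemma KC_mult: "x \<in> KC \<Longrightarrow> y \<in> KC \<Longrightarrow> x * y \<in> KC"
  unfolding KC_def by (simp, metis mult.assoc)

lemma KC_one: "1 \<in> KC"
  by (simp add: KC_def)

lemma KC_emb: "emb c \<in> KC"
  by (simp add: KC_def emb_mult[symmetric] mult.commute)

lemma subspace_KC: "subspace KC"
proof (rule subspaceI)
  fix c x assume "x \<in> KC"
  then show "scl c x \<in> KC" unfolding scl_def by (rule KC_mult[OF KC_emb])
qed (auto simp: KC_def algebra_simps)

lemma subalg_KC: "subalg A \<Longrightarrow> A \<subseteq> KC"
  by (auto simp: subalg_def KC_def)

lemma emb_as_scl: "emb c = scl c 1"
  by (simp add: scl_def)

lemma emb_zero [simp]: "emb 0 = 0"
  by (simp add: emb_as_scl)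

lemma subalg_span:
  assumes "\<And>g h. g \<in> G \<Longrightarrow> h \<in> G \<Longrightarrow> g * h \<in> span G" "G \<subseteq> KC"
  shows "subalg (span G)"
proof -
  have KC: "span G \<subseteq> KC" using assms(2) subspace_KC by (rule span_minimal)
  have gx: "g * x \<in> span G" if g: "g \<in> G" and x: "x \<in> span G" for g x
    using x
  proof (induction rule: span_induct_alt)
    case (step c h y)
    have "g \<in> KC" using assms(2) g by blast
    then show ?case using step assms(1)[OF g] KC_scl
      by (auto simp: distrib_left intro!: span_add span_scale)
  qed (simp add: span_zero)
  have "y * x \<in> span G" if y: "y \<in> span G" and x: "x \<in> span G" for y x
    using y
  proof (induction rule: span_induct_alt)
    case (step c h y)
    then show ?case using gx x by (auto simp: distrib_right intro!: span_add span_scale)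
  qed (simp add: span_zero)
  then show ?thesis using KC by (auto simp: subalg_def KC_def)
qed

section \<open>Multiplication operators on the ambient ring\<close>

definition embE :: "'k \<Rightarrow> 'r endo" where
  "embE c = Endo (scl c)"

lemma app_embE [simp]: "app (embE c) x = scl c x"
  unfolding embE_def by (subst app_Endo) (auto simp: scale_right_distrib)

text \<open>The additive operators on the ambient ring form a ring with scalars themselves, so all
  structure results above also hold for algebras of operators.\<close>

interpretation E: scalar_ring embE
  by unfold_locales (auto intro!: endo_eqI simp: scale_left_distrib scl_def emb_mult emb_one mult.assoc distrib_right emb_add)

lemma app_E_scl [simp]: "app (E.scl c T) x = scl c (app T x)"
  by (simp add: E.scl_def)

definition Lm :: "'r \<Rightarrow> 'r endo" where "Lm a = Endo (\<lambda>x. a * x)"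
definition Rm :: "'r \<Rightarrow> 'r endo" where "Rm a = Endo (\<lambda>x. x * a)"

lemma app_Lm [simp]: "app (Lm a) x = a * x"
  unfolding Lm_def by (subst app_Endo) (auto simp: distrib_left)

lemma app_Rm [simp]: "app (Rm a) x = x * a"
  unfolding Rm_def by (subst app_Endo) (auto simp: distrib_right)

text \<open>The image of \<open>C \<otimes> C\<^sup>o\<^sup>p\<close> in the additive endomorphisms of the ambient ring.\<close>
definition Mop :: "'r set \<Rightarrow> 'r endo set" where
  "Mop C = E.span {Lm a * Rm b |a b. a \<in> C \<and> b \<in> C}"

lemma LR_in_E_KC: "a \<in> KC \<Longrightarrow> Lm a * Rm b \<in> E.KC"
  by (auto simp: E.KC_def KC_scl mult.assoc intro!: endo_eqI)

lemma LR_in_Mop: "a \<in> C \<Longrightarrow> b \<in> C \<Longrightarrow> Lm a * Rm b \<in> Mop C"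
  unfolding Mop_def by (rule E.span_base) auto

lemma subalg_Mop:
  assumes "subalg C"
  shows "E.subalg (Mop C)"
  unfolding Mop_def
proof (rule E.subalg_span)
  fix g h assume "g \<in> {Lm a * Rm b |a b. a \<in> C \<and> b \<in> C}" "h \<in> {Lm a * Rm b |a b. a \<in> C \<and> b \<in> C}"
  then obtain a b a' b' where g: "g = Lm a * Rm b" "h = Lm a' * Rm b'"
    and in_C: "a \<in> C" "b \<in> C" "a' \<in> C" "b' \<in> C" by blast
  have "g * h = Lm (a * a') * Rm (b' * b)"
    unfolding g by (rule endo_eqI) (simp add: mult.assoc)
  then show "g * h \<in> E.span {Lm a * Rm b |a b. a \<in> C \<and> b \<in> C}"
    using in_C subalgD(2)[OF assms] by (auto intro!: E.span_base)
next
  show "{Lm a * Rm b |a b. a \<in> C \<and> b \<in> C} \<subseteq> E.KC"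
    using LR_in_E_KC subalg_KC[OF assms] by auto
qed

lemmas Mop_mult = E.subalgD(2)[OF subalg_Mop]

lemma Mop_explicit:
  assumes "subalg C" "T \<in> Mop C"
  obtains I :: "'r endo set" and a b where "finite I" "\<And>i. i \<in> I \<Longrightarrow> a i \<in> C" "\<And>i. i \<in> I \<Longrightarrow> b i \<in> C"
    "\<And>x. app T x = (\<Sum>i\<in>I. a i * x * b i)"
proof -
  obtain I r where I: "finite I" "I \<subseteq> {Lm a * Rm b |a b. a \<in> C \<and> b \<in> C}"
    "T = (\<Sum>i\<in>I. E.scl (r i) i)"
    using assms(2) unfolding Mop_def E.span_explicit by blast
  have "\<forall>i\<in>I. \<exists>a b. a \<in> C \<and> b \<in> C \<and> i = Lm a * Rm b" using I(2) by blast
  then obtain a b where ab: "\<And>i. i \<in> I \<Longrightarrow> a i \<in> C" "\<And>i. i \<in> I \<Longrightarrow> b i \<in> C"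
    "\<And>i. i \<in> I \<Longrightarrow> i = Lm (a i) * Rm (b i)" by metis
  have "app (E.scl (r i) i) x = scl (r i) (a i) * x * b i" if "i \<in> I" for i x
    by (subst ab(3)[OF that]) (simp add: mult.assoc)
  then have "app T x = (\<Sum>i\<in>I. scl (r i) (a i) * x * b i)" for x
    unfolding I(3) app_sum_left by (rule sum.cong[OF refl])
  moreover have "scl (r i) (a i) \<in> C" if "i \<in> I" for i
    using subspace_scale[OF subalgD(1)[OF assms(1)]] ab(1) that by blast
  ultimately show thesis using that[of I "\<lambda>i. scl (r i) (a i)" b] I(1) ab by blast
qed

lemma Mop_KC:
  assumes "subalg C" "T \<in> Mop C" "m \<in> KC"
  shows "app T m \<in> KC"
proof -
  obtain I :: "'r endo set" and a b where I: "finite I" "\<And>i. i \<in> I \<Longrightarrow> a i \<in> C" "\<And>i. i \<in> I \<Longrightarrow> b i \<in> C"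
    "\<And>x. app T x = (\<Sum>i\<in>I. a i * x * b i)" by (rule Mop_explicit[OF assms(1,2)]) blast
  then show ?thesis using subalg_KC[OF assms(1)] assms(3)
    by (auto intro!: subspace_sum[OF subspace_KC] KC_mult)
qed

lemma Mop_closed:
  assumes "subalg C" "T \<in> Mop C" "subspace M"
    "\<And>a m b. a \<in> C \<Longrightarrow> b \<in> C \<Longrightarrow> m \<in> M \<Longrightarrow> a * m * b \<in> M" "m \<in> M"
  shows "app T m \<in> M"
proof -
  obtain I :: "'r endo set" and a b where I: "finite I" "\<And>i. i \<in> I \<Longrightarrow> a i \<in> C" "\<And>i. i \<in> I \<Longrightarrow> b i \<in> C"
    "\<And>x. app T x = (\<Sum>i\<in>I. a i * x * b i)" by (rule Mop_explicit[OF assms(1,2)]) blast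
  then show ?thesis using assms by (auto intro!: subspace_sum)
qed

lemma Mop_commute:
  assumes "subalg C" "\<And>x y. x \<in> C \<Longrightarrow> y \<in> C \<Longrightarrow> x * y = y * x" "S \<in> Mop C" "T \<in> Mop C"
  shows "S * T = T * S"
proof -
  have 1: "Lm a * Rm b * T = T * (Lm a * Rm b)" if a: "a \<in> C" and b: "b \<in> C" for a b
  proof (rule endo_eqI)
    fix x
    obtain I :: "'r endo set" and a' b' where I: "finite I" "\<And>i. i \<in> I \<Longrightarrow> a' i \<in> C" "\<And>i. i \<in> I \<Longrightarrow> b' i \<in> C"
      "\<And>x. app T x = (\<Sum>i\<in>I. a' i * x * b' i)" by (rule Mop_explicit[OF assms(1,4)]) blast
    have "a * (a' i * x * b' i * b) = a' i * (a * (x * b)) * b' i" if i: "i \<in> I" for i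
    proof -
      have "a * (a' i * x * b' i * b) = (a * a' i) * x * (b' i * b)" by (simp add: mult.assoc)
      also have "\<dots> = (a' i * a) * x * (b * b' i)"
        using assms(2)[OF a I(2)[OF i]] assms(2)[OF b I(3)[OF i]] by simp
      finally show ?thesis by (simp add: mult.assoc)
    qed
    then show "app (Lm a * Rm b * T) x = app (T * (Lm a * Rm b)) x"
      by (simp add: I(4) sum_distrib_left sum_distrib_right)
  qed
  have KCT: "T \<in> E.KC" using E.subalg_KC[OF subalg_Mop[OF assms(1)]] assms(4) by blast
  show ?thesis using assms(3) unfolding Mop_def
  proof (induction rule: E.span_induct_alt)
    case (step c g y)
    then show ?case using 1 E.KC_scl[OF KCT] by (auto simp: distrib_left distrib_right)
  qed simp
qed

section \<open>Separability of commutative reduced algebras over a perfect field\<close>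

definition ev :: "'r \<Rightarrow> 'k poly \<Rightarrow> 'r" where
  "ev z p = fold_coeffs (\<lambda>a f. emb a + z * f) p 0"

lemma ev_0 [simp]: "ev z 0 = 0"
  by (simp add: ev_def)

lemma ev_pCons [simp]: "ev z (pCons a p) = emb a + z * ev z p"
  by (cases "a = 0 \<and> p = 0") (auto simp: ev_def)

lemma ev_add: "ev z (p + q) = ev z p + ev z q"
  by (induction p q rule: poly_induct2) (auto simp: emb_add algebra_simps)

lemma ev_smult: "z \<in> KC \<Longrightarrow> ev z (smult a p) = emb a * ev z p"
  by (induction p) (auto simp: emb_mult distrib_left KC_def mult.assoc[symmetric])

lemma ev_mult: "z \<in> KC \<Longrightarrow> ev z (p * q) = ev z p * ev z q"
  by (induction p) (auto simp: ev_add ev_smult distrib_right mult.assoc)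

lemma ev_1 [simp]: "ev z 1 = 1"
  by (simp add: one_pCons emb_one)

lemma ev_minus: "ev z (- p) = - ev z p"
proof -
  have "ev z (p + - p) = 0" by simp
  then show ?thesis unfolding ev_add by (simp add: eq_neg_iff_add_eq_0 add.commute)
qed

lemma ev_diff: "ev z (p - q) = ev z p - ev z q"
  using ev_add[of z p "- q"] by (simp add: ev_minus)

lemma ev_monom: "z \<in> KC \<Longrightarrow> ev z (monom a n) = scl a (z ^ n)"
  by (induction n) (auto simp: monom_0 monom_Suc emb_as_scl KC_scl)

lemma ev_in:
  assumes "subalg Z" "1 \<in> Z" "z \<in> Z"
  shows "ev z p \<in> Z"
proof (induction p)
  case (pCons a p)
  have "emb a \<in> Z" using subspace_scale[OF subalgD(1)[OF assms(1)] assms(2)] by (simp add: emb_as_scl)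
  then show ?case using pCons subalgD[OF assms(1)] assms(3) by (auto intro!: subspace_add)
qed (simp add: subspace_0 subalgD[OF assms(1)])

text \<open>The divided difference \<open>(p(X) - p(Y)) / (X - Y)\<close> at \<open>X = z \<otimes> 1\<close>, \<open>Y = 1 \<otimes> z\<close>.\<close>

lemma divided_difference:
  assumes "subalg Z" "1 \<in> Z" "z \<in> Z"
  shows "\<exists>T\<in>Mop Z. app T 1 = ev z (pderiv p) \<and>
    (\<forall>m\<in>KC. z * app T m - app T m * z = ev z p * m - m * ev z p)"
proof (induction p)
  case 0
  have "0 \<in> Mop Z" by (simp add: Mop_def E.span_zero)
  then show ?case by (intro bexI[of _ 0]) auto
next
  case (pCons a p)
  then obtain T where T: "T \<in> Mop Z" "app T 1 = ev z (pderiv p)"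
    "\<And>m. m \<in> KC \<Longrightarrow> z * app T m - app T m * z = ev z p * m - m * ev z p" by blast
  define e where "e = ev z p"
  have zKC: "z \<in> KC" using subalg_KC[OF assms(1)] assms(3) by blast
  have e: "e \<in> Z" unfolding e_def using ev_in assms by blast
  have ze: "z * e = e * z"
    using ev_mult[OF zKC, of "[:0, 1:]" p] ev_mult[OF zKC, of p "[:0, 1:]"]
    by (simp add: e_def emb_one mult.commute)
  \<comment> \<open>From \<open>X p(X) - Y p(Y) = (X - Y) p(X) + Y (p(X) - p(Y))\<close>; left
    multiplication plays \<open>X\<close>, right multiplication plays \<open>Y\<close>, and the
    constant \<open>a\<close> cancels.\<close>
  let ?S = "Lm e * Rm 1 + Lm 1 * Rm z * T"
  have "?S \<in> Mop Z"
    using E.subalgD(1)[OF subalg_Mop[OF assms(1)]] LR_in_Mop[OF e assms(2)]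
      LR_in_Mop[OF assms(2,3)] Mop_mult[OF assms(1) _ T(1)] by (auto intro!: E.subspace_add)
  moreover have "app ?S 1 = ev z (pderiv (pCons a p))"
  proof -
    have "app T 1 * z = z * app T 1"
      using T(3)[OF KC_one] by (simp add: e_def[symmetric])
    then show ?thesis by (simp add: pderiv_pCons ev_add T(2) e_def)
  qed
  moreover have "z * app ?S m - app ?S m * z = ev z (pCons a p) * m - m * ev z (pCons a p)"
    if m: "m \<in> KC" for m
  proof -
    have "z * app ?S m - app ?S m * z = z * (e * m) - e * m * z + (z * app T m - app T m * z) * z"
      by (simp add: algebra_simps)
    also have "\<dots> = z * (e * m) - m * (e * z)"
      by (simp add: T(3)[OF m] e_def[symmetric] algebra_simps)
    also have "\<dots> = ev z (pCons a p) * m - m * ev z (pCons a p)"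
      using m by (simp add: e_def[symmetric] KC_def algebra_simps ze[symmetric])
    finally show ?thesis .
  qed
  ultimately show ?case by blast
qed

lemma annihilating_poly:
  assumes "subalg Z" "1 \<in> Z" "fd Z" "z \<in> Z"
  obtains p where "p \<noteq> 0" "ev z p = 0"
proof -
  have zKC: "z \<in> KC" using subalg_KC[OF assms(1)] assms(4) by blast
  have pow: "z ^ n \<in> Z" for n
    using subalgD(2)[OF assms(1)] assms(2,4) by (induction n) auto
  show thesis
  \<comment> \<open>Linear dependence speaks about the set of powers, which is finite when powers
    repeat; then a difference of two monomials already annihilates \<open>z\<close>.\<close>
  proof (cases "inj (\<lambda>n. z ^ n)")
    case False
    then obtain i j where ij: "i \<noteq> j" "z ^ i = z ^ j" by (auto simp: inj_def)
    have "monom (1::'k) i - monom 1 j \<noteq> 0" using ij(1) by (metis monom_eq_iff' right_minus_eq zero_neq_one)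
    moreover have "ev z (monom (1::'k) i - monom 1 j) = 0"
      using ij(2) zKC by (simp add: ev_diff ev_monom)
    ultimately show thesis using that by blast
  next
    case True
    obtain S where S: "finite S" "Z \<subseteq> span S" using assms(3) by (auto simp: fd_def)
    have "infinite (range (\<lambda>n. z ^ n))" using True by (simp add: finite_image_iff)
    moreover have "range (\<lambda>n. z ^ n) \<subseteq> span S" using pow S(2) by blast
    ultimately have "dependent (range (\<lambda>n. z ^ n))" using independent_span_bound[OF S(1)] by blast
    then obtain t u where tu: "finite t" "t \<subseteq> range (\<lambda>n. z ^ n)" "(\<Sum>v\<in>t. scl (u v) v) = 0" "\<exists>v\<in>t. u v \<noteq> 0"
      by (auto simp: dependent_explicit)
    define N where "N = (\<lambda>n. z ^ n) -` t"
    have fN: "finite N" unfolding N_def using tu(1) True by (rule finite_vimageI)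
    have tN: "t = (\<lambda>n. z ^ n) ` N" using tu(2) by (auto simp: N_def)
    define p where "p = (\<Sum>n\<in>N. monom (u (z ^ n)) n)"
    have ev_sum: "ev z (sum f M) = (\<Sum>n\<in>M. ev z (f n))" for f and M :: "nat set"
      by (induction M rule: infinite_finite_induct) (auto simp: ev_add)
    have "ev z p = (\<Sum>n\<in>N. scl (u (z ^ n)) (z ^ n))"
      unfolding p_def ev_sum using zKC by (simp add: ev_monom)
    also have "\<dots> = (\<Sum>v\<in>t. scl (u v) v)"
      unfolding tN by (subst sum.reindex) (use True in \<open>auto simp: inj_on_def inj_def\<close>)
    finally have "ev z p = 0" using tu(3) by simp
    moreover obtain n where n: "n \<in> N" "u (z ^ n) \<noteq> 0" using tu(4) tN by auto
    have "coeff p n = u (z ^ n)" using n(1) fN by (simp add: p_def coeff_sum)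
    then have "p \<noteq> 0" using n(2) by auto
    ultimately show thesis using that by blast
  qed
qed

text \<open>For an annihilating \<open>p = q * q * s\<close> of least degree, \<open>q * s\<close>
  evaluates to an element of square zero, hence to zero; minimality of the degree makes
  \<open>q\<close> constant. So \<open>p\<close> is square-free, and perfectness does the
  rest.\<close>

lemma separable_annihilating_poly:
  assumes "perfect_field TYPE('k)" "subalg Z" "1 \<in> Z" "fd Z" "z \<in> Z"
    and reduced: "\<And>x. x \<in> Z \<Longrightarrow> x * x = 0 \<Longrightarrow> x = 0"
  obtains p where "ev z p = 0" "coprime p (pderiv p)"
proof -
  have zKC: "z \<in> KC" using subalg_KC[OF assms(2)] assms(5) by blast
  let ?P = "\<lambda>p. p \<noteq> 0 \<and> ev z p = 0"
  obtain p0 where "?P p0" using annihilating_poly[OF assms(2-5)] by blast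
  then obtain p where p: "?P p" "\<And>q. ?P q \<Longrightarrow> degree p \<le> degree q"
    using ex_has_least_nat[of ?P p0 degree] by blast
  have "coprime p (pderiv p)"
  proof (rule perfect_field_separable[OF assms(1)])
    show "p \<noteq> 0" using p(1) by blast
    fix q s assume qs: "p = q * q * s"
    have "ev z (q * s) * ev z (q * s) = ev z (p * s)"
      using ev_mult[OF zKC, of "q * s" "q * s"] by (simp add: qs algebra_simps)
    also have "\<dots> = 0" using p(1) by (simp add: ev_mult[OF zKC])
    finally have "ev z (q * s) = 0" using reduced ev_in[OF assms(2,3,5)] by blast
    moreover have nz: "q \<noteq> 0" "s \<noteq> 0" using p(1) qs by auto
    ultimately have "degree p \<le> degree (q * s)" using p(2) by simp
    then have "degree q = 0" using nz by (simp add: qs degree_mult_eq)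
    then show "is_unit q" using nz by (simp add: is_unit_iff_degree)
  qed
  with p that show thesis by blast
qed

text \<open>The divided difference \<open>D\<close> of \<open>p\<close> has values that commute with
  \<open>z\<close>, because \<open>p\<close> annihilates \<open>z\<close>, and it sends
  \<open>1\<close> to the value of \<open>pderiv p\<close> at \<open>z\<close>. The Bezout
  coefficient \<open>v\<close> evaluates to an inverse of that value and normalises
  \<open>D\<close>.\<close>

lemma commutative_averaging_one:
  assumes "perfect_field TYPE('k)" "subalg Z" "1 \<in> Z" "fd Z" "z \<in> Z"
    and "\<And>x. x \<in> Z \<Longrightarrow> x * x = 0 \<Longrightarrow> x = 0"
  obtains T where "T \<in> Mop Z" "app T 1 = 1" "\<And>m. m \<in> KC \<Longrightarrow> z * app T m = app T m * z"
proof -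
  have zKC: "z \<in> KC" using subalg_KC[OF assms(2)] assms(5) by blast
  obtain p where p: "ev z p = 0" "coprime p (pderiv p)"
    using separable_annihilating_poly[OF assms] by blast
  obtain u v where uv: "u * p + v * pderiv p = 1" using poly_bezout[OF p(2)] .
  obtain D where D: "D \<in> Mop Z" "app D 1 = ev z (pderiv p)"
    "\<And>m. m \<in> KC \<Longrightarrow> z * app D m - app D m * z = ev z p * m - m * ev z p"
    using divided_difference[OF assms(2,3,5)] by blast
  let ?T = "Lm (ev z v) * Rm 1 * D"
  have "?T \<in> Mop Z"
    by (rule Mop_mult[OF assms(2) LR_in_Mop[OF ev_in[OF assms(2,3,5)] assms(3)] D(1)])
  moreover have "app ?T 1 = 1"
  proof -
    have "ev z v * ev z (pderiv p) = ev z (u * p + v * pderiv p)"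
      by (simp add: ev_add ev_mult[OF zKC] p(1))
    then show ?thesis by (simp add: D(2) uv)
  qed
  moreover have "z * app ?T m = app ?T m * z" if "m \<in> KC" for m
  proof -
    have comm: "z * ev z v = ev z v * z"
      using ev_mult[OF zKC, of "[:0, 1:]" v] ev_mult[OF zKC, of v "[:0, 1:]"]
      by (simp add: emb_one mult.commute)
    have "z * app D m = app D m * z" using D(3)[OF that] p(1) by simp
    then show ?thesis by simp (metis comm mult.assoc)
  qed
  ultimately show thesis using that by blast
qed

text \<open>The operators for single elements are composed over a basis. As operators from
  \<open>Mop Z\<close> commute, any factor can be regarded as the outermost one, so the values of
  the composite commute with every basis element.\<close>

lemma commutative_averaging:
  assumes "perfect_field TYPE('k)" "subalg Z" "1 \<in> Z" "fd Z"
    and red: "\<And>x. x \<in> Z \<Longrightarrow> x * x = 0 \<Longrightarrow> x = 0"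
    and comm: "\<And>x y. x \<in> Z \<Longrightarrow> y \<in> Z \<Longrightarrow> x * y = y * x"
  obtains T where "T \<in> Mop Z" "app T 1 = 1" "\<And>z m. z \<in> Z \<Longrightarrow> m \<in> KC \<Longrightarrow> z * app T m = app T m * z"
proof -
  have *: "\<exists>T\<in>Mop Z. app T 1 = 1 \<and> (\<forall>z\<in>G. \<forall>m\<in>KC. z * app T m = app T m * z)"
    if "finite G" "G \<subseteq> Z" for G
    using that
  proof (induction G rule: finite_induct)
    case empty
    have "Lm 1 * Rm 1 \<in> Mop Z" using LR_in_Mop assms(3) by blast
    then show ?case by (intro bexI[of _ "Lm 1 * Rm 1"]) auto
  next
    case (insert z G)
    then obtain T where T: "T \<in> Mop Z" "app T 1 = 1"
      "\<And>z m. z \<in> G \<Longrightarrow> m \<in> KC \<Longrightarrow> z * app T m = app T m * z" by blast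
    obtain S where S: "S \<in> Mop Z" "app S 1 = 1" "\<And>m. m \<in> KC \<Longrightarrow> z * app S m = app S m * z"
      using commutative_averaging_one[OF assms(1-4) _ red, of z] insert.prems by blast
    have ST: "app S (app T m) = app T (app S m)" for m
      using Mop_commute[OF assms(2) comm S(1) T(1)] by (metis app_simps(6))
    have "\<forall>m\<in>KC. y * app (T * S) m = app (T * S) m * y" if "y \<in> insert z G" for y
    proof (cases "y = z")
      case True
      then show ?thesis using S(3) Mop_KC[OF assms(2) T(1)] by (simp add: ST[symmetric])
    next
      case False
      then show ?thesis using that T(3) Mop_KC[OF assms(2) S(1)] by simp
    qed
    then show ?case
      using Mop_mult[OF assms(2) T(1) S(1)] T(2) S(2) by (intro bexI[of _ "T * S"]) auto
  qed
  obtain B where B: "finite B" "B \<subseteq> Z" "span B = Z"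
    by (rule fd_basis[OF assms(4) subalgD(1)[OF assms(2)]]) blast
  obtain T where T: "T \<in> Mop Z" "app T 1 = 1" "\<And>z m. z \<in> B \<Longrightarrow> m \<in> KC \<Longrightarrow> z * app T m = app T m * z"
    using *[OF B(1,2)] by blast
  have "z * app T m = app T m * z" if z: "z \<in> Z" and m: "m \<in> KC" for z m
  proof -
    have "z \<in> span B" using z B by simp
    then show ?thesis
    proof (induction rule: span_induct_alt)
      case (step c x y)
      then show ?case using T(3)[OF _ m] KC_scl[OF Mop_KC[OF assms(2) T(1) m]]
        by (simp add: distrib_left distrib_right)
    qed simp
  qed
  with T that show thesis by blast
qed

section \<open>Separability over the centre by means of the multiplication algebra\<close>

lemma projection_onto:
  assumes "subspace C"
  obtains P :: "'r endo" where "\<And>x. app P x \<in> C" "\<And>x. x \<in> C \<Longrightarrow> app P x = x"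
    "\<And>c x. app P (scl c x) = scl c (app P x)"
proof -
  interpret vp: vector_space_pair scl scl ..
  obtain g where g: "range g \<subseteq> C" "Vector_Spaces.linear scl scl g" "\<And>x. x \<in> C \<Longrightarrow> g x = x"
    using vp.linear_exists_left_inverse_on[OF vector_space.linear_id[OF vector_space_axioms] assms] by auto
  interpret g: Vector_Spaces.linear scl scl g by (rule g(2))
  have "app (Endo g) = g" by (rule app_Endo) (rule g.add)
  with g g.scale that[of "Endo g"] show thesis by auto
qed

text \<open>The multiplication algebra of \<open>C\<close>, realised on the ambient ring by means of a projection \<open>P\<close> onto \<open>C\<close>.\<close>
definition EC :: "'r set \<Rightarrow> 'r endo \<Rightarrow> 'r endo set" where
  "EC C P = E.span {Lm a * Rm b * P |a b. a \<in> C \<and> b \<in> C}"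

context
  fixes C :: "'r set" and P :: "'r endo"
  assumes ss: "ssalg C" and one: "1 \<in> C"
    and P_in: "\<And>x. app P x \<in> C" and P_id: "\<And>x. x \<in> C \<Longrightarrow> app P x = x"
    and P_scl: "\<And>c x. app P (scl c x) = scl c (app P x)"
begin

lemmas C = subalgD[OF ssalgD(1)[OF ss]]

lemma C_KC: "x \<in> C \<Longrightarrow> x \<in> KC"
  using subalg_KC[OF ssalgD(1)[OF ss]] by blast

lemma EC_induct [consumes 1, case_names zero step]:
  assumes "T \<in> EC C P" "Q 0"
    "\<And>c a b S. a \<in> C \<Longrightarrow> b \<in> C \<Longrightarrow> S \<in> EC C P \<Longrightarrow> Q S \<Longrightarrow> Q (E.scl c (Lm a * Rm b * P) + S)"
  shows "Q T"
proof -
  have "T \<in> EC C P \<and> Q T" using assms(1) unfolding EC_def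
  proof (induction rule: E.span_induct_alt)
    case (step c x y)
    then obtain a b where "x = Lm a * Rm b * P" "a \<in> C" "b \<in> C" by blast
    then show ?case using step assms(3)[of a b y c] unfolding EC_def
      by (auto intro!: E.span_add E.span_scale intro: E.span_base)
  qed (auto simp: assms(2) E.span_zero)
  then show ?thesis by blast
qed

lemma EC_gen: "a \<in> C \<Longrightarrow> b \<in> C \<Longrightarrow> Lm a * Rm b * P \<in> EC C P"
  unfolding EC_def by (rule E.span_base) blast

lemma EC_app: "T \<in> EC C P \<Longrightarrow> app T x \<in> C"
  by (induction rule: EC_induct)
    (use C P_in in \<open>auto intro!: subspace_add subspace_scale simp: subspace_0\<close>)

lemma EC_P: "T \<in> EC C P \<Longrightarrow> T * P = T"
proof (induction rule: EC_induct)
  case (step c a b S)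
  have "P * P = P" by (rule endo_eqI) (simp add: P_id P_in)
  then show ?case using step by (simp add: distrib_right mult.assoc)
qed simp

lemma EC_zeroI: "T \<in> EC C P \<Longrightarrow> (\<And>x. x \<in> C \<Longrightarrow> app T x = 0) \<Longrightarrow> T = 0"
  by (rule endo_eqI) (metis EC_P P_in app_simps(1,6))

lemma subalg_EC: "E.subalg (EC C P)"
  unfolding EC_def
proof (rule E.subalg_span)
  fix g h assume "g \<in> {Lm a * Rm b * P |a b. a \<in> C \<and> b \<in> C}" "h \<in> {Lm a * Rm b * P |a b. a \<in> C \<and> b \<in> C}"
  then obtain a b a' b' where g: "g = Lm a * Rm b * P" "h = Lm a' * Rm b' * P"
    and in_C: "a \<in> C" "b \<in> C" "a' \<in> C" "b' \<in> C" by blast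
  have "g * h = Lm (a * a') * Rm (b' * b) * P"
    unfolding g by (rule endo_eqI) (simp add: P_id P_in C(2) in_C mult.assoc)
  then show "g * h \<in> E.span {Lm a * Rm b * P |a b. a \<in> C \<and> b \<in> C}"
    using in_C C(2) by (auto intro!: E.span_base)
next
  show "{Lm a * Rm b * P |a b. a \<in> C \<and> b \<in> C} \<subseteq> E.KC"
    by (auto simp: E.KC_def P_scl C(4) intro!: endo_eqI)
qed

lemma fd_EC: "E.fd (EC C P)"
proof -
  obtain B where B: "finite B" "B \<subseteq> C" "span B = C"
    by (rule fd_basis[OF ssalgD(2)[OF ss] C(1)]) blast
  define G where "G = (\<lambda>(a, b). Lm a * Rm b * P) ` (B \<times> B)"
  have 1: "Lm a * Rm b * P \<in> E.span G" if a: "a \<in> C" and b: "b \<in> B" for a b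
  proof -
    have "a \<in> span B" using a B by simp
    then show ?thesis
    proof (induction rule: span_induct_alt)
      case base
      have "Lm 0 * Rm b * P = 0" by (rule endo_eqI) simp
      then show ?case by (simp add: E.span_zero)
    next
      case (step c x y)
      have "Lm (scl c x + y) * Rm b * P = E.scl c (Lm x * Rm b * P) + Lm y * Rm b * P"
        by (rule endo_eqI) (simp add: distrib_right)
      moreover have "Lm x * Rm b * P \<in> E.span G"
        using step(1) b by (auto simp: G_def intro!: E.span_base)
      ultimately show ?case using step by (auto intro!: E.span_add E.span_scale)
    qed
  qed
  have 2: "Lm a * Rm b * P \<in> E.span G" if a: "a \<in> C" and b: "b \<in> C" for a b
  proof -
    have "b \<in> span B" using b B by simp
    then show ?thesis
    proof (induction rule: span_induct_alt)
      case base
      have "Lm a * Rm 0 * P = 0" by (rule endo_eqI) simp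
      then show ?case by (simp add: E.span_zero)
    next
      case (step c x y)
      have "Lm a * Rm (scl c x + y) * P = E.scl c (Lm a * Rm x * P) + Lm a * Rm y * P"
        by (rule endo_eqI) (simp add: distrib_left C(4) P_in a)
      then show ?case using step 1[OF a] by (auto intro!: E.span_add E.span_scale)
    qed
  qed
  have "EC C P \<subseteq> E.span G"
    unfolding EC_def by (rule E.span_minimal) (use 2 in auto)
  moreover have "finite G" using B(1) by (simp add: G_def)
  ultimately show ?thesis unfolding E.fd_def by blast
qed

lemma EC_central:
  assumes "T \<in> EC C P" "e \<in> C" "\<And>c. c \<in> C \<Longrightarrow> c * e = e * c" "x \<in> C"
  shows "app T (e * x) = e * app T x"
  using assms(1)
proof (induction rule: EC_induct)
  case (step c a b S)
  have "a * (e * x * b) = e * (a * (x * b))" using assms(3)[OF step(1)] by (metis mult.assoc)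
  then show ?case using step assms by (simp add: P_id C(2) distrib_left C(4))
qed simp

text \<open>Let \<open>N\<close> be a square-zero ideal of operators. The values of its elements on
  \<open>C\<close> span an ideal \<open>I\<close> of \<open>C\<close>, with a central unit
  \<open>e\<close>, and every \<open>n\<close> in \<open>N\<close> kills \<open>I\<close> because
  \<open>N\<close> has square zero. Operators commute with multiplication by \<open>e\<close>, so
  \<open>n x = e (n x) = n (e x) = 0\<close>, as \<open>e x\<close> lies in
  \<open>I\<close>.\<close>

lemma ssalg_EC: "E.ssalg (EC C P)"
  unfolding E.ssalg_def
proof (intro conjI subalg_EC fd_EC)
  show "E.square_free (EC C P)"
    unfolding E.square_free_def
  proof (intro allI impI subsetI, elim conjE)
    fix N n
    assume N: "E.left_ideal (EC C P) N" "E.right_ideal (EC C P) N" "\<forall>x\<in>N. \<forall>y\<in>N. x * y = 0" and n: "n \<in> N"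
    define G where "G = {app k x |k x. k \<in> N \<and> x \<in> C}"
    define I where "I = span G"
    have NE: "k \<in> EC C P" if "k \<in> N" for k using E.left_idealD(2)[OF N(1) that] .
    have IC: "I \<subseteq> C" unfolding I_def
      by (rule span_minimal[OF _ C(1)]) (auto simp: G_def NE EC_app)
    have cG: "c * g \<in> G \<and> g * c \<in> G" if c: "c \<in> C" and g: "g \<in> G" for c g
    proof -
      obtain k x where k: "g = app k x" "k \<in> N" "x \<in> C" using g by (auto simp: G_def)
      have "Lm c * Rm 1 * P * k \<in> N" "Lm 1 * Rm c * P * k \<in> N"
        using E.left_idealD(3)[OF N(1) EC_gen k(2)] c one by auto
      moreover have "c * g = app (Lm c * Rm 1 * P * k) x" "g * c = app (Lm 1 * Rm c * P * k) x"
        using k NE EC_app by (simp_all add: P_id)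
      ultimately show ?thesis using k(3) unfolding G_def by blast
    qed
    have ideal: "left_ideal C I \<and> right_ideal C I"
      unfolding left_ideal_def right_ideal_def
    proof (intro conjI ballI IC)
      fix a x assume a: "a \<in> C" and "x \<in> I"
      from this(2) have "a * x \<in> I \<and> x * a \<in> I" unfolding I_def
      proof (induction rule: span_induct_alt)
        case (step c g y)
        then show ?case using cG[OF a] C(4)[OF a]
          by (auto simp: distrib_left distrib_right intro!: span_add span_scale intro: span_base)
      qed (simp add: span_zero)
      then show "a * x \<in> I" "x * a \<in> I" by auto
    qed (simp_all add: I_def)
    then obtain e where e: "e \<in> I" "\<And>x. x \<in> I \<Longrightarrow> e * x = x" "\<And>a. a \<in> C \<Longrightarrow> a * e = e * a"
      using ideal_central_unit[OF ss] by metis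
    have nI: "app n y = 0" if "y \<in> I" for y
      using that unfolding I_def
    proof (induction rule: span_induct_alt)
      case (step c g y)
      then obtain k x where k: "g = app k x" "k \<in> N" by (auto simp: G_def)
      have "n * k = 0" using N(3) n k(2) by blast
      then have "app n g = 0" unfolding k(1) by (metis app_simps(1,6))
      moreover have "app n (scl c g) = scl c (app n g)"
        using E.KC_scl[of n] E.subalg_KC[OF subalg_EC] NE[OF n]
        by (metis E.subalgD(3) app_embE app_simps(6) subalg_EC)
      ultimately show ?case using step by simp
    qed simp
    have "app n x = 0" if x: "x \<in> C" for x
    proof -
      have "app n x \<in> I" unfolding I_def by (rule span_base) (use n x in \<open>auto simp: G_def\<close>)
      then have "app n x = app n (e * x)"
        using e(2) EC_central[OF NE[OF n] _ e(3) x] e(1) IC by auto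
      moreover have "e * x \<in> I" using right_idealD(3)[OF _ x e(1)] ideal by blast
      ultimately show ?thesis using nI by simp
    qed
    then show "n \<in> {0}" using EC_zeroI[OF NE[OF n]] by simp
  qed
qed

text \<open>Dropping the projection gives an operator with the same values on \<open>C\<close> that
  acts on the whole ambient ring by the sums \<open>a * x * b\<close>. Two choices differ by an
  operator that vanishes on \<open>C\<close>, which \<open>Mop_vanish\<close> controls.\<close>

lemma EC_Mop:
  assumes "T \<in> EC C P"
  shows "\<exists>S\<in>Mop C. T = S * P"
  using assms
proof (induction rule: EC_induct)
  case zero
  have "0 \<in> Mop C" by (simp add: Mop_def E.span_zero)
  then show ?case by (intro bexI[of _ 0]) auto
next
  case (step c a b S)
  then obtain S' where S': "S' \<in> Mop C" "S = S' * P" by blast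
  have "E.scl c (Lm a * Rm b) + S' \<in> Mop C"
    using LR_in_Mop[OF step(1,2)] S'(1) unfolding Mop_def by (intro E.span_add E.span_scale)
  moreover have "E.scl c (Lm a * Rm b * P) + S = (E.scl c (Lm a * Rm b) + S') * P"
    by (simp add: S'(2) distrib_right mult.assoc)
  ultimately show ?case by blast
qed

text \<open>The operators with values in the centre of \<open>C\<close>; they serve as coordinate
  forms of \<open>C\<close> over its centre.\<close>

definition EH :: "'r endo set" where
  "EH = {T \<in> EC C P. \<forall>c\<in>C. \<forall>x. c * app T x = app T x * c}"

text \<open>The left ideal of operators that kill \<open>1\<close> has an idempotent generator
  \<open>e\<close>, and \<open>P - e\<close> is the desired operator. Indeed
  \<open>Lm c - Rm c\<close>, restricted to \<open>C\<close>, kills \<open>1\<close>, so it is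
  unchanged by composition with \<open>e\<close> and is therefore killed by composition with
  \<open>P - e\<close>.\<close>

lemma central_projection:
  obtains T where "T \<in> EH" "app T 1 = 1"
proof -
  let ?K = "{T \<in> EC C P. app T 1 = 0}"
  note EC = E.subalgD[OF subalg_EC]
  have K: "E.left_ideal (EC C P) ?K"
    using EC(1,2) by (auto simp: E.left_ideal_def E.subspace_def)
  obtain e where e: "e \<in> ?K" "\<And>T. T \<in> ?K \<Longrightarrow> T * e = T"
    by (rule E.left_ideal_idempotent_generator[OF ssalg_EC K]) blast
  let ?T = "Lm 1 * Rm 1 * P - e"
  have T: "?T \<in> EC C P" using e(1) EC(1) EC_gen[OF one one] by (auto intro!: E.subspace_diff)
  have "c * app ?T x = app ?T x * c" if c: "c \<in> C" for c x
  proof -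
    let ?D = "Lm c * Rm 1 * P - Lm 1 * Rm c * P"
    have D: "?D \<in> EC C P" using EC(1) EC_gen c one by (auto intro!: E.subspace_diff)
    then have "?D \<in> ?K" using one by (simp add: P_id)
    then have "?D * e = ?D" using e(2) by blast
    moreover have "?D * (Lm 1 * Rm 1 * P) = ?D"
      by (rule endo_eqI) (simp add: P_id P_in)
    ultimately have "?D * ?T = 0" by (simp add: right_diff_distrib)
    moreover define y where "y = app ?T x"
    ultimately have "app ?D y = 0" by (metis app_simps(1,6))
    moreover have "app P y = y" unfolding y_def by (rule P_id[OF EC_app[OF T]])
    ultimately show ?thesis unfolding y_def[symmetric] by simp
  qed
  with T have "?T \<in> EH" by (auto simp: EH_def)
  moreover have "app ?T 1 = 1" using e(1) one by (simp add: P_id)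
  ultimately show thesis using that by blast
qed

text \<open>A dual basis of \<open>C\<close> over its centre with coordinate forms in the multiplication algebra. The span is
  a two-sided ideal of that algebra, and its unit fixes \<open>1\<close> and commutes with left multiplications.\<close>

lemma dual_basis: "P \<in> E.span {Lm e * T |e T. e \<in> C \<and> T \<in> EH}"
proof -
  let ?G = "{Lm e * T |e T. e \<in> C \<and> T \<in> EH}"
  let ?H = "E.span ?G"
  note EC = E.subalgD[OF subalg_EC]
  have LE: "Lm e * T = Lm e * Rm 1 * P * T" if "e \<in> C" "T \<in> EC C P" for e T
    by (rule endo_eqI) (simp add: P_id EC_app[OF that(2)])
  have GE: "?G \<subseteq> EC C P"
  proof safe
    fix e T assume *: "e \<in> C" "T \<in> EH"
    then have "T \<in> EC C P" by (simp add: EH_def)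
    then show "Lm e * T \<in> EC C P" using LE[OF *(1)] EC(2)[OF EC_gen[OF *(1) one]] by simp
  qed
  have HE: "?H \<subseteq> EC C P" using GE EC(1) by (rule E.span_minimal)
  have SG: "S * g \<in> ?H" if S: "S \<in> EC C P" and g: "g \<in> ?G" for S g
    using S
  proof (induction rule: EC_induct)
    case zero show ?case by (simp add: E.span_zero)
  next
    case (step c a b S)
    obtain e T where eT: "g = Lm e * T" "e \<in> C" "T \<in> EH" using g by blast
    \<comment> \<open>The values of \<open>T\<close> are central, so \<open>b\<close> moves past
      them into the coefficient.\<close>
    have "Lm a * Rm b * P * g = Lm (a * e * b) * T"
    proof (rule endo_eqI)
      fix x
      have "app T x * b = b * app T x" "app T x \<in> C" using eT(3) step(2) EC_app by (auto simp: EH_def)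
      then show "app (Lm a * Rm b * P * g) x = app (Lm (a * e * b) * T) x"
        using eT(2) C(2) by (simp add: eT(1) P_id mult.assoc)
    qed
    moreover have "Lm (a * e * b) * T \<in> ?H"
      using eT step C(2) by (intro E.span_base) blast
    ultimately show ?case using step by (auto simp: distrib_right intro!: E.span_add E.span_scale)
  qed
  have gS: "g * S \<in> ?H" if S: "S \<in> EC C P" and g: "g \<in> ?G" for S g
  proof -
    obtain e T where eT: "g = Lm e * T" "e \<in> C" "T \<in> EH" using g by blast
    have "T * S \<in> EH" using eT(3) S EC(2) by (auto simp: EH_def)
    then show ?thesis unfolding eT(1) mult.assoc using eT(2) by (intro E.span_base) blast
  qed
  have lH: "E.left_ideal (EC C P) ?H"
    unfolding E.left_ideal_def
  proof (intro conjI ballI HE)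
    fix S h assume S: "S \<in> EC C P" and "h \<in> ?H"
    from this(2) show "S * h \<in> ?H"
    proof (induction rule: E.span_induct_alt)
      case (step c g y)
      then show ?case using SG[OF S] EC(4)[OF S]
        by (simp add: distrib_left E.span_add E.span_scale)
    qed (simp add: E.span_zero)
  qed simp
  have rH: "E.right_ideal (EC C P) ?H"
    unfolding E.right_ideal_def
  proof (intro conjI ballI HE)
    fix S h assume S: "S \<in> EC C P" and "h \<in> ?H"
    from this(2) show "h * S \<in> ?H"
    proof (induction rule: E.span_induct_alt)
      case (step c g y)
      then show ?case using gS[OF S]
        by (simp add: distrib_right E.span_add E.span_scale)
    qed (simp add: E.span_zero)
  qed simp
  obtain e where e: "e \<in> ?H" "\<And>h. h \<in> ?H \<Longrightarrow> e * h = h" "\<And>S. S \<in> EC C P \<Longrightarrow> S * e = e * S"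
    by (rule E.ideal_central_unit[OF ssalg_EC lH rH]) blast
  obtain T where T: "T \<in> EH" "app T 1 = 1" using central_projection .
  have "Lm 1 * T \<in> ?H" using T(1) one by (intro E.span_base) blast
  moreover have "Lm 1 * T = T" by (rule endo_eqI) simp
  ultimately have "e * T = T" using e(2) by simp
  then have e1: "app e 1 = 1" using T(2) by (metis app_simps(6))
  have eE: "e \<in> EC C P" using e(1) HE by blast
  have "app e x = x" if x: "x \<in> C" for x
  proof -
    have "app e (app (Lm x * Rm 1 * P) 1) = app (Lm x * Rm 1 * P) (app e 1)"
      using e(3)[OF EC_gen[OF x one]] by (metis app_simps(6))
    then show ?thesis using one by (simp add: P_id e1)
  qed
  then have "e * P = P" by (intro endo_eqI) (simp add: P_in)
  then show ?thesis using e(1) EC_P[OF eE] by simp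
qed

text \<open>\<open>C \<otimes>\<^sub>Z C\<^sup>o\<^sup>p\<close> acts faithfully on \<open>C\<close>, where \<open>Z\<close> is the centre of \<open>C\<close>.\<close>

lemma Mop_vanish:
  assumes T: "T \<in> Mop C" and T0: "\<And>x. x \<in> C \<Longrightarrow> app T x = 0"
    and m: "m \<in> KC" and mz: "\<And>z. z \<in> C \<Longrightarrow> (\<And>c. c \<in> C \<Longrightarrow> c * z = z * c) \<Longrightarrow> z * m = m * z"
  shows "app T m = 0"
proof -
  obtain I :: "'r endo set" and a b where I: "finite I" "\<And>i. i \<in> I \<Longrightarrow> a i \<in> C" "\<And>i. i \<in> I \<Longrightarrow> b i \<in> C"
    "\<And>x. app T x = (\<Sum>i\<in>I. a i * x * b i)" by (rule Mop_explicit[OF ssalgD(1)[OF ss] T]) blast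
  \<comment> \<open>Vanishing on \<open>C\<close> is transferred from the operator to its
    coefficients: for \<open>S\<close> of the form \<open>x \<mapsto> p * x * q\<close>, the sum is
    the value of \<open>T\<close> at \<open>p\<close>, times \<open>q\<close>.\<close>
  have 1: "(\<Sum>i\<in>I. a i * app S (b i)) = 0" if "S \<in> EC C P" for S
    using that
  proof (induction rule: EC_induct)
    case (step c p q S)
    have "(\<Sum>i\<in>I. a i * scl c (p * (b i * q))) = scl c ((\<Sum>i\<in>I. a i * p * b i) * q)"
      unfolding sum_distrib_right scale_sum_right
      by (rule sum.cong) (auto simp: C(4) I(2) mult.assoc)
    also have "\<dots> = 0" using T0[OF step(1)] I(4) by simp
    finally show ?case using step(4) by (simp add: distrib_left sum.distrib P_id I(3))
  qed simp
  \<comment> \<open>For \<open>Lm e * S\<close> with \<open>S\<close> in \<open>EH\<close>, the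
    central value \<open>app S (b i)\<close> commutes with \<open>m\<close> and \<open>e\<close>,
    which leaves the sum of the first claim, multiplied by \<open>m * e\<close>. The dual basis
    expansion of \<open>P\<close> then recovers \<open>b i\<close> itself.\<close>
  have 2: "(\<Sum>i\<in>I. a i * m * app S (b i)) = 0" if "S \<in> E.span {Lm e * T |e T. e \<in> C \<and> T \<in> EH}" for S
    using that
  proof (induction rule: E.span_induct_alt)
    case (step c g y)
    then obtain e S where eS: "g = Lm e * S" "e \<in> C" "S \<in> EH" by blast
    have SE: "S \<in> EC C P" using eS(3) by (simp add: EH_def)
    have "a i * m * scl c (e * app S (b i)) = scl c (a i * app S (b i) * m * e)" if i: "i \<in> I" for i
    proof -
      have "a i * m \<in> KC" using KC_mult[OF C_KC m] I(2) i by blast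
      then have "a i * m * scl c (e * app S (b i)) = scl c (a i * m * (e * app S (b i)))" by (rule KC_scl)
      moreover have "e * app S (b i) = app S (b i) * e" using eS by (simp add: EH_def)
      moreover have "app S (b i) * m = m * app S (b i)"
        using eS(3) EC_app[OF SE] by (intro mz) (auto simp: EH_def)
      ultimately show ?thesis by (metis mult.assoc)
    qed
    then have "(\<Sum>i\<in>I. a i * m * scl c (e * app S (b i))) = scl c ((\<Sum>i\<in>I. a i * app S (b i)) * m * e)"
      unfolding sum_distrib_right scale_sum_right by (rule sum.cong[OF refl])
    then show ?case using step 1[OF SE] by (simp add: eS(1) distrib_left sum.distrib)
  qed simp
  have "(\<Sum>i\<in>I. a i * m * b i) = 0" using 2[OF dual_basis] by (simp add: P_id I(3))
  then show ?thesis using I(4) by simp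
qed

text \<open>A lift \<open>T\<close> of the central projection to \<open>Mop C\<close> has central
  values on \<open>C\<close>, so \<open>Lm c * T - Rm c * T\<close> vanishes there; by faithfulness
  it vanishes on every \<open>m\<close> that commutes with the centre.\<close>

lemma centre_averaging:
  obtains T where "T \<in> Mop C" "app T 1 = 1"
    "\<And>m c. m \<in> KC \<Longrightarrow> \<forall>z\<in>C. (\<forall>c\<in>C. c * z = z * c) \<longrightarrow> z * m = m * z \<Longrightarrow>
       c \<in> C \<Longrightarrow> c * app T m = app T m * c"
proof -
  obtain S where S: "S \<in> EH" "app S 1 = 1" using central_projection .
  obtain T where T: "T \<in> Mop C" "S = T * P" using EC_Mop[of S] S(1) unfolding EH_def by blast
  have "c * app T m = app T m * c"
    if m: "m \<in> KC" "\<forall>z\<in>C. (\<forall>c\<in>C. c * z = z * c) \<longrightarrow> z * m = m * z" and c: "c \<in> C" for m c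
  proof -
    let ?D = "(Lm c * Rm 1 - Lm 1 * Rm c) * T"
    have "Lm c * Rm 1 - Lm 1 * Rm c \<in> Mop C"
      using E.subalgD(1)[OF subalg_Mop[OF ssalgD(1)[OF ss]]] LR_in_Mop c one by (auto intro!: E.subspace_diff)
    then have "?D \<in> Mop C" using Mop_mult[OF ssalgD(1)[OF ss] _ T(1)] by blast
    moreover have "app ?D x = 0" if "x \<in> C" for x
    proof -
      have "app T x = app S x" using that by (simp add: T(2) P_id)
      then show ?thesis using S(1) c by (simp add: EH_def)
    qed
    ultimately have "app ?D m = 0" using Mop_vanish m by blast
    then show ?thesis by simp
  qed
  moreover have "app T 1 = 1" using S(2) one by (simp add: T(2) P_id)
  ultimately show thesis using that T(1) by blast
qed

end

text \<open>Averaging over the centre \<open>Z\<close> makes the argument commute with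
  \<open>Z\<close>, which is exactly what the second averaging requires.\<close>

theorem averaging:
  assumes "perfect_field TYPE('k)" "ssalg C" "1 \<in> C"
  obtains T where "T \<in> Mop C" "app T 1 = 1" "\<And>c m. c \<in> C \<Longrightarrow> m \<in> KC \<Longrightarrow> c * app T m = app T m * c"
proof -
  note C = subalgD[OF ssalgD(1)[OF assms(2)]]
  define Z where "Z = {z\<in>C. \<forall>c\<in>C. c * z = z * c}"
  have CKC: "C \<subseteq> KC" using subalg_KC[OF ssalgD(1)[OF assms(2)]] .
  have Z: "subalg Z"
    unfolding subalg_def
  proof (intro conjI ballI allI)
    show "subspace Z" unfolding Z_def using C by (auto simp: subspace_def distrib_left distrib_right)
    fix x y assume xy: "x \<in> Z" "y \<in> Z"
    have "c * (x * y) = x * y * c" if c: "c \<in> C" for c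
    proof -
      have "c * x = x * c" "c * y = y * c" using xy c by (auto simp: Z_def)
      then show ?thesis by (metis mult.assoc)
    qed
    moreover have "x \<in> C" "y \<in> C" using xy unfolding Z_def by blast+
    then have "x * y \<in> C" by (rule C(2))
    ultimately show "x * y \<in> Z" unfolding Z_def by blast
  next
    fix x c assume "x \<in> Z"
    then have "x \<in> C" by (simp add: Z_def)
    then show "x * emb c = emb c * x" by (rule C(3))
  qed
  have ZC: "Z \<subseteq> C" by (auto simp: Z_def)
  have Z1: "1 \<in> Z" using assms(3) by (simp add: Z_def)
  \<comment> \<open>A central element of square zero generates the ideal \<open>Cx\<close>, again of
    square zero.\<close>
  have red: "x = 0" if x: "x \<in> Z" "x * x = 0" for x
  proof -
    let ?I = "(\<lambda>y. y * x) ` C"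
    have xc: "c * x = x * c" if "c \<in> C" for c using x(1) that by (simp add: Z_def)
    have xC: "x \<in> C" using x(1) ZC by blast
    have l: "left_ideal C ?I"
      using subspace_right_mult[OF C(1)] C(2) xC by (auto simp: left_ideal_def mult.assoc[symmetric])
    moreover have r: "right_ideal C ?I"
      unfolding right_ideal_def
    proof (intro conjI ballI)
      fix a y assume a: "a \<in> C" and "y \<in> ?I"
      then obtain b where "y = b * x" "b \<in> C" by blast
      then have "y * a = (b * a) * x" "b * a \<in> C" using xc[OF a] C(2) a by (auto simp: mult.assoc)
      then show "y * a \<in> ?I" by blast
    qed (use l in \<open>auto simp: left_ideal_def\<close>)
    moreover have "y * y' = 0" if y: "y \<in> ?I" "y' \<in> ?I" for y y'
    proof -
      obtain b b' where b: "y = b * x" "y' = b' * x" "b' \<in> C" using y by blast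
      then have "y * y' = b * (x * x) * b'" using xc[of b'] by (simp add: mult.assoc)
      then show ?thesis using x(2) by simp
    qed
    moreover have "x \<in> ?I" using assms(3) by (force intro: image_eqI[of _ _ 1])
    ultimately show ?thesis using square_freeD[OF ssalgD(3)[OF assms(2)]] by blast
  qed
  have comm: "x * y = y * x" if "x \<in> Z" "y \<in> Z" for x y using that unfolding Z_def by blast
  obtain S where S: "S \<in> Mop Z" "app S 1 = 1" "\<And>z m. z \<in> Z \<Longrightarrow> m \<in> KC \<Longrightarrow> z * app S m = app S m * z"
    using commutative_averaging[OF assms(1) Z Z1 fd_subset[OF ssalgD(2)[OF assms(2)] ZC] red comm] by blast
  obtain P where P: "\<And>x. app P x \<in> C" "\<And>x. x \<in> C \<Longrightarrow> app P x = x" "\<And>c x. app P (scl c x) = scl c (app P x)"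
    by (rule projection_onto[OF C(1)]) blast
  obtain T where T: "T \<in> Mop C" "app T 1 = 1"
    "\<And>m c. m \<in> KC \<Longrightarrow> \<forall>z\<in>C. (\<forall>c\<in>C. c * z = z * c) \<longrightarrow> z * m = m * z \<Longrightarrow>
       c \<in> C \<Longrightarrow> c * app T m = app T m * c"
    by (rule centre_averaging[OF assms(2,3) P]) (assumption, rule that)
  have "Mop Z \<subseteq> Mop C" unfolding Mop_def using ZC by (intro E.span_mono) blast
  then have "T * S \<in> Mop C" using Mop_mult[OF ssalgD(1)[OF assms(2)] T(1)] S(1) by blast
  moreover have "app (T * S) 1 = 1" using S(2) T(2) by simp
  moreover have "c * app (T * S) m = app (T * S) m * c" if c: "c \<in> C" and m: "m \<in> KC" for c m
    unfolding app_simps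
  proof (rule T(3)[OF Mop_KC[OF Z S(1) m] _ c], intro ballI impI)
    fix z assume "z \<in> C" "\<forall>c\<in>C. c * z = z * c"
    then have "z \<in> Z" unfolding Z_def by blast
    then show "z * app S m = app S m * z" using S(3) m by blast
  qed
  ultimately show thesis using that by blast
qed

section \<open>Extensions inside an ambient ring\<close>

definition loc_ss :: "'r set \<Rightarrow> bool" where
  "loc_ss J \<longleftrightarrow> (\<forall>X. finite X \<and> X \<subseteq> J \<longrightarrow> (\<exists>T. ssalg T \<and> X \<subseteq> T \<and> T \<subseteq> J))"

lemma loc_ssD:
  assumes "loc_ss J" "finite X" "X \<subseteq> J"
  obtains T where "ssalg T" "X \<subseteq> T" "T \<subseteq> J"
  using assms unfolding loc_ss_def by blast

text \<open>That \<open>g\<close> lies in the span of \<open>XJ\<close> is as important as fixing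
  \<open>X\<close>: whenever left multiplication by \<open>w\<close> preserves this span,
  \<open>g * (w * g) = w * g\<close> follows.\<close>

lemma left_identity_idempotent:
  assumes "loc_ss J" "finite X" "X \<subseteq> J"
  obtains g where "g \<in> J" "g * g = g" "g \<in> span {x * j |x j. x \<in> X \<and> j \<in> J}" "\<And>x. x \<in> X \<Longrightarrow> g * x = x"
proof -
  obtain T where T: "ssalg T" "X \<subseteq> T" "T \<subseteq> J" using loc_ssD[OF assms] .
  note TA = subalgD[OF ssalgD(1)[OF T(1)]]
  obtain u where u: "u \<in> T" "\<And>x. x \<in> T \<Longrightarrow> x * u = x" by (rule ssalg_unit[OF T(1)]) blast
  let ?G = "{x * j |x j. x \<in> X \<and> j \<in> T}"
  have R: "right_ideal T (span ?G)"
    unfolding right_ideal_def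
  proof (intro conjI ballI)
    show "span ?G \<subseteq> T" by (rule span_minimal[OF _ TA(1)]) (use T(2) TA(2) in blast)
    fix a v assume a: "a \<in> T" and "v \<in> span ?G"
    from this(2) show "v * a \<in> span ?G"
    proof (induction rule: span_induct_alt)
      case (step c g y)
      then obtain x j where "g = x * j" "x \<in> X" "j \<in> T" by blast
      moreover from this have "j * a \<in> T" using TA(2) a by blast
      ultimately have "g * a \<in> ?G" using mult.assoc by blast
      then show ?case using step by (auto simp: distrib_right intro!: span_add span_scale intro: span_base)
    qed (simp add: span_zero)
  qed simp
  obtain g where g: "g \<in> span ?G" "g * g = g" "\<And>x. x \<in> span ?G \<Longrightarrow> g * x = x"
    by (rule right_ideal_idempotent_generator[OF T(1) R]) blast
  have "g \<in> J" using g(1) right_idealD(2)[OF R] T(3) by blast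
  moreover have "span ?G \<subseteq> span {x * j |x j. x \<in> X \<and> j \<in> J}" by (rule span_mono) (use T(3) in blast)
  moreover have "g * x = x" if x: "x \<in> X" for x
  proof (rule g(3), rule span_base)
    have "x = x * u" using u(2) T(2) x by auto
    then show "x \<in> ?G" using u(1) x by blast
  qed
  ultimately show thesis using that[of g] g(1,2) by blast
qed

lemma right_identity_idempotent:
  assumes "loc_ss J" "finite X" "X \<subseteq> J"
  obtains g where "g \<in> J" "g * g = g" "g \<in> span {j * x |x j. x \<in> X \<and> j \<in> J}" "\<And>x. x \<in> X \<Longrightarrow> x * g = x"
proof -
  obtain T where T: "ssalg T" "X \<subseteq> T" "T \<subseteq> J" using loc_ssD[OF assms] .
  note TA = subalgD[OF ssalgD(1)[OF T(1)]]
  obtain u where u: "u \<in> T" "\<And>x. x \<in> T \<Longrightarrow> u * x = x" by (rule ssalg_unit[OF T(1)]) blast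
  let ?G = "{j * x |x j. x \<in> X \<and> j \<in> T}"
  have R: "left_ideal T (span ?G)"
    unfolding left_ideal_def
  proof (intro conjI ballI)
    show "span ?G \<subseteq> T" by (rule span_minimal[OF _ TA(1)]) (use T(2) TA(2) in blast)
    fix a v assume a: "a \<in> T" and "v \<in> span ?G"
    from this(2) show "a * v \<in> span ?G"
    proof (induction rule: span_induct_alt)
      case (step c g y)
      then obtain x j where "g = j * x" "x \<in> X" "j \<in> T" by blast
      moreover from this have "a * j \<in> T" using TA(2) a by blast
      ultimately have "a * g \<in> ?G" using mult.assoc[symmetric] by blast
      then show ?case using step TA(4)[OF a]
        by (auto simp: distrib_left intro!: span_add span_scale intro: span_base)
    qed (simp add: span_zero)
  qed simp
  obtain g where g: "g \<in> span ?G" "g * g = g" "\<And>x. x \<in> span ?G \<Longrightarrow> x * g = x"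
    by (rule left_ideal_idempotent_generator[OF T(1) R]) blast
  have "g \<in> J" using g(1) left_idealD(2)[OF R] T(3) by blast
  moreover have "span ?G \<subseteq> span {j * x |x j. x \<in> X \<and> j \<in> J}" by (rule span_mono) (use T(3) in blast)
  moreover have "x * g = x" if x: "x \<in> X" for x
  proof (rule g(3), rule span_base)
    have "x = u * x" using u(2) T(2) x by auto
    then show "x \<in> ?G" using u(1) x by blast
  qed
  ultimately show thesis using that[of g] g(1,2) by blast
qed

text \<open>With \<open>W\<close> a linear complement of \<open>J\<close> in \<open>A\<close> and \<open>g\<close> an idempotent generating the right ideal
  spanned by the defects \<open>xy - s(xy)\<close>, where \<open>s\<close> is the projection to \<open>W\<close>, the space
  \<open>(1 - g)W\<close> is closed under multiplication.\<close>

lemma lift_quotient: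
  assumes A: "subalg A" and J: "left_ideal A J" "right_ideal A J" "loc_ss J"
    and G: "finite G" "A \<subseteq> span (G \<union> J)"
    and ssq: "\<And>I. left_ideal A I \<Longrightarrow> right_ideal A I \<Longrightarrow> J \<subseteq> I \<Longrightarrow> (\<And>x y. x \<in> I \<Longrightarrow> y \<in> I \<Longrightarrow> x * y \<in> J) \<Longrightarrow> I \<subseteq> J"
  obtains C where "ssalg C" "C \<subseteq> A" "\<And>x. x \<in> C \<Longrightarrow> x \<in> J \<Longrightarrow> x = 0"
    "\<And>a. a \<in> A \<Longrightarrow> \<exists>c\<in>C. a - c \<in> J"
proof -
  note AA = subalgD[OF A]
  note lJ = left_idealD[OF J(1)] and rJ = right_idealD[OF J(2)]
  obtain P where P: "\<And>x. app P x \<in> J" "\<And>x. x \<in> J \<Longrightarrow> app P x = x" "\<And>c x. app P (scl c x) = scl c (app P x)"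
    by (rule projection_onto[OF lJ(1)]) blast
  define s where "s x = x - app P x" for x
  have s_add: "s (x + y) = s x + s y" for x y by (simp add: s_def)
  have s_scl: "s (scl c x) = scl c (s x)" for c x by (simp add: s_def P(3) scale_right_diff_distrib)
  have s_J: "s x = 0" if "x \<in> J" for x using P(2)[OF that] by (simp add: s_def)
  have s_split: "x = s x + app P x" for x by (simp add: s_def)
  define W where "W = s ` A"
  have subW: "subspace W"
    unfolding W_def
  proof (rule subspaceI)
    show "0 \<in> s ` A" using s_J[OF subspace_0[OF lJ(1)]] subspace_0[OF AA(1)] by (metis imageI)
  next
    fix x y assume "x \<in> s ` A" "y \<in> s ` A"
    then show "x + y \<in> s ` A" using subspace_add[OF AA(1)] by (force simp: s_add[symmetric])
  next
    fix c x assume "x \<in> s ` A"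
    then show "scl c x \<in> s ` A" using subspace_scale[OF AA(1)] by (force simp: s_scl[symmetric])
  qed
  have WA: "x \<in> A" if "x \<in> W" for x
    using that P(1) lJ(2) subspace_diff[OF AA(1)] by (auto simp: W_def s_def)
  have sW: "s x \<in> W" if "x \<in> A" for x using that by (simp add: W_def)
  have W_J: "x = 0" if x: "x \<in> W" "x \<in> J" for x
  proof -
    obtain y where y: "x = s y" using x(1) by (auto simp: W_def)
    have "y = x + app P y" using s_split y by simp
    then have "y \<in> J" using subspace_add[OF lJ(1) x(2) P(1)] by metis
    then show ?thesis using s_J y by simp
  qed
  have fdW: "fd W"
    unfolding fd_def
  proof (intro exI conjI subsetI)
    show "finite (s ` G)" using G(1) by simp
    fix w assume "w \<in> W"
    then obtain x where x: "w = s x" "x \<in> span (G \<union> J)" using G(2) by (auto simp: W_def)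
    have "s x \<in> span (s ` G)" using x(2)
    proof (induction rule: span_induct_alt)
      case base show ?case using s_J[OF subspace_0[OF lJ(1)]] by (simp add: span_zero)
    next
      case (step c x y)
      then have "s x \<in> span (s ` G)" using s_J by (auto intro: span_base simp: span_zero)
      then show ?case using step by (simp add: s_add s_scl span_add span_scale)
    qed
    then show "w \<in> span (s ` G)" using x(1) by simp
  qed
  obtain B where B: "finite B" "B \<subseteq> W" "span B = W"
    by (rule fd_basis[OF fdW subW]) blast
  \<comment> \<open>By bilinearity the defects of pairs of basis elements span all defects, so a
    finite set suffices.\<close>
  define X where "X = (\<lambda>(x, y). app P (x * y)) ` (B \<times> B)"
  have X: "finite X" "X \<subseteq> J" using B(1) P(1) by (auto simp: X_def)
  have PX1: "app P (x * y) \<in> span X" if x: "x \<in> W" and y: "y \<in> B" for x y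
  proof -
    have "x \<in> span B" using x B by simp
    then show ?thesis
    proof (induction rule: span_induct_alt)
      case (step c b z)
      have "app P (b * y) \<in> span X" using step(1) y by (auto simp: X_def intro!: span_base)
      then show ?case using step by (simp add: distrib_right P(3) span_add span_scale)
    qed (simp add: span_zero)
  qed
  have PX: "app P (x * y) \<in> span X" if x: "x \<in> W" and y: "y \<in> W" for x y
  proof -
    have "y \<in> span B" using y B by simp
    then show ?thesis
    proof (induction rule: span_induct_alt)
      case (step c b z)
      then show ?case using PX1[OF x] AA(4)[OF WA[OF x]]
        by (simp add: distrib_left P(3) span_add span_scale)
    qed (simp add: span_zero)
  qed
  let ?XJ = "span {x * j |x j. x \<in> X \<and> j \<in> J}"
  obtain g where g: "g \<in> J" "g * g = g" "g \<in> ?XJ" "\<And>x. x \<in> X \<Longrightarrow> g * x = x"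
    by (rule left_identity_idempotent[OF J(3) X]) blast
  have gA: "g \<in> A" using g(1) lJ(2) by blast
  have gX: "g * v = v" if "v \<in> span X" for v
    using that
    by (induction rule: span_induct_alt) (auto simp: distrib_left AA(4)[OF gA] g(4))
  have gXJ: "g * v = v" if "v \<in> ?XJ" for v
    using that
  proof (induction rule: span_induct_alt)
    case (step c h y)
    then obtain x j where "h = x * j" "x \<in> X" by blast
    then have "g * h = h" using g(4) by (simp add: mult.assoc[symmetric])
    then show ?case using step by (simp add: distrib_left AA(4)[OF gA])
  qed simp
  have XJ: "v * j \<in> ?XJ" if v: "v \<in> span X" and j: "j \<in> J" for v j
    using v
  proof (induction rule: span_induct_alt)
    case (step c x y)
    have "x * j \<in> ?XJ" using step(1) j by (intro span_base) blast
    then show ?case using step by (simp add: distrib_right span_add span_scale)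
  qed (simp add: span_zero)
  \<comment> \<open>Comparing \<open>(z * x) * y\<close> with \<open>z * (x * y)\<close> shows that
    the defect is a 2-cocycle: \<open>z P(xy) = P(w1 y) - P(z w2) + P(zx) y\<close>. After
    multiplication by \<open>j\<close>, each term on the right has a defect as its left
    factor.\<close>
  have stab1: "z * (app P (x * y) * j) \<in> ?XJ" if z: "z \<in> W" and x: "x \<in> W" and y: "y \<in> W" and j: "j \<in> J" for z x y j
  proof -
    define w1 where "w1 = s (z * x)"
    define w2 where "w2 = s (x * y)"
    note zxy = WA[OF z] WA[OF x] WA[OF y]
    have w: "w1 \<in> W" "w2 \<in> W" using sW AA(2) zxy by (auto simp: w1_def w2_def)
    have zx: "z * x = w1 + app P (z * x)" and xy: "x * y = w2 + app P (x * y)"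
      using s_split by (auto simp: w1_def w2_def)
    have e1: "z * (x * y) = w1 * y + app P (z * x) * y"
      by (metis zx distrib_right mult.assoc)
    have e2: "z * (x * y) = z * w2 + z * app P (x * y)"
      by (subst xy) (simp add: distrib_left)
    have "s (z * (x * y)) = s (w1 * y)"
      unfolding e1 s_add using s_J[OF rJ(3)[OF zxy(3) P(1)]] by simp
    moreover have "s (z * (x * y)) = s (z * w2)"
      unfolding e2 s_add using s_J[OF lJ(3)[OF zxy(1) P(1)]] by simp
    ultimately have "s (w1 * y) = s (z * w2)" by simp
    then have ss: "w1 * y - z * w2 = app P (w1 * y) - app P (z * w2)"
      by (simp add: s_def algebra_simps)
    have "z * app P (x * y) = w1 * y - z * w2 + app P (z * x) * y"
      using e1 e2 by (simp add: algebra_simps)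
    also have "\<dots> = app P (w1 * y) - app P (z * w2) + app P (z * x) * y" by (simp only: ss)
    finally have "z * (app P (x * y) * j) = app P (w1 * y) * j - app P (z * w2) * j + app P (z * x) * (y * j)"
      by (simp add: mult.assoc[symmetric] distrib_right left_diff_distrib)
    moreover have "y * j \<in> J" using lJ(3)[OF zxy(3) j] .
    ultimately show ?thesis using XJ[OF PX] w z x y j by (simp add: span_add span_diff)
  qed
  have stab: "z * v \<in> ?XJ" if z: "z \<in> W" and v: "v \<in> ?XJ" for z v
    using v
  proof (induction rule: span_induct_alt)
    case (step c h y)
    then obtain x j where h: "h = x * j" "x \<in> X" "j \<in> J" by blast
    then obtain b b' where "x = app P (b * b')" "b \<in> W" "b' \<in> W" using B(2) by (auto simp: X_def)
    then have "z * h \<in> ?XJ" using stab1[OF z] h by blast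
    then show ?case using step by (simp add: distrib_left AA(4)[OF WA[OF z]] span_add span_scale)
  qed (simp add: span_zero)
  have gwg: "g * (w * g) = w * g" if "w \<in> W" for w
    using gXJ[OF stab[OF that g(3)]] .
  define t where "t x = x - g * x" for x
  have t_add: "t (x + y) = t x + t y" for x y by (simp add: t_def distrib_left)
  have t_scl: "t (scl c x) = scl c (t x)" for c x
    by (simp add: t_def AA(4)[OF gA] scale_right_diff_distrib)
  define C where "C = t ` W"
  have CA: "C \<subseteq> A" unfolding C_def t_def using WA gA AA(2) subspace_diff[OF AA(1)] by blast
  have subC: "subspace C"
    unfolding C_def
  proof (rule subspaceI)
    show "0 \<in> t ` W" using subspace_0[OF subW] by (force simp: t_def intro: image_eqI[of _ _ 0])
  next
    fix x y assume "x \<in> t ` W" "y \<in> t ` W"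
    then show "x + y \<in> t ` W" using subspace_add[OF subW] by (force simp: t_add[symmetric])
  next
    fix c x assume "x \<in> t ` W"
    then show "scl c x \<in> t ` W" using subspace_scale[OF subW] by (force simp: t_scl[symmetric])
  qed
  \<comment> \<open>Since \<open>(1 - g) x g = 0\<close>, the inner factor \<open>1 - g\<close> may
    be dropped, and the outer one kills the defect of \<open>x * y\<close>.\<close>
  have t_mult: "t x * t y = t (s (x * y))" if x: "x \<in> W" and y: "y \<in> W" for x y
  proof -
    have "t x * t y = x * y - g * (x * y) - (x * g - g * (x * g)) * y"
      by (simp add: t_def algebra_simps)
    also have "\<dots> = t (x * y)" using gwg[OF x] by (simp add: t_def)
    also have "\<dots> = t (s (x * y)) + t (app P (x * y))" using s_split[of "x * y"] t_add by metis
    also have "t (app P (x * y)) = 0" using gX[OF PX[OF x y]] by (simp add: t_def)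
    finally show ?thesis by simp
  qed
  have subalgC: "subalg C"
    unfolding subalg_def
  proof (intro conjI ballI allI subC)
    fix x y assume "x \<in> C" "y \<in> C"
    then obtain x' y' where xy: "x = t x'" "y = t y'" "x' \<in> W" "y' \<in> W" by (auto simp: C_def)
    then have "x * y = t (s (x' * y'))" using t_mult by simp
    moreover have "s (x' * y') \<in> W" using sW AA(2) WA xy by blast
    ultimately show "x * y \<in> C" by (simp add: C_def)
  next
    fix x c assume "x \<in> C" then show "x * emb c = emb c * x" using CA AA(3) by blast
  qed
  have fdC: "fd C"
    unfolding fd_def
  proof (intro exI conjI subsetI)
    show "finite (t ` B)" using B(1) by simp
    fix w assume "w \<in> C"
    then obtain x where x: "w = t x" "x \<in> span B" using B(3) by (auto simp: C_def)
    have "t x \<in> span (t ` B)" using x(2)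
    proof (induction rule: span_induct_alt)
      case base show ?case by (simp add: span_zero t_def)
    next
      case (step c x y)
      then have "t x \<in> span (t ` B)" by (auto intro: span_base)
      then show ?case using step by (simp add: t_add t_scl span_add span_scale)
    qed
    then show "w \<in> span (t ` B)" using x(1) by simp
  qed
  have C_J: "x = 0" if x: "x \<in> C" "x \<in> J" for x
  proof -
    obtain w where w: "x = w - g * w" "w \<in> W" using x(1) by (auto simp: C_def t_def)
    then have "w = x + g * w" by simp
    moreover have "g * w \<in> J" using rJ(3)[OF WA[OF w(2)] g(1)] .
    ultimately have "w \<in> J" using subspace_add[OF lJ(1) x(2)] by metis
    then have "w = 0" using W_J w(2) by blast
    then show ?thesis by (simp add: w(1))
  qed
  have A_CJ: "\<exists>c\<in>C. a - c \<in> J" if a: "a \<in> A" for a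
  proof
    show "t (s a) \<in> C" using sW[OF a] by (simp add: C_def)
    have "a - t (s a) = app P a + g * s a" by (simp add: t_def s_def)
    moreover have "g * s a \<in> J" using rJ(3)[OF WA[OF sW[OF a]] g(1)] .
    ultimately show "a - t (s a) \<in> J" using subspace_add[OF lJ(1) P(1)] by simp
  qed
  have "square_free C"
    unfolding square_free_def
  proof (intro allI impI subsetI, elim conjE)
    fix I i assume I: "left_ideal C I" "right_ideal C I" "\<forall>x\<in>I. \<forall>y\<in>I. x * y = 0" and i: "i \<in> I"
    \<comment> \<open>\<open>I + J\<close> is an ideal of \<open>A\<close> whose square lies in
      \<open>J\<close>; by semisimplicity of the quotient it lies in \<open>J\<close>, so
      \<open>I\<close> lies in the intersection of \<open>C\<close> and \<open>J\<close>, which is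
      zero.\<close>
    let ?I = "{x + y |x y. x \<in> I \<and> y \<in> J}"
    note lI = left_idealD[OF I(1)] and rI = right_idealD[OF I(2)]
    have IA: "x \<in> A" if "x \<in> I" for x using lI(2)[OF that] CA by blast
    have sub: "subspace ?I" using subspace_sums[OF lI(1) lJ(1)] .
    have IsubA: "?I \<subseteq> A" using IA lJ(2) subspace_add[OF AA(1)] by blast
    have "?I \<subseteq> J"
    proof (rule ssq)
      show "left_ideal A ?I" unfolding left_ideal_def
      proof (intro conjI ballI sub IsubA)
        fix a v assume a: "a \<in> A" and "v \<in> ?I"
        then obtain x y where v: "v = x + y" "x \<in> I" "y \<in> J" by blast
        obtain c where c: "c \<in> C" "a - c \<in> J" using A_CJ[OF a] by blast
        have "a * v = c * x + ((a - c) * x + a * y)" by (simp add: v algebra_simps)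
        moreover have "(a - c) * x + a * y \<in> J"
          using rJ(3)[OF IA[OF v(2)] c(2)] lJ(3)[OF a v(3)] subspace_add[OF lJ(1)] by blast
        ultimately show "a * v \<in> ?I" using lI(3)[OF c(1) v(2)] by blast
      qed
      show "right_ideal A ?I" unfolding right_ideal_def
      proof (intro conjI ballI sub IsubA)
        fix a v assume a: "a \<in> A" and "v \<in> ?I"
        then obtain x y where v: "v = x + y" "x \<in> I" "y \<in> J" by blast
        obtain c where c: "c \<in> C" "a - c \<in> J" using A_CJ[OF a] by blast
        have "v * a = x * c + (x * (a - c) + y * a)" by (simp add: v algebra_simps)
        moreover have "x * (a - c) + y * a \<in> J"
          using lJ(3)[OF IA[OF v(2)] c(2)] rJ(3)[OF a v(3)] subspace_add[OF lJ(1)] by blast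
        ultimately show "v * a \<in> ?I" using rI(3)[OF c(1) v(2)] by blast
      qed
      show "J \<subseteq> ?I"
      proof
        fix x assume "x \<in> J"
        then show "x \<in> ?I" using subspace_0[OF lI(1)] by force
      qed
      fix v v' assume "v \<in> ?I" "v' \<in> ?I"
      then obtain x y x' y' where v: "v = x + y" "x \<in> I" "y \<in> J" "v' = x' + y'" "x' \<in> I" "y' \<in> J" by blast
      have "x * x' = 0" using I(3) v by blast
      then have "v * v' = x * y' + y * (x' + y')" by (simp add: v(1,4) algebra_simps)
      moreover have "x * y' \<in> J" using lJ(3)[OF IA[OF v(2)] v(6)] .
      moreover have "y * (x' + y') \<in> J"
        using rJ(3)[OF _ v(3)] subspace_add[OF AA(1) IA[OF v(5)] lJ(2)[OF v(6)]] by blast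
      ultimately show "v * v' \<in> J" using subspace_add[OF lJ(1)] by simp
    qed
    moreover have "i \<in> ?I" using i subspace_0[OF lJ(1)] by force
    ultimately show "i \<in> {0}" using C_J[OF lI(2)[OF i]] by blast
  qed
  with subalgC fdC have "ssalg C" by (simp add: ssalg_def)
  then show thesis using that CA C_J A_CJ by blast
qed

text \<open>As in Maschke's theorem, the average of a projection onto a \<open>D\<close>-stable right ideal is again a
  projection onto it.\<close>

lemma left_identity_commuting:
  assumes "perfect_field TYPE('k)" "ssalg D" "1 \<in> D" "subspace J" "J \<subseteq> KC" "loc_ss J"
    and DJ: "\<And>d j. d \<in> D \<Longrightarrow> j \<in> J \<Longrightarrow> d * j \<in> J" "\<And>d j. d \<in> D \<Longrightarrow> j \<in> J \<Longrightarrow> j * d \<in> J"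
    and X: "finite X" "X \<subseteq> J"
  obtains g where "g \<in> J" "g * g = g" "\<And>x. x \<in> X \<Longrightarrow> g * x = x" "\<And>d. d \<in> D \<Longrightarrow> d * g = g * d"
proof -
  note DA = subalgD[OF ssalgD(1)[OF assms(2)]]
  obtain T where T: "T \<in> Mop D" "app T 1 = 1" "\<And>c m. c \<in> D \<Longrightarrow> m \<in> KC \<Longrightarrow> c * app T m = app T m * c"
    by (rule averaging[OF assms(1-3)]) blast
  obtain I :: "'r endo set" and a b where I: "finite I" "\<And>i. i \<in> I \<Longrightarrow> a i \<in> D" "\<And>i. i \<in> I \<Longrightarrow> b i \<in> D"
    "\<And>x. app T x = (\<Sum>i\<in>I. a i * x * b i)" by (rule Mop_explicit[OF ssalgD(1)[OF assms(2)] T(1)]) blast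
  obtain B where B: "finite B" "B \<subseteq> D" "span B = D"
    by (rule fd_basis[OF ssalgD(2)[OF assms(2)] DA(1)]) blast
  \<comment> \<open>\<open>X\<close> is enlarged to generators of \<open>DX\<close>, so that the
    right ideal spanned by \<open>YJ\<close> is stable under \<open>D\<close>; this yields
    \<open>g * (d * g) = d * g\<close>.\<close>
  define Y where "Y = (\<lambda>(b, x). b * x) ` (B \<times> X)"
  have Y: "finite Y" "Y \<subseteq> J" using B X DJ(1) by (auto simp: Y_def)
  have DX: "d * x \<in> span Y" if d: "d \<in> D" and x: "x \<in> X" for d x
  proof -
    have "d \<in> span B" using d B by simp
    then show ?thesis
    proof (induction rule: span_induct_alt)
      case (step c b y)
      have "b * x \<in> span Y" using step(1) x by (auto simp: Y_def intro!: span_base)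
      then show ?case using step by (simp add: distrib_right span_add span_scale)
    qed (simp add: span_zero)
  qed
  let ?YJ = "span {x * j |x j. x \<in> Y \<and> j \<in> J}"
  obtain g where g: "g \<in> J" "g * g = g" "g \<in> ?YJ" "\<And>x. x \<in> Y \<Longrightarrow> g * x = x"
    by (rule left_identity_idempotent[OF assms(6) Y]) blast
  have gKC: "g \<in> KC" using g(1) assms(5) by blast
  have gY: "g * v = v" if "v \<in> span Y" for v
    using that by (induction rule: span_induct_alt) (auto simp: distrib_left KC_scl[OF gKC] g(4))
  have gYJ: "g * v = v" if "v \<in> ?YJ" for v
    using that
  proof (induction rule: span_induct_alt)
    case (step c h y)
    then obtain x j where "h = x * j" "x \<in> Y" by blast
    then have "g * h = h" using g(4) by (simp add: mult.assoc[symmetric])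
    then show ?case using step by (simp add: distrib_left KC_scl[OF gKC])
  qed simp
  have YJ: "v * j \<in> ?YJ" if v: "v \<in> span Y" and j: "j \<in> J" for v j
    using v
  proof (induction rule: span_induct_alt)
    case (step c x y)
    have "x * j \<in> ?YJ" using step(1) j by (intro span_base) blast
    then show ?case using step by (simp add: distrib_right span_add span_scale)
  qed (simp add: span_zero)
  have stab: "d * v \<in> ?YJ" if d: "d \<in> D" and v: "v \<in> ?YJ" for d v
    using v
  proof (induction rule: span_induct_alt)
    case (step c h y)
    then obtain b x j where h: "h = b * x * j" "b \<in> B" "x \<in> X" "j \<in> J" by (auto simp: Y_def)
    have "d * b \<in> D" using DA(2) d h(2) B(2) by blast
    then have "(d * b) * x * j \<in> ?YJ" using YJ[OF DX] h by blast
    then have "d * h \<in> ?YJ" by (simp add: h(1) mult.assoc)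
    then show ?case using step by (simp add: distrib_left DA(4)[OF d] span_add span_scale)
  qed (simp add: span_zero)
  have gdg: "g * (d * g) = d * g" if "d \<in> D" for d using gYJ[OF stab[OF that g(3)]] .
  define g' where "g' = app T g"
  \<comment> \<open>If \<open>g\<close> fixes all of \<open>D v\<close>, the factor \<open>g\<close>
    disappears from each summand, and what remains is \<open>app T 1 * v = v\<close>. The argument
    serves for \<open>X\<close> and for \<open>g'\<close> itself.\<close>
  have fixv: "g' * v = v" if v: "\<And>d. d \<in> D \<Longrightarrow> g * (d * v) = d * v" for v
  proof -
    have "g' * v = (\<Sum>i\<in>I. a i * (g * (b i * v)))"
      by (simp add: g'_def I(4) sum_distrib_right mult.assoc)
    also have "\<dots> = (\<Sum>i\<in>I. a i * 1 * b i * v)"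
      by (rule sum.cong[OF refl]) (simp add: v I(3) mult.assoc)
    also have "\<dots> = app T 1 * v" by (simp only: I(4) sum_distrib_right)
    finally show ?thesis by (simp add: T(2))
  qed
  have "g' \<in> J" unfolding g'_def
    by (rule Mop_closed[OF ssalgD(1)[OF assms(2)] T(1) assms(4) _ g(1)]) (use DJ in blast)
  moreover have "g' * g' = g'"
  proof (rule fixv)
    fix d assume d: "d \<in> D"
    have "g * (d * (a i * g * b i)) = d * (a i * g * b i)" if i: "i \<in> I" for i
      using gdg[OF DA(2)[OF d I(2)[OF i]]] by (metis mult.assoc)
    then show "g * (d * g') = d * g'" by (simp add: g'_def I(4) sum_distrib_left)
  qed
  moreover have "g' * x = x" if "x \<in> X" for x by (rule fixv) (rule gY[OF DX[OF _ that]])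
  moreover have "d * g' = g' * d" if "d \<in> D" for d unfolding g'_def by (rule T(3)[OF that gKC])
  ultimately show thesis using that by blast
qed

text \<open>Left-right mirror of \<open>left_identity_commuting\<close>. The averaging operator is
  two-sided and serves both; scalars, which stand on the left, move past elements of
  \<open>J\<close> by \<open>KC_scl\<close>.\<close>

lemma right_identity_commuting:
  assumes "perfect_field TYPE('k)" "ssalg D" "1 \<in> D" "subspace J" "J \<subseteq> KC" "loc_ss J"
    and DJ: "\<And>d j. d \<in> D \<Longrightarrow> j \<in> J \<Longrightarrow> d * j \<in> J" "\<And>d j. d \<in> D \<Longrightarrow> j \<in> J \<Longrightarrow> j * d \<in> J"
    and X: "finite X" "X \<subseteq> J"
  obtains g where "g \<in> J" "g * g = g" "\<And>x. x \<in> X \<Longrightarrow> x * g = x" "\<And>d. d \<in> D \<Longrightarrow> d * g = g * d"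
proof -
  note DA = subalgD[OF ssalgD(1)[OF assms(2)]]
  obtain T where T: "T \<in> Mop D" "app T 1 = 1" "\<And>c m. c \<in> D \<Longrightarrow> m \<in> KC \<Longrightarrow> c * app T m = app T m * c"
    by (rule averaging[OF assms(1-3)]) blast
  obtain I :: "'r endo set" and a b where I: "finite I" "\<And>i. i \<in> I \<Longrightarrow> a i \<in> D" "\<And>i. i \<in> I \<Longrightarrow> b i \<in> D"
    "\<And>x. app T x = (\<Sum>i\<in>I. a i * x * b i)" by (rule Mop_explicit[OF ssalgD(1)[OF assms(2)] T(1)]) blast
  obtain B where B: "finite B" "B \<subseteq> D" "span B = D"
    by (rule fd_basis[OF ssalgD(2)[OF assms(2)] DA(1)]) blast
  define Y where "Y = (\<lambda>(b, x). x * b) ` (B \<times> X)"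
  have Y: "finite Y" "Y \<subseteq> J" using B X DJ(2) by (auto simp: Y_def)
  have JKC: "j \<in> KC" if "j \<in> J" for j using that assms(5) by blast
  have DX: "x * d \<in> span Y" if d: "d \<in> D" and x: "x \<in> X" for d x
  proof -
    have xKC: "x \<in> KC" using JKC x X(2) by blast
    have "d \<in> span B" using d B by simp
    then show ?thesis
    proof (induction rule: span_induct_alt)
      case (step c b y)
      have "x * b \<in> span Y" using step(1) x by (auto simp: Y_def intro!: span_base)
      then show ?case using step by (simp add: distrib_left KC_scl[OF xKC] span_add span_scale)
    qed (simp add: span_zero)
  qed
  let ?YJ = "span {j * x |x j. x \<in> Y \<and> j \<in> J}"
  obtain g where g: "g \<in> J" "g * g = g" "g \<in> ?YJ" "\<And>x. x \<in> Y \<Longrightarrow> x * g = x"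
    by (rule right_identity_idempotent[OF assms(6) Y]) blast
  have gKC: "g \<in> KC" using g(1) assms(5) by blast
  have gY: "v * g = v" if "v \<in> span Y" for v
    using that by (induction rule: span_induct_alt) (auto simp: distrib_right g(4))
  have gYJ: "v * g = v" if "v \<in> ?YJ" for v
    using that
  proof (induction rule: span_induct_alt)
    case (step c h y)
    then obtain x j where "h = j * x" "x \<in> Y" by blast
    then have "h * g = h" using g(4) by (simp add: mult.assoc)
    then show ?case using step by (simp add: distrib_right)
  qed simp
  have YJ: "j * v \<in> ?YJ" if v: "v \<in> span Y" and j: "j \<in> J" for v j
    using v
  proof (induction rule: span_induct_alt)
    case (step c x y)
    have "j * x \<in> ?YJ" using step(1) j by (intro span_base) blast
    then show ?case using step by (simp add: distrib_left KC_scl[OF JKC[OF j]] span_add span_scale)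
  qed (simp add: span_zero)
  have stab: "v * d \<in> ?YJ" if d: "d \<in> D" and v: "v \<in> ?YJ" for d v
    using v
  proof (induction rule: span_induct_alt)
    case (step c h y)
    then obtain b x j where h: "h = j * (x * b)" "b \<in> B" "x \<in> X" "j \<in> J" by (auto simp: Y_def)
    have "b * d \<in> D" using DA(2) d h(2) B(2) by blast
    then have "j * (x * (b * d)) \<in> ?YJ" using YJ[OF DX] h by blast
    then have "h * d \<in> ?YJ" by (simp add: h(1) mult.assoc)
    then show ?case using step by (simp add: distrib_right span_add span_scale)
  qed (simp add: span_zero)
  have gdg: "g * d * g = g * d" if "d \<in> D" for d using gYJ[OF stab[OF that g(3)]] .
  define g' where "g' = app T g"
  have fixv: "v * g' = v" if v: "\<And>d. d \<in> D \<Longrightarrow> v * d * g = v * d" for v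
  proof -
    have "v * g' = (\<Sum>i\<in>I. v * a i * g * b i)"
      by (simp add: g'_def I(4) sum_distrib_left mult.assoc)
    also have "\<dots> = (\<Sum>i\<in>I. v * (a i * 1 * b i))"
      by (rule sum.cong[OF refl]) (simp add: v I(2) mult.assoc[symmetric])
    also have "\<dots> = v * app T 1" by (simp only: I(4) sum_distrib_left)
    finally show ?thesis by (simp add: T(2))
  qed
  have "g' \<in> J" unfolding g'_def
    by (rule Mop_closed[OF ssalgD(1)[OF assms(2)] T(1) assms(4) _ g(1)]) (use DJ in blast)
  moreover have "g' * g' = g'"
  proof (rule fixv)
    fix d assume d: "d \<in> D"
    have "a i * g * b i * d * g = a i * g * b i * d" if i: "i \<in> I" for i
      using gdg[OF DA(2)[OF I(3)[OF i] d]] by (metis mult.assoc)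
    then show "g' * d * g = g' * d" by (simp add: g'_def I(4) sum_distrib_right)
  qed
  moreover have "x * g' = x" if "x \<in> X" for x by (rule fixv) (rule gY[OF DX[OF _ that]])
  moreover have "d * g' = g' * d" if "d \<in> D" for d unfolding g'_def by (rule T(3)[OF that gKC])
  ultimately show thesis using that by blast
qed

text \<open>The right identity \<open>h\<close> is chosen for \<open>X\<close> and also for
  \<open>g\<close>, so \<open>g * h = g\<close>. This makes \<open>g + h - h * g\<close> idempotent,
  and it inherits the left identity from \<open>g\<close> and the right one from
  \<open>h\<close>.\<close>

lemma identity_commuting:
  assumes "perfect_field TYPE('k)" "ssalg D" "1 \<in> D" "subspace J" "J \<subseteq> KC" "loc_ss J"
    and DJ: "\<And>d j. d \<in> D \<Longrightarrow> j \<in> J \<Longrightarrow> d * j \<in> J" "\<And>d j. d \<in> D \<Longrightarrow> j \<in> J \<Longrightarrow> j * d \<in> J"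
    and JJ: "\<And>x y. x \<in> J \<Longrightarrow> y \<in> J \<Longrightarrow> x * y \<in> J"
    and X: "finite X" "X \<subseteq> J"
  obtains e where "e \<in> J" "e * e = e" "\<And>x. x \<in> X \<Longrightarrow> e * x = x" "\<And>x. x \<in> X \<Longrightarrow> x * e = x"
    "\<And>d. d \<in> D \<Longrightarrow> d * e = e * d"
proof -
  obtain g where g: "g \<in> J" "g * g = g" "\<And>x. x \<in> X \<Longrightarrow> g * x = x" "\<And>d. d \<in> D \<Longrightarrow> d * g = g * d"
    by (rule left_identity_commuting[OF assms(1-6) DJ X]) blast+
  have X': "finite (insert g X)" "insert g X \<subseteq> J" using X g(1) by auto
  obtain h where h: "h \<in> J" "h * h = h" "\<And>x. x \<in> insert g X \<Longrightarrow> x * h = x" "\<And>d. d \<in> D \<Longrightarrow> d * h = h * d"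
    by (rule right_identity_commuting[OF assms(1-6) DJ X']) blast+
  define e where "e = g + h - h * g"
  have gh: "g * h = g" using h(3) by blast
  have ge: "g * e = g" and he: "h * e = h"
    by (simp_all add: e_def algebra_simps g(2) gh h(2)) (metis gh g(2) h(2) mult.assoc add_diff_cancel)+
  have "e \<in> J" unfolding e_def
    using g(1) h(1) JJ by (intro subspace_diff[OF assms(4)] subspace_add[OF assms(4)]) auto
  moreover have "e * e = e"
  proof -
    have "e * e = g * e + h * e - h * (g * e)" by (subst (1) e_def) (simp add: algebra_simps)
    also have "\<dots> = e" unfolding ge he by (simp add: e_def)
    finally show ?thesis .
  qed
  moreover have "e * x = x" if "x \<in> X" for x
    using g(3)[OF that] by (simp add: e_def algebra_simps)
  moreover have "x * e = x" if "x \<in> X" for x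
  proof -
    have "x * h = x" using h(3) that by blast
    then show ?thesis by (simp add: e_def algebra_simps mult.assoc[symmetric])
  qed
  moreover have "d * e = e * d" if "d \<in> D" for d
  proof -
    have "d * (h * g) = h * g * d" using g(4)[OF that] h(4)[OF that] by (metis mult.assoc)
    then show ?thesis using g(4)[OF that] h(4)[OF that] by (simp add: e_def distrib_left distrib_right left_diff_distrib right_diff_distrib)
  qed
  ultimately show thesis using that by blast
qed

text \<open>Averaging requires the ambient \<open>1\<close>, whereas the unit \<open>u\<close> of
  \<open>C\<close> may differ from it. For \<open>x\<close> in a square-zero ideal,
  \<open>x * u\<close> lies in \<open>C\<close> and in the ideal, so regularity makes it zero; what
  is left of \<open>x\<close> is a multiple of the idempotent \<open>1 - u\<close>.\<close>

lemma ssalg_adjoin_one: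
  assumes "ssalg C"
  shows "ssalg {c + scl k 1 |c k. c \<in> C}" (is "ssalg ?D")
proof -
  note C = subalgD[OF ssalgD(1)[OF assms]]
  have CKC: "x \<in> KC" if "x \<in> C" for x using subalg_KC[OF ssalgD(1)[OF assms]] that by blast
  obtain u where u: "u \<in> C" "\<And>x. x \<in> C \<Longrightarrow> x * u = x" "\<And>x. x \<in> C \<Longrightarrow> u * x = x"
    by (rule ssalg_unit[OF assms]) blast
  have D: "?D = span (C \<union> {1})"
    unfolding span_Un span_singleton using C(1) by (auto simp: span_eq_iff[THEN iffD2])
  have "subalg ?D" unfolding D
  proof (rule subalg_span)
    fix g h assume "g \<in> C \<union> {1}" "h \<in> C \<union> {1}"
    then have "g * h \<in> C \<union> {1}" using C(2) by auto
    then show "g * h \<in> span (C \<union> {1})" by (rule span_base)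
  qed (use CKC KC_one in auto)
  moreover have "fd ?D"
  proof -
    obtain S where "finite S" "C \<subseteq> span S" using ssalgD(2)[OF assms] by (auto simp: fd_def)
    moreover from this have "span (C \<union> {1}) \<subseteq> span (S \<union> {1})"
      using span_mono[of S "S \<union> {1}"] by (intro span_minimal) (auto intro: span_base)
    ultimately show ?thesis unfolding fd_def D by (intro exI[of _ "S \<union> {1}"]) auto
  qed
  moreover have "square_free ?D"
    unfolding square_free_def
  proof (intro allI impI subsetI, elim conjE)
    fix I x assume I: "left_ideal ?D I" "right_ideal ?D I" "\<forall>x\<in>I. \<forall>y\<in>I. x * y = 0" and x: "x \<in> I"
    have CD: "c \<in> ?D" if "c \<in> C" for c using that unfolding D by (intro span_base) blast
    obtain c k where ck: "x = c + scl k 1" "c \<in> C" using left_idealD(2)[OF I(1) x] by blast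
    have xu: "x * u = c + scl k u" using u ck by (simp add: distrib_right)
    have "x * u \<in> C" unfolding xu using ck(2) u(1) C(1) by (simp add: subspace_add subspace_scale)
    then obtain y where y: "y \<in> C" "x * u * y * (x * u) = x * u" using ssalg_regular[OF assms] by blast
    have "x * u \<in> I" using right_idealD(3)[OF I(2) CD[OF u(1)] x] .
    then have "x * u * y \<in> I" using right_idealD(3)[OF I(2) CD[OF y(1)]] by blast
    then have "x * u = 0" using I(3) \<open>x * u \<in> I\<close> y(2) by metis
    then have "c = - scl k u" using xu by (simp add: eq_neg_iff_add_eq_0)
    then have xk: "x = scl k (1 - u)" using ck(1) by (simp add: scale_right_diff_distrib)
    have uu: "u * u = u" using u by blast
    have "1 - u \<in> KC" using subspace_diff[OF subspace_KC KC_one CKC[OF u(1)]] .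
    then have "x * x = scl k (scl k ((1 - u) * (1 - u)))" by (simp add: xk KC_scl)
    also have "(1 - u) * (1 - u) = 1 - u" by (simp add: algebra_simps uu)
    finally have "scl k (scl k (1 - u)) = 0" using I(3) x by simp
    then show "x \<in> {0}" using xk by auto
  qed
  ultimately show ?thesis by (simp add: ssalg_def)
qed

text \<open>If \<open>x = x * y * x\<close> with \<open>y\<close> in \<open>T\<close>, then
  \<open>e * y * e\<close> serves in place of \<open>y\<close>; hence the corner is regular as
  well.\<close>

lemma ssalg_corner:
  assumes "ssalg T" "e \<in> T" "e * e = e"
  shows "ssalg {t\<in>T. e * t = t \<and> t * e = t}" (is "ssalg ?U")
proof -
  note T = subalgD[OF ssalgD(1)[OF assms(1)]]
  have "subalg ?U"
    unfolding subalg_def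
  proof (intro conjI ballI allI)
    show "subspace ?U" using T(1) T(4)[OF assms(2)] by (auto simp: subspace_def distrib_left distrib_right)
    fix x y assume "x \<in> ?U" "y \<in> ?U"
    then have xy: "x \<in> T" "y \<in> T" "e * x = x" "y * e = y" by auto
    then have "e * (x * y) = x * y" "x * y * e = x * y" by (metis mult.assoc)+
    then show "x * y \<in> ?U" using T(2) xy by blast
  qed (use T(3) in blast)
  moreover have "fd ?U" by (rule fd_subset[OF ssalgD(2)[OF assms(1)]]) blast
  moreover have "square_free ?U"
    unfolding square_free_def
  proof (intro allI impI subsetI, elim conjE)
    fix I x assume I: "left_ideal ?U I" "right_ideal ?U I" "\<forall>x\<in>I. \<forall>y\<in>I. x * y = 0" and x: "x \<in> I"
    then have xU: "x \<in> T" "e * x = x" "x * e = x" using left_idealD(2)[OF I(1) x] by auto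
    obtain y where y: "y \<in> T" "x * y * x = x" using ssalg_regular[OF assms(1) xU(1)] by blast
    let ?z = "e * y * e"
    have "e * ?z = ?z" "?z * e = ?z" using assms(3) by (metis mult.assoc)+
    then have "?z \<in> ?U" using T(2) y(1) assms(2) by blast
    then have "x * ?z \<in> I" using right_idealD(3)[OF I(2) _ x] by blast
    then have "x * ?z * x = 0" using I(3) x by blast
    moreover have "x * ?z * x = x * y * x" using xU(2,3) by (metis mult.assoc)
    ultimately show "x \<in> {0}" using y(2) by simp
  qed
  ultimately show ?thesis by (simp add: ssalg_def)
qed

text \<open>Since \<open>e\<close> commutes with \<open>C\<close>, every \<open>t\<close> in
  \<open>U = eTe\<close> satisfies \<open>x * t = (e * x) * t\<close>, with \<open>e * x\<close> in
  \<open>U\<close>. So \<open>U\<close> is an ideal of \<open>C + U\<close>, and semisimplicity is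
  checked in \<open>C\<close> modulo \<open>U\<close> and then in \<open>U\<close>.\<close>

theorem extension_loc_ss:
  assumes perf: "perfect_field TYPE('k)"
    and A: "subalg A" and J: "left_ideal A J" "right_ideal A J" "loc_ss J"
    and G: "finite G" "A \<subseteq> span (G \<union> J)"
    and ssq: "\<And>I. left_ideal A I \<Longrightarrow> right_ideal A I \<Longrightarrow> J \<subseteq> I \<Longrightarrow> (\<And>x y. x \<in> I \<Longrightarrow> y \<in> I \<Longrightarrow> x * y \<in> J) \<Longrightarrow> I \<subseteq> J"
    and F: "finite F" "F \<subseteq> A"
  obtains B where "ssalg B" "F \<subseteq> B" "B \<subseteq> A"
proof -
  note AA = subalgD[OF A]
  note lJ = left_idealD[OF J(1)] and rJ = right_idealD[OF J(2)]
  have JKC: "J \<subseteq> KC" using lJ(2) subalg_KC[OF A] by blast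
  obtain C where C: "ssalg C" "C \<subseteq> A" "\<And>x. x \<in> C \<Longrightarrow> x \<in> J \<Longrightarrow> x = 0"
    "\<And>a. a \<in> A \<Longrightarrow> \<exists>c\<in>C. a - c \<in> J"
    by (rule lift_quotient[OF A J G ssq]) blast+
  note CA = subalgD[OF ssalgD(1)[OF C(1)]]
  obtain B where B: "finite B" "B \<subseteq> C" "span B = C"
    by (rule fd_basis[OF ssalgD(2)[OF C(1)] CA(1)]) blast
  have "\<forall>f\<in>F. \<exists>c\<in>C. f - c \<in> J" using C(4) F(2) by blast
  then obtain c where c: "\<And>f. f \<in> F \<Longrightarrow> c f \<in> C" "\<And>f. f \<in> F \<Longrightarrow> f - c f \<in> J" by metis
  define X where "X = (\<lambda>f. f - c f) ` F"
  have X: "finite X" "X \<subseteq> J" using F(1) c(2) by (auto simp: X_def)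
  let ?D = "{x + scl k 1 |x k. x \<in> C}"
  have CD: "x \<in> ?D" if "x \<in> C" for x using that by (force intro: exI[of _ 0])
  have D1: "1 \<in> ?D" using subspace_0[OF CA(1)] by (force intro: exI[of _ 1])
  have DJ: "d * j \<in> J" "j * d \<in> J" if d: "d \<in> ?D" and j: "j \<in> J" for d j
  proof -
    obtain x k where x: "d = x + scl k 1" "x \<in> C" using d by blast
    have "x * j \<in> J" "j * x \<in> J" using lJ(3)[OF _ j] rJ(3)[OF _ j] x(2) C(2) by blast+
    moreover have "j * scl k 1 = scl k j" using KC_scl[of j k 1] JKC j by auto
    ultimately show "d * j \<in> J" "j * d \<in> J" unfolding x(1) distrib_left distrib_right
      using j by (auto intro!: subspace_add[OF lJ(1)] subspace_scale[OF lJ(1)])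
  qed
  have JJ: "x * y \<in> J" if "x \<in> J" "y \<in> J" for x y using lJ(3)[OF lJ(2)[OF that(1)] that(2)] .
  obtain e where e: "e \<in> J" "e * e = e" "\<And>x. x \<in> X \<Longrightarrow> e * x = x" "\<And>x. x \<in> X \<Longrightarrow> x * e = x"
    "\<And>d. d \<in> ?D \<Longrightarrow> d * e = e * d"
    by (rule identity_commuting[OF perf ssalg_adjoin_one[OF C(1)] D1 lJ(1) JKC J(3) DJ JJ X]) blast+
  have eC: "x * e = e * x" if "x \<in> C" for x using e(5)[OF CD[OF that]] .
  \<comment> \<open>The elements \<open>e * b\<close> are included so that \<open>eC\<close> lies in
    \<open>T\<close>, which makes \<open>U\<close> absorb \<open>C\<close>.\<close>
  have fin: "finite (X \<union> {e} \<union> (\<lambda>b. e * b) ` B)" and sub: "X \<union> {e} \<union> (\<lambda>b. e * b) ` B \<subseteq> J"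
    using X e(1) B rJ(3)[OF _ e(1)] C(2) by auto
  obtain T where T: "ssalg T" "X \<union> {e} \<union> (\<lambda>b. e * b) ` B \<subseteq> T" "T \<subseteq> J"
    using loc_ssD[OF J(3) fin sub] .
  note TA = subalgD[OF ssalgD(1)[OF T(1)]]
  define U where "U = {t\<in>T. e * t = t \<and> t * e = t}"
  have U: "ssalg U" unfolding U_def by (rule ssalg_corner[OF T(1) _ e(2)]) (use T(2) in blast)
  note UA = subalgD[OF ssalgD(1)[OF U]]
  have UJ: "x \<in> J" if "x \<in> U" for x using that T(3) by (auto simp: U_def)
  have XU: "X \<subseteq> U" using T(2) e(3,4) by (auto simp: U_def)
  have eCU: "e * x \<in> U" if x: "x \<in> C" for x
  proof -
    have eT: "e \<in> T" using T(2) by blast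
    have "x \<in> span B" using x B by simp
    then have "e * x \<in> T"
    proof (induction rule: span_induct_alt)
      case (step c b y)
      have "e * b \<in> T" using step(1) T(2) by blast
      then show ?case using step TA(1) by (simp add: distrib_left TA(4)[OF eT] subspace_add subspace_scale)
    qed (simp add: subspace_0[OF TA(1)])
    moreover have "e * (e * x) = e * x" "e * x * e = e * x" using e(2) eC[OF x] by (metis mult.assoc)+
    ultimately show ?thesis by (simp add: U_def)
  qed
  have CU: "x * t \<in> U" "t * x \<in> U" if x: "x \<in> C" and t: "t \<in> U" for x t
  proof -
    have et: "e * t = t" "t * e = t" using t by (auto simp: U_def)
    have "x * t = (e * x) * t" "t * x = t * (e * x)"
      using et eC[OF x] by (metis mult.assoc)+
    then show "x * t \<in> U" "t * x \<in> U" using UA(2) eCU[OF x] t by auto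
  qed
  define R where "R = {x + y |x y. x \<in> C \<and> y \<in> U}"
  have subR: "subspace R" unfolding R_def by (rule subspace_sums[OF CA(1) UA(1)])
  have RA: "R \<subseteq> A" unfolding R_def using C(2) UJ lJ(2) subspace_add[OF AA(1)] by blast
  have subalgR: "subalg R"
    unfolding subalg_def
  proof (intro conjI ballI allI subR)
    fix v w assume "v \<in> R" "w \<in> R"
    then obtain x y x' y' where v: "v = x + y" "x \<in> C" "y \<in> U" "w = x' + y'" "x' \<in> C" "y' \<in> U"
      unfolding R_def by blast
    have "v * w = x * x' + (x * y' + y * x' + y * y')" by (simp add: v(1,4) algebra_simps)
    moreover have "x * y' + y * x' + y * y' \<in> U"
      using CU v UA(2) by (intro subspace_add[OF UA(1)]) auto
    ultimately show "v * w \<in> R" using CA(2) v unfolding R_def by blast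
  next
    fix x c assume "x \<in> R" then show "x * emb c = emb c * x" using RA AA(3) by blast
  qed
  have fdR: "fd R"
  proof -
    obtain S where S: "finite S" "U \<subseteq> span S" using ssalgD(2)[OF U] by (auto simp: fd_def)
    have "R \<subseteq> span (B \<union> S)" unfolding R_def span_Un using S(2) B(3) by blast
    then show ?thesis unfolding fd_def using S(1) B(1) by (intro exI[of _ "B \<union> S"]) auto
  qed
  have CR: "x \<in> R" if "x \<in> C" for x using that subspace_0[OF UA(1)] unfolding R_def by force
  have UR: "x \<in> R" if "x \<in> U" for x using that subspace_0[OF CA(1)] unfolding R_def by force
  have "square_free R"
    unfolding square_free_def
  proof (intro allI impI subsetI, elim conjE)
    fix I x assume I: "left_ideal R I" "right_ideal R I" "\<forall>x\<in>I. \<forall>y\<in>I. x * y = 0" and x: "x \<in> I"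
    obtain a t where at: "x = a + t" "a \<in> C" "t \<in> U" using left_idealD(2)[OF I(1) x] unfolding R_def by blast
    \<comment> \<open>Expanding \<open>x * d * x = 0\<close> puts \<open>a = a * d * a\<close> into
      \<open>U\<close>, hence into both \<open>C\<close> and \<open>J\<close>; so
      \<open>a = 0\<close> and \<open>x\<close> lies in \<open>U\<close>, where regularity applies
      again.\<close>
    obtain d where d: "d \<in> C" "a * d * a = a" using ssalg_regular[OF C(1) at(2)] by blast
    have "x * d \<in> I" using right_idealD(3)[OF I(2) CR[OF d(1)] x] .
    then have "x * d * x = 0" using I(3) x by blast
    then have "a * d * a + (a * d * t + (t * d * a + t * d * t)) = 0" by (simp add: at(1) algebra_simps)
    then have "a = - (a * d * t + (t * d * a + t * d * t))" unfolding d(2) eq_neg_iff_add_eq_0 .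
    moreover have "a * d * t \<in> U" "t * d * a \<in> U" "t * d * t \<in> U"
      using CU(1)[OF CA(2)[OF at(2) d(1)] at(3)] CU(2)[OF at(2) CU(2)[OF d(1) at(3)]]
        UA(2)[OF CU(2)[OF d(1) at(3)] at(3)] by auto
    then have "- (a * d * t + (t * d * a + t * d * t)) \<in> U"
      by (intro subspace_neg[OF UA(1)] subspace_add[OF UA(1)])
    ultimately have "a \<in> J" using UJ by metis
    then have "a = 0" using C(3) at(2) by blast
    then have xU: "x \<in> U" using at by simp
    obtain y where y: "y \<in> U" "x * y * x = x" using ssalg_regular[OF U xU] by blast
    have "x * y \<in> I" using right_idealD(3)[OF I(2) UR[OF y(1)] x] .
    then show "x \<in> {0}" using I(3) x y(2) by simp
  qed
  then have "ssalg R" using subalgR fdR by (simp add: ssalg_def)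
  moreover have "F \<subseteq> R"
  proof
    fix f assume f: "f \<in> F"
    have "f = c f + (f - c f)" by simp
    moreover have "f - c f \<in> U" using XU f by (auto simp: X_def)
    ultimately show "f \<in> R" unfolding R_def using c(1)[OF f] by blast
  qed
  ultimately show thesis using that RA by blast
qed

end

section \<open>Representing an algebra by endomorphisms\<close>

lemma UN_const:
  "a \<in> X \<Longrightarrow> (\<And>x. x \<in> X \<Longrightarrow> f x = Z) \<Longrightarrow> (\<Union>x\<in>X. f x) = Z"
  by blast

lemma kalgD:
  assumes "is_kalgebra A"
  shows "azero A \<in> acarrier A"
    "x \<in> acarrier A \<Longrightarrow> y \<in> acarrier A \<Longrightarrow> aadd A x y \<in> acarrier A"
    "x \<in> acarrier A \<Longrightarrow> y \<in> acarrier A \<Longrightarrow> amul A x y \<in> acarrier A"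
    "x \<in> acarrier A \<Longrightarrow> aneg A x \<in> acarrier A"
    "x \<in> acarrier A \<Longrightarrow> asmul A c x \<in> acarrier A"
    "x \<in> acarrier A \<Longrightarrow> y \<in> acarrier A \<Longrightarrow> z \<in> acarrier A \<Longrightarrow> aadd A (aadd A x y) z = aadd A x (aadd A y z)"
    "x \<in> acarrier A \<Longrightarrow> y \<in> acarrier A \<Longrightarrow> aadd A x y = aadd A y x"
    "x \<in> acarrier A \<Longrightarrow> aadd A (azero A) x = x"
    "x \<in> acarrier A \<Longrightarrow> aadd A (aneg A x) x = azero A"
    "x \<in> acarrier A \<Longrightarrow> y \<in> acarrier A \<Longrightarrow> z \<in> acarrier A \<Longrightarrow> amul A (amul A x y) z = amul A x (amul A y z)"
    "x \<in> acarrier A \<Longrightarrow> y \<in> acarrier A \<Longrightarrow> z \<in> acarrier A \<Longrightarrow> amul A x (aadd A y z) = aadd A (amul A x y) (amul A x z)"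
    "x \<in> acarrier A \<Longrightarrow> y \<in> acarrier A \<Longrightarrow> z \<in> acarrier A \<Longrightarrow> amul A (aadd A x y) z = aadd A (amul A x z) (amul A y z)"
    "x \<in> acarrier A \<Longrightarrow> asmul A 1 x = x"
    "x \<in> acarrier A \<Longrightarrow> asmul A (a * b) x = asmul A a (asmul A b x)"
    "x \<in> acarrier A \<Longrightarrow> asmul A (a + b) x = aadd A (asmul A a x) (asmul A b x)"
    "x \<in> acarrier A \<Longrightarrow> y \<in> acarrier A \<Longrightarrow> asmul A a (aadd A x y) = aadd A (asmul A a x) (asmul A a y)"
    "x \<in> acarrier A \<Longrightarrow> y \<in> acarrier A \<Longrightarrow> amul A (asmul A a x) y = asmul A a (amul A x y)"
    "x \<in> acarrier A \<Longrightarrow> y \<in> acarrier A \<Longrightarrow> amul A x (asmul A a y) = asmul A a (amul A x y)"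
  using assms unfolding is_kalgebra_def by (elim conjE, metis)+

lemma kalg_idem_zero:
  assumes "is_kalgebra A" "x \<in> acarrier A" "aadd A x x = x"
  shows "x = azero A"
proof -
  note A = kalgD[OF assms(1)]
  have "azero A = aadd A (aneg A x) (aadd A x x)" using A(9)[OF assms(2)] assms(3) by simp
  also have "\<dots> = aadd A (aadd A (aneg A x) x) x" using A(6)[OF A(4)[OF assms(2)] assms(2) assms(2)] by simp
  also have "\<dots> = x" using A(8,9) assms(2) by simp
  finally show ?thesis by simp
qed

lemma kalg_zero:
  assumes "is_kalgebra A"
  shows "x \<in> acarrier A \<Longrightarrow> asmul A 0 x = azero A" "asmul A c (azero A) = azero A"
    "x \<in> acarrier A \<Longrightarrow> amul A x (azero A) = azero A"
    "x \<in> acarrier A \<Longrightarrow> aadd A x (azero A) = x"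
proof -
  note A = kalgD[OF assms]
  have z: "aadd A (azero A) (azero A) = azero A" using A(1,8) by simp
  show "asmul A 0 x = azero A" if "x \<in> acarrier A"
    using A(15)[OF that, of 0 0] by (intro kalg_idem_zero[OF assms A(5)[OF that]]) simp
  show "asmul A c (azero A) = azero A"
    using A(16)[OF A(1) A(1), of c] z by (intro kalg_idem_zero[OF assms A(5)[OF A(1)]]) simp
  show "amul A x (azero A) = azero A" if "x \<in> acarrier A"
    using A(11)[OF that A(1) A(1)] z by (intro kalg_idem_zero[OF assms A(3)[OF that A(1)]]) simp
  show "aadd A x (azero A) = x" if "x \<in> acarrier A" using A(7)[OF that A(1)] A(8)[OF that] by simp
qed

lemma kalg_cancel:
  assumes "is_kalgebra A" "x \<in> acarrier A" "y \<in> acarrier A" "aadd A x y = y"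
  shows "x = azero A"
proof -
  note A = kalgD[OF assms(1)]
  have "x = aadd A x (aadd A y (aneg A y))"
    using A(7)[OF assms(3) A(4)[OF assms(3)]] A(9)[OF assms(3)] kalg_zero(4)[OF assms(1,2)] by simp
  also have "\<dots> = aadd A (aadd A x y) (aneg A y)" using A(6)[OF assms(2,3) A(4)[OF assms(3)]] by simp
  also have "\<dots> = azero A" using A(7)[OF assms(3) A(4)[OF assms(3)]] A(9)[OF assms(3)] assms(4) by simp
  finally show ?thesis .
qed

section \<open>A linear copy of the algebra inside a free vector space\<close>

definition pscale :: "'k::field \<Rightarrow> ('a \<Rightarrow>\<^sub>0 'k) \<Rightarrow> ('a \<Rightarrow>\<^sub>0 'k)" where
  "pscale c w = Poly_Mapping.map ((*) c) w"

lemma lookup_pscale [simp]: "Poly_Mapping.lookup (pscale c w) x = c * Poly_Mapping.lookup w x"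
  by (simp add: pscale_def Poly_Mapping.map.rep_eq when_def)

interpretation pm: vector_space pscale
  by unfold_locales (auto intro!: poly_mapping_eqI simp: lookup_add algebra_simps)

text \<open>The canonical linear map from the free vector space on the elements of \<open>A\<close>
  onto \<open>A\<close>. Keys outside the carrier are dropped, so every vector has a value; the
  additive group is written as a multiplicative monoid to make \<open>finprod\<close>
  applicable.\<close>

definition lev :: "('k::field, 'a) kalg \<Rightarrow> ('a \<Rightarrow>\<^sub>0 'k) \<Rightarrow> 'a" where
  "lev A w = finprod \<lparr>carrier = acarrier A, mult = aadd A, one = azero A\<rparr>
     (\<lambda>x. asmul A (Poly_Mapping.lookup w x) x) (Poly_Mapping.keys w \<inter> acarrier A)"

context
  fixes A :: "('k::field, 'a) kalg"
  assumes A: "is_kalgebra A"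
begin

abbreviation "AG \<equiv> \<lparr>carrier = acarrier A, mult = aadd A, one = azero A\<rparr>"

lemma comm_monoid_AG: "comm_monoid AG"
  by (rule comm_monoidI) (use kalgD[OF A] in auto)

interpretation AG: comm_monoid AG
  by (rule comm_monoid_AG)

lemma lev_superset:
  assumes "finite S" "S \<subseteq> acarrier A" "Poly_Mapping.keys w \<inter> acarrier A \<subseteq> S"
  shows "lev A w = finprod AG (\<lambda>x. asmul A (Poly_Mapping.lookup w x) x) S"
  unfolding lev_def
proof (rule AG.finprod_mono_neutral_cong_left[OF assms(1,3)])
  fix i assume "i \<in> S - Poly_Mapping.keys w \<inter> acarrier A"
  then have "Poly_Mapping.lookup w i = 0" "i \<in> acarrier A" using assms(2) by (auto simp: in_keys_iff)
  then show "asmul A (Poly_Mapping.lookup w i) i = \<one>\<^bsub>AG\<^esub>" using kalg_zero(1)[OF A] by simp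
qed (use assms(2) kalgD(5)[OF A] in auto)

lemma lev_closed: "lev A w \<in> acarrier A"
proof -
  have "lev A w \<in> carrier AG" unfolding lev_def
    by (rule AG.finprod_closed) (use kalgD(5)[OF A] in auto)
  then show ?thesis by simp
qed

lemma lev_add: "lev A (v + w) = aadd A (lev A v) (lev A w)"
proof -
  let ?S = "(Poly_Mapping.keys v \<union> Poly_Mapping.keys w) \<inter> acarrier A"
  have S: "finite ?S" "?S \<subseteq> acarrier A" by auto
  have "lev A (v + w) = finprod AG (\<lambda>x. asmul A (Poly_Mapping.lookup (v + w) x) x) ?S"
    by (rule lev_superset[OF S]) (use keys_add[of v w] in blast)
  also have "\<dots> = finprod AG (\<lambda>x. asmul A (Poly_Mapping.lookup v x) x \<otimes>\<^bsub>AG\<^esub> asmul A (Poly_Mapping.lookup w x) x) ?S"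
    by (rule AG.finprod_cong') (use kalgD(5,15)[OF A] kalgD(2)[OF A] in \<open>auto simp: lookup_add\<close>)
  also have "\<dots> = finprod AG (\<lambda>x. asmul A (Poly_Mapping.lookup v x) x) ?S \<otimes>\<^bsub>AG\<^esub>
      finprod AG (\<lambda>x. asmul A (Poly_Mapping.lookup w x) x) ?S"
    by (rule AG.finprod_multf) (use kalgD(5)[OF A] in auto)
  also have "\<dots> = aadd A (lev A v) (lev A w)"
    by (subst (1 2) lev_superset[OF S]) auto
  finally show ?thesis .
qed

lemma asmul_finprod:
  assumes "finite S" "\<And>x. x \<in> S \<Longrightarrow> f x \<in> acarrier A"
  shows "asmul A c (finprod AG f S) = finprod AG (\<lambda>x. asmul A c (f x)) S"
  using assms
proof (induction S rule: finite_induct)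
  case empty
  then show ?case by (simp add: kalg_zero(2)[OF A])
next
  case (insert x S)
  have f: "f \<in> S \<rightarrow> carrier AG" "f x \<in> carrier AG" using insert.prems by auto
  have cf: "(\<lambda>x. asmul A c (f x)) \<in> S \<rightarrow> carrier AG" "asmul A c (f x) \<in> carrier AG"
    using insert.prems kalgD(5)[OF A] by auto
  have "finprod AG f S \<in> acarrier A" using AG.finprod_closed[OF f(1)] by simp
  then show ?case
    using AG.finprod_insert[OF insert.hyps f] AG.finprod_insert[OF insert.hyps cf] insert.IH insert.prems
      kalgD(16)[OF A] by simp
qed

lemma lev_scale: "lev A (pscale c w) = asmul A c (lev A w)"
proof -
  let ?S = "Poly_Mapping.keys w \<inter> acarrier A"
  have S: "finite ?S" "?S \<subseteq> acarrier A" by auto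
  have "lev A (pscale c w) = finprod AG (\<lambda>x. asmul A (Poly_Mapping.lookup (pscale c w) x) x) ?S"
    by (rule lev_superset[OF S]) (auto simp: in_keys_iff)
  also have "\<dots> = finprod AG (\<lambda>x. asmul A c (asmul A (Poly_Mapping.lookup w x) x)) ?S"
    by (rule AG.finprod_cong') (use kalgD(5,14)[OF A] in auto)
  also have "\<dots> = asmul A c (lev A w)"
    unfolding lev_def by (rule asmul_finprod[symmetric]) (use kalgD(5)[OF A] in auto)
  finally show ?thesis .
qed

lemma lev_single: "x \<in> acarrier A \<Longrightarrow> lev A (Poly_Mapping.single x 1) = x"
proof -
  assume x: "x \<in> acarrier A"
  have "lev A (Poly_Mapping.single x 1) = finprod AG (\<lambda>y. asmul A (Poly_Mapping.lookup (Poly_Mapping.single x 1) y) y) {x}"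
    by (rule lev_superset) (use x in auto)
  also have "\<dots> = x" using x kalgD(13)[OF A] kalg_zero(4)[OF A]
    by (subst AG.finprod_insert) auto
  finally show ?thesis .
qed

text \<open>Let \<open>g\<close> project onto the kernel of \<open>lev\<close>. Then
  \<open>id - g\<close> depends only on the value under \<open>lev\<close>, so applying it to any
  preimage of \<open>x\<close>, here the basis vector at \<open>x\<close>, is linear in
  \<open>x\<close>.\<close>

lemma linear_section:
  obtains s :: "'a \<Rightarrow> ('a \<Rightarrow>\<^sub>0 'k)" where
    "\<And>x. x \<in> acarrier A \<Longrightarrow> lev A (s x) = x"
    "\<And>x y. x \<in> acarrier A \<Longrightarrow> y \<in> acarrier A \<Longrightarrow> s (aadd A x y) = s x + s y"
    "\<And>c x. x \<in> acarrier A \<Longrightarrow> s (asmul A c x) = pscale c (s x)"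
proof -
  let ?I = "{w. lev A w = azero A}"
  let ?e = "\<lambda>x. Poly_Mapping.single x (1::'k)"
  note AA = kalgD[OF A]
  have I: "pm.subspace ?I"
  proof (rule pm.subspaceI)
    have "lev A (pscale 0 0) = azero A" unfolding lev_scale using kalg_zero(1)[OF A lev_closed] .
    then show "0 \<in> ?I" by simp
  qed (use lev_add lev_scale kalg_zero[OF A] AA(1,8) in auto)
  interpret vp: vector_space_pair pscale pscale ..
  obtain g where g: "range g \<subseteq> ?I" "Vector_Spaces.linear pscale pscale g" "\<And>x. x \<in> ?I \<Longrightarrow> g x = x"
    using vp.linear_exists_left_inverse_on[OF pm.linear_id I] by auto
  interpret g: Vector_Spaces.linear pscale pscale g by (rule g(2))
  define q where "q w = w - g w" for w
  have q_add: "q (v + w) = q v + q w" for v w by (simp add: q_def g.add)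
  have q_scale: "q (pscale c w) = pscale c (q w)" for c w by (simp add: q_def g.scale pm.scale_right_diff_distrib)
  have lev_q: "lev A (q w) = lev A w" for w
  proof -
    have "lev A w = aadd A (lev A (q w)) (lev A (g w))" by (simp add: lev_add[symmetric] q_def)
    moreover have "lev A (g w) = azero A" using g(1) by blast
    ultimately show ?thesis using kalg_zero(4)[OF A lev_closed] by simp
  qed
  have q_eq: "q v = q w" if "lev A v = lev A w" for v w
  proof -
    have "lev A v = aadd A (lev A (v - w)) (lev A w)" by (simp add: lev_add[symmetric])
    then have "lev A (v - w) = azero A" using kalg_cancel[OF A lev_closed lev_closed] that by metis
    then have "g (v - w) = v - w" using g(3) by blast
    then have "q (v - w) = 0" by (simp add: q_def)
    then show ?thesis using q_add[of "v - w" w] by simp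
  qed
  show thesis
  proof (rule that[of "\<lambda>x. q (?e x)"])
    show "lev A (q (?e x)) = x" if "x \<in> acarrier A" for x using lev_q lev_single[OF that] by simp
    show "q (?e (aadd A x y)) = q (?e x) + q (?e y)" if "x \<in> acarrier A" "y \<in> acarrier A" for x y
      unfolding q_add[symmetric] by (rule q_eq) (simp add: lev_add lev_single that AA(2))
    show "q (?e (asmul A c x)) = pscale c (q (?e x))" if "x \<in> acarrier A" for c x
      unfolding q_scale[symmetric] by (rule q_eq) (simp add: lev_scale lev_single that AA(5))
  qed
qed

end

definition emb0 :: "'k::field \<Rightarrow> ('k \<times> ('a \<Rightarrow>\<^sub>0 'k)) endo" where
  "emb0 c = Endo (\<lambda>v. (c * fst v, pscale c (snd v)))"

lemma app_emb0: "app (emb0 c) v = (c * fst v, pscale c (snd v))"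
  unfolding emb0_def by (subst app_Endo) (auto simp: distrib_left pm.scale_right_distrib)

lemma scalar_ring_emb0: "scalar_ring emb0"
  by unfold_locales (auto intro!: endo_eqI simp: app_emb0 distrib_right pm.scale_left_distrib mult.assoc prod_eq_iff)

locale kalg_rep = scalar_ring emb
  for emb :: "'k::field \<Rightarrow> 'r::{ring,monoid_mult}" +
  fixes R :: "('k, 'a) kalg" and \<rho> :: "'a \<Rightarrow> 'r"
  assumes R: "is_kalgebra R"
    and inj: "inj_on \<rho> (acarrier R)"
    and rho_add: "x \<in> acarrier R \<Longrightarrow> y \<in> acarrier R \<Longrightarrow> \<rho> (aadd R x y) = \<rho> x + \<rho> y"
    and rho_mul: "x \<in> acarrier R \<Longrightarrow> y \<in> acarrier R \<Longrightarrow> \<rho> (amul R x y) = \<rho> x * \<rho> y"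
    and rho_smul: "x \<in> acarrier R \<Longrightarrow> \<rho> (asmul R c x) = emb c * \<rho> x"
    and rho_central: "x \<in> acarrier R \<Longrightarrow> \<rho> x * emb c = emb c * \<rho> x"

text \<open>The left regular representation on the unitization \<open>K \<times> A\<close>, with \<open>A\<close> identified with a
  complement of the linear relations in the free vector space on its elements.\<close>

lemma kalgebra_embedding:
  fixes A :: "('k::field, 'a) kalg"
  assumes A: "is_kalgebra A"
  obtains \<rho> :: "'a \<Rightarrow> ('k \<times> ('a \<Rightarrow>\<^sub>0 'k)) endo" where "kalg_rep emb0 A \<rho>"
proof -
  obtain s :: "'a \<Rightarrow> ('a \<Rightarrow>\<^sub>0 'k)" where s:
    "\<And>x. x \<in> acarrier A \<Longrightarrow> lev A (s x) = x"
    "\<And>x y. x \<in> acarrier A \<Longrightarrow> y \<in> acarrier A \<Longrightarrow> s (aadd A x y) = s x + s y"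
    "\<And>c x. x \<in> acarrier A \<Longrightarrow> s (asmul A c x) = pscale c (s x)"
    by (rule linear_section[OF A]) blast
  note AA = kalgD[OF A]
  note lev = lev_closed[OF A] lev_add[OF A] lev_scale[OF A]
  \<comment> \<open>In the unitization, \<open>x * (k, v) = (0, k x + x v)\<close>. The vector
    \<open>v\<close> is arbitrary and is read as an algebra element through
    \<open>lev\<close>.\<close>
  define f where "f x v = (0::'k, pscale (fst v) (s x) + s (amul A x (lev A (snd v))))" for x v
  define \<rho> where "\<rho> x = Endo (f x)" for x
  have app: "app (\<rho> x) v = f x v" if x: "x \<in> acarrier A" for x v
    unfolding \<rho>_def
    by (subst app_Endo)
      (auto simp: f_def lev AA(11)[OF x] AA(3)[OF x] s(2) pm.scale_left_distrib)
  have "kalg_rep emb0 A \<rho>"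
  proof (intro kalg_rep.intro scalar_ring_emb0 kalg_rep_axioms.intro A)
    show "inj_on \<rho> (acarrier A)"
    proof (rule inj_onI)
      fix x y assume xy: "x \<in> acarrier A" "y \<in> acarrier A" "\<rho> x = \<rho> y"
      have 0: "lev A 0 = azero A" using lev(3)[of 0 0] kalg_zero(1)[OF A lev(1)] by simp
      have "s (azero A) = 0" using s(3)[OF AA(1), of 0] kalg_zero(2)[OF A] by simp
      \<comment> \<open>Acting on the unit \<open>(1, 0)\<close> recovers \<open>z\<close>, even if
        \<open>A\<close> has elements that annihilate all of \<open>A\<close>.\<close>
      then have "app (\<rho> z) (1, 0) = (0, s z)" if "z \<in> acarrier A" for z
        using that 0 kalg_zero(3)[OF A] by (simp add: app f_def)
      then have "s x = s y" using xy by (metis snd_conv)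
      then show "x = y" using s(1) xy by metis
    qed
  next
    fix x y assume xy: "x \<in> acarrier A" "y \<in> acarrier A"
    show "\<rho> (aadd A x y) = \<rho> x + \<rho> y"
      using xy AA by (intro endo_eqI) (simp add: app f_def s(2) lev pm.scale_right_distrib)
    show "\<rho> (amul A x y) = \<rho> x * \<rho> y"
      using xy AA by (intro endo_eqI) (simp add: app f_def s lev)
  next
    fix x c assume x: "x \<in> acarrier A"
    show "\<rho> (asmul A c x) = emb0 c * \<rho> x"
      using x AA by (intro endo_eqI) (simp add: app f_def s(3) lev app_emb0 pm.scale_right_distrib mult.commute)
    show "\<rho> x * emb0 c = emb0 c * \<rho> x"
      using x AA by (intro endo_eqI) (simp add: app f_def s(3) lev app_emb0 pm.scale_right_distrib)
  qed
  then show thesis by (rule that)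
qed

section \<open>Transfer of semisimplicity between the algebra and its image\<close>

context kalg_rep
begin

lemmas RA = kalgD[OF R]

lemma rho_inj: "x \<in> acarrier R \<Longrightarrow> y \<in> acarrier R \<Longrightarrow> \<rho> x = \<rho> y \<Longrightarrow> x = y"
  using inj by (auto dest: inj_onD)

lemma rho_zero [simp]: "\<rho> (azero R) = 0"
  using rho_smul[OF RA(1), of 0] kalg_zero(2)[OF R] by simp

lemma rho_neg: "x \<in> acarrier R \<Longrightarrow> \<rho> (aneg R x) = - \<rho> x"
  using rho_add[OF RA(4), of x x] RA(9) by (simp add: eq_neg_iff_add_eq_0)

lemma rho_scl: "x \<in> acarrier R \<Longrightarrow> \<rho> (asmul R c x) = scl c (\<rho> x)"
  by (simp add: rho_smul scl_def)

lemma subspace_image: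
  assumes "ksubspace R S"
  shows "subspace (\<rho> ` S)"
proof -
  have S: "\<And>x. x \<in> S \<Longrightarrow> x \<in> acarrier R" "azero R \<in> S" "\<And>x y. x \<in> S \<Longrightarrow> y \<in> S \<Longrightarrow> aadd R x y \<in> S"
    "\<And>c x. x \<in> S \<Longrightarrow> asmul R c x \<in> S" using assms by (auto simp: ksubspace_def)
  show ?thesis
  proof (rule subspaceI)
    show "0 \<in> \<rho> ` S" using S(2) rho_zero by (metis imageI)
  next
    fix u v assume "u \<in> \<rho> ` S" "v \<in> \<rho> ` S"
    then obtain x y where "u = \<rho> x" "v = \<rho> y" "x \<in> S" "y \<in> S" by blast
    moreover from this have "u + v = \<rho> (aadd R x y)" using rho_add S(1) by auto
    ultimately show "u + v \<in> \<rho> ` S" using S(3) by blast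
  next
    fix c u assume "u \<in> \<rho> ` S"
    then obtain x where "u = \<rho> x" "x \<in> S" by blast
    moreover from this have "scl c u = \<rho> (asmul R c x)" using rho_scl S(1) by auto
    ultimately show "scl c u \<in> \<rho> ` S" using S(4) by blast
  qed
qed

lemma ksubspace_preimage:
  assumes "subspace I" "ksubspace R B"
  shows "ksubspace R {x\<in>B. \<rho> x \<in> I}"
proof -
  have "x \<in> acarrier R" if "x \<in> B" for x using assms(2) that by (auto simp: ksubspace_def)
  then show ?thesis
    using assms(2) subspace_0[OF assms(1)] subspace_add[OF assms(1)] subspace_neg[OF assms(1)] subspace_scale[OF assms(1)]
    by (auto simp: ksubspace_def rho_add rho_neg rho_scl)
qed

lemma subalg_image:
  assumes "subalgebra R B"
  shows "subalg (\<rho> ` B)"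
proof -
  have B: "x \<in> acarrier R" if "x \<in> B" for x using assms that by (auto simp: subalgebra_def ksubspace_def)
  show ?thesis
    unfolding subalg_def
  proof (intro conjI ballI allI)
    show "subspace (\<rho> ` B)" using subspace_image assms by (auto simp: subalgebra_def)
  next
    fix u v assume "u \<in> \<rho> ` B" "v \<in> \<rho> ` B"
    then obtain x y where "u = \<rho> x" "v = \<rho> y" "x \<in> B" "y \<in> B" by blast
    moreover from this have "u * v = \<rho> (amul R x y)" using rho_mul B by auto
    moreover from calculation have "amul R x y \<in> B" using assms by (auto simp: subalgebra_def)
    ultimately show "u * v \<in> \<rho> ` B" by blast
  next
    fix u c assume "u \<in> \<rho> ` B"
    then show "u * emb c = emb c * u" using rho_central B by auto
  qed
qed

lemma ssalg_image:
  assumes B: "subalgebra R B" and f: "fdss (R\<lparr>acarrier := B\<rparr>)"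
  shows "ssalg (\<rho> ` B)"
proof -
  have BR: "x \<in> acarrier R" if "x \<in> B" for x using B that by (auto simp: subalgebra_def ksubspace_def)
  have sa: "subalg (\<rho> ` B)" using subalg_image[OF B] .
  obtain S where S: "finite S" "S \<subseteq> B" "B \<subseteq> lin_span (R\<lparr>acarrier := B\<rparr>) S"
    using f by (auto simp: fdss_def fin_dim_def)
  have span: "x \<in> acarrier R \<and> \<rho> x \<in> span (\<rho> ` S)" if "x \<in> lin_span (R\<lparr>acarrier := B\<rparr>) S" for x
    using that
  proof (induction rule: lin_span.induct)
    case (span_base x)
    then show ?case using S(2) BR by (auto intro: span_clauses(1))
  qed (auto simp: RA rho_add rho_scl intro!: span_clauses(2-4))
  have "fd (\<rho> ` B)" unfolding fd_def
    by (rule exI[of _ "\<rho> ` S"]) (use S span in auto)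
  moreover have "square_free (\<rho> ` B)"
    unfolding square_free_def
  proof (intro allI impI subsetI, elim conjE)
    fix I v assume I: "left_ideal (\<rho> ` B) I" "right_ideal (\<rho> ` B) I" "\<forall>x\<in>I. \<forall>y\<in>I. x * y = 0" and v: "v \<in> I"
    let ?I = "{x\<in>B. \<rho> x \<in> I}"
    have k: "ksubspace R ?I" using ksubspace_preimage[OF left_idealD(1)[OF I(1)]] B by (auto simp: subalgebra_def)
    have m: "amul R x y \<in> ?I \<and> amul R y x \<in> ?I" if x: "x \<in> B" and y: "y \<in> ?I" for x y
      using x y B left_idealD(3)[OF I(1), of "\<rho> x" "\<rho> y"] right_idealD(3)[OF I(2), of "\<rho> x" "\<rho> y"] BR
      by (auto simp: rho_mul subalgebra_def)
    have "kideal (R\<lparr>acarrier := B\<rparr>) ?I"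
      using k m by (auto simp: kideal_def ksubspace_def)
    moreover have "nilpotent_ideal (R\<lparr>acarrier := B\<rparr>) ?I"
      unfolding nilpotent_ideal_def
    proof (intro exI[of _ 2] conjI allI impI)
      fix xs assume "length xs = 2 \<and> set xs \<subseteq> ?I"
      then obtain x y where xs: "xs = [x, y]" "x \<in> ?I" "y \<in> ?I" by (auto simp: numeral_2_eq_2 length_Suc_conv)
      have "\<rho> (amul R x y) = \<rho> (azero R)" using xs I(3) BR by (simp add: rho_mul)
      then have "amul R x y = azero R" using xs BR RA(1,3) by (intro rho_inj) auto
      then show "aprod (R\<lparr>acarrier := B\<rparr>) xs = azero (R\<lparr>acarrier := B\<rparr>)" by (simp add: xs(1))
    qed simp
    ultimately have "?I = {azero R}" using f by (auto simp: fdss_def semisimple_def)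
    moreover obtain x where "v = \<rho> x" "x \<in> B" using left_idealD(2)[OF I(1) v] by blast
    ultimately have "x = azero R" using v by blast
    then show "v \<in> {0}" using \<open>v = \<rho> x\<close> by simp
  qed
  ultimately show ?thesis using sa by (simp add: ssalg_def)
qed

lemma is_kalgebra_sub:
  assumes "subalgebra R B"
  shows "is_kalgebra (R\<lparr>acarrier := B\<rparr>)"
proof -
  have "x \<in> acarrier R" if "x \<in> B" for x using assms that by (auto simp: subalgebra_def ksubspace_def)
  then show ?thesis
    using assms RA unfolding is_kalgebra_def subalgebra_def ksubspace_def by (simp add: subset_iff)
qed

text \<open>For \<open>x\<close> in a nilpotent ideal, regularity of the image provides
  \<open>y\<close> such that \<open>z = x * y\<close> is an idempotent of the ideal and
  \<open>z * x = x\<close>. All powers of \<open>z\<close> equal \<open>z\<close>, so nilpotency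
  gives \<open>z = 0\<close> and \<open>x = 0\<close>.\<close>

lemma fdss_preimage:
  assumes C: "ssalg C" "C \<subseteq> \<rho> ` acarrier R"
  defines "B \<equiv> {x\<in>acarrier R. \<rho> x \<in> C}"
  shows "subalgebra R B" "fdss (R\<lparr>acarrier := B\<rparr>)"
proof -
  note CA = subalgD[OF ssalgD(1)[OF C(1)]]
  have full: "ksubspace R (acarrier R)" using RA by (auto simp: ksubspace_def)
  have mulB: "amul R x y \<in> B" if "x \<in> B" "y \<in> B" for x y
    using that RA(3) rho_mul CA(2) by (auto simp: B_def)
  show sub: "subalgebra R B"
    using ksubspace_preimage[OF CA(1) full] mulB by (auto simp: subalgebra_def B_def)
  have BR: "x \<in> acarrier R" if "x \<in> B" for x using that by (simp add: B_def)
  obtain S where S: "finite S" "S \<subseteq> C" "span S = C"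
    by (rule fd_basis[OF ssalgD(2)[OF C(1)] CA(1)]) blast
  define T where "T = {x\<in>acarrier R. \<rho> x \<in> S}"
  have T: "\<rho> ` T = S" "T \<subseteq> B" using S(2) C(2) by (auto simp: T_def B_def)
  have fT: "finite T"
    by (rule finite_imageD[of \<rho>]) (use T S(1) in \<open>auto simp: T_def inj_on_def dest: rho_inj\<close>)
  have ex: "\<exists>x\<in>lin_span (R\<lparr>acarrier := B\<rparr>) T \<inter> acarrier R. \<rho> x = v" if "v \<in> span S" for v
    using that
  proof (induction rule: span_induct_alt)
    case base
    have "azero R \<in> lin_span (R\<lparr>acarrier := B\<rparr>) T"
      using lin_span.span_zero[of "R\<lparr>acarrier := B\<rparr>"] by simp
    then show ?case using RA(1) by (intro bexI[of _ "azero R"]) auto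
  next
    case (step c u v)
    then obtain y where y: "y \<in> lin_span (R\<lparr>acarrier := B\<rparr>) T" "y \<in> acarrier R" "\<rho> y = v" by blast
    obtain x where x: "x \<in> T" "\<rho> x = u" "x \<in> acarrier R" using step(1) T BR by blast
    have "aadd R (asmul R c x) y \<in> lin_span (R\<lparr>acarrier := B\<rparr>) T"
      using lin_span.span_add[OF lin_span.span_smul[OF lin_span.span_base[OF x(1)], of "R\<lparr>acarrier := B\<rparr>" c] y(1)] by simp
    then show ?case using x y RA by (intro bexI[of _ "aadd R (asmul R c x) y"]) (auto simp: rho_add rho_scl)
  qed
  have "fin_dim (R\<lparr>acarrier := B\<rparr>)"
    unfolding fin_dim_def
  proof (intro exI[of _ T] conjI fT subsetI)
    fix x assume "x \<in> acarrier (R\<lparr>acarrier := B\<rparr>)"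
    then have x: "x \<in> acarrier R" "\<rho> x \<in> span S" using S(3) by (auto simp: B_def)
    then obtain y where "y \<in> lin_span (R\<lparr>acarrier := B\<rparr>) T" "y \<in> acarrier R" "\<rho> y = \<rho> x" using ex by blast
    then show "x \<in> lin_span (R\<lparr>acarrier := B\<rparr>) T" using rho_inj x(1) by metis
  qed (use T(2) in auto)
  moreover have "semisimple (R\<lparr>acarrier := B\<rparr>)"
    unfolding semisimple_def
  proof (intro allI impI, elim conjE)
    fix I assume I: "kideal (R\<lparr>acarrier := B\<rparr>) I" "nilpotent_ideal (R\<lparr>acarrier := B\<rparr>) I"
    have "x = azero R" if x: "x \<in> I" for x
    proof -
      have xB: "x \<in> B" using x I(1) by (auto simp: kideal_def ksubspace_def)
      then have "\<rho> x \<in> C" by (simp add: B_def)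
      then obtain w where w: "w \<in> C" "\<rho> x * w * \<rho> x = \<rho> x" using ssalg_regular[OF C(1)] by blast
      obtain y where y: "y \<in> acarrier R" "\<rho> y = w" using w(1) C(2) by blast
      then have yB: "y \<in> B" using w(1) by (simp add: B_def)
      define z where "z = amul R x y"
      have zI: "z \<in> I" using I(1) x yB by (auto simp: kideal_def z_def)
      have zR: "z \<in> acarrier R" using RA(3) BR xB yB by (simp add: z_def)
      have rz: "\<rho> z = \<rho> x * w" using rho_mul BR xB y by (simp add: z_def)
      have "\<rho> (amul R z z) = \<rho> z" unfolding rho_mul[OF zR zR] rz using w(2) by (metis mult.assoc)
      then have zz: "amul R z z = z" using rho_inj RA(3) zR by blast
      \<comment> \<open>Lengths start at one, because \<open>aprod\<close> of the empty list is
        zero; the exponent of nilpotency is positive.\<close>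
      have pow: "aprod (R\<lparr>acarrier := B\<rparr>) (replicate (Suc n) z) = z" for n
        by (induction n) (simp_all add: zz)
      obtain n where n: "n > 0" "\<And>xs. length xs = n \<Longrightarrow> set xs \<subseteq> I \<Longrightarrow> aprod (R\<lparr>acarrier := B\<rparr>) xs = azero R"
        using I(2) by (auto simp: nilpotent_ideal_def)
      have "z = azero R"
        using n(2)[of "replicate n z"] pow[of "n - 1"] n(1) zI by (simp add: set_replicate_conv_if)
      then have "\<rho> x = 0" using w(2) rz rho_zero by (metis mult_zero_left)
      then show ?thesis using rho_inj BR[OF xB] RA(1) rho_zero by metis
    qed
    moreover have "azero R \<in> I" using I(1) by (auto simp: kideal_def ksubspace_def)
    ultimately have "I = {azero R}" by blast
    then show "I = {azero (R\<lparr>acarrier := B\<rparr>)}" by simp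
  qed
  ultimately show "fdss (R\<lparr>acarrier := B\<rparr>)" using is_kalgebra_sub[OF sub] by (simp add: fdss_def)
qed

section \<open>Cosets and the quotient algebra\<close>

context
  fixes J :: "'a set"
  assumes J: "kideal R J"
begin

lemma JR: "x \<in> J \<Longrightarrow> x \<in> acarrier R"
  using J by (auto simp: kideal_def ksubspace_def)

lemma subspace_J: "subspace (\<rho> ` J)"
  using J subspace_image by (auto simp: kideal_def)

text \<open>Membership in a coset becomes subtraction in the ambient ring, where the coset
  calculations are carried out.\<close>

lemma coset_eq:
  assumes x: "x \<in> acarrier R"
  shows "coset R J x = {y\<in>acarrier R. \<rho> y - \<rho> x \<in> \<rho> ` J}"
proof (intro equalityI subsetI)
  fix y assume "y \<in> coset R J x"
  then obtain j where j: "j \<in> J" "y = aadd R x j" by (auto simp: coset_def)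
  then show "y \<in> {y\<in>acarrier R. \<rho> y - \<rho> x \<in> \<rho> ` J}" using x JR RA(2) by (auto simp: rho_add)
next
  fix y assume "y \<in> {y\<in>acarrier R. \<rho> y - \<rho> x \<in> \<rho> ` J}"
  then obtain j where j: "y \<in> acarrier R" "j \<in> J" "\<rho> y - \<rho> x = \<rho> j" by auto
  then have "\<rho> y = \<rho> (aadd R x j)" using x JR by (simp add: rho_add algebra_simps)
  then have "y = aadd R x j" using rho_inj j(1) RA(2)[OF x JR[OF j(2)]] by blast
  then show "y \<in> coset R J x" using j(2) by (auto simp: coset_def)
qed

lemma coset_eq_iff:
  assumes "x \<in> acarrier R" "y \<in> acarrier R"
  shows "coset R J x = coset R J y \<longleftrightarrow> \<rho> x - \<rho> y \<in> \<rho> ` J"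
proof
  assume "coset R J x = coset R J y"
  moreover have "x \<in> coset R J x" using coset_eq[OF assms(1)] assms(1) subspace_0[OF subspace_J] by simp
  ultimately show "\<rho> x - \<rho> y \<in> \<rho> ` J" using coset_eq[OF assms(2)] by auto
next
  assume xy: "\<rho> x - \<rho> y \<in> \<rho> ` J"
  have "\<rho> z - \<rho> x \<in> \<rho> ` J \<longleftrightarrow> \<rho> z - \<rho> y \<in> \<rho> ` J" for z
    using subspace_add[OF subspace_J, of "\<rho> z - \<rho> x", OF _ xy] subspace_diff[OF subspace_J, of "\<rho> z - \<rho> y", OF _ xy]
    by auto
  then show "coset R J x = coset R J y" using coset_eq assms by simp
qed

lemma self_in_coset: "x \<in> acarrier R \<Longrightarrow> x \<in> coset R J x"
  using coset_eq subspace_0[OF subspace_J] by simp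

lemma J_mult:
  assumes "u \<in> \<rho> ` J" "x \<in> acarrier R"
  shows "\<rho> x * u \<in> \<rho> ` J" "u * \<rho> x \<in> \<rho> ` J"
proof -
  obtain j where j: "u = \<rho> j" "j \<in> J" using assms(1) by blast
  then have "amul R x j \<in> J" "amul R j x \<in> J" using J assms(2) by (auto simp: kideal_def)
  then show "\<rho> x * u \<in> \<rho> ` J" "u * \<rho> x \<in> \<rho> ` J"
    using rho_mul[OF assms(2) JR[OF j(2)]] rho_mul[OF JR[OF j(2)] assms(2)] j(1) by (metis imageI)+
qed

text \<open>Each operation is a union over representatives. All members of the union are the same
  coset, and there is at least one, since every element represents its own coset.\<close>

lemma quot_ops:
  assumes x: "x \<in> acarrier R" and y: "y \<in> acarrier R"
  shows "aadd (quot_alg R J) (coset R J x) (coset R J y) = coset R J (aadd R x y)"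
    "amul (quot_alg R J) (coset R J x) (coset R J y) = coset R J (amul R x y)"
    "asmul (quot_alg R J) c (coset R J x) = coset R J (asmul R c x)"
proof -
  have in_coset: "x' \<in> acarrier R" "\<rho> x' - \<rho> x \<in> \<rho> ` J" if "x' \<in> coset R J x" "x \<in> acarrier R" for x x'
    using that coset_eq by auto
  have "coset R J (aadd R x' y') = coset R J (aadd R x y)" if "x' \<in> coset R J x" "y' \<in> coset R J y" for x' y'
  proof -
    note d = in_coset[OF that(1) x] in_coset[OF that(2) y]
    have "\<rho> x' + \<rho> y' - (\<rho> x + \<rho> y) = (\<rho> x' - \<rho> x) + (\<rho> y' - \<rho> y)" by simp
    then have "\<rho> x' + \<rho> y' - (\<rho> x + \<rho> y) \<in> \<rho> ` J" using subspace_add[OF subspace_J d(2,4)] by metis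
    then show ?thesis using d x y RA(2) by (simp add: coset_eq_iff rho_add)
  qed
  then show "aadd (quot_alg R J) (coset R J x) (coset R J y) = coset R J (aadd R x y)"
    unfolding quot_alg_def kalg.simps
    by (intro UN_const[OF self_in_coset[OF x]] UN_const[OF self_in_coset[OF y]])
  have "coset R J (amul R x' y') = coset R J (amul R x y)" if "x' \<in> coset R J x" "y' \<in> coset R J y" for x' y'
  proof -
    note d = in_coset[OF that(1) x] in_coset[OF that(2) y]
    have "\<rho> x' * \<rho> y' - \<rho> x * \<rho> y = (\<rho> x' - \<rho> x) * \<rho> y' + \<rho> x * (\<rho> y' - \<rho> y)" by (simp add: algebra_simps)
    then have "\<rho> x' * \<rho> y' - \<rho> x * \<rho> y \<in> \<rho> ` J"
      using subspace_add[OF subspace_J J_mult(2)[OF d(2,3)] J_mult(1)[OF d(4) x]] by simp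
    then show ?thesis using d x y RA(3) by (simp add: coset_eq_iff rho_mul)
  qed
  then show "amul (quot_alg R J) (coset R J x) (coset R J y) = coset R J (amul R x y)"
    unfolding quot_alg_def kalg.simps
    by (intro UN_const[OF self_in_coset[OF x]] UN_const[OF self_in_coset[OF y]])
  have "coset R J (asmul R c x') = coset R J (asmul R c x)" if "x' \<in> coset R J x" for x'
  proof -
    note d = in_coset[OF that(1) x]
    have "scl c (\<rho> x' - \<rho> x) \<in> \<rho> ` J" using subspace_scale[OF subspace_J d(2)] .
    then show ?thesis using d x RA(5) by (simp add: coset_eq_iff rho_scl scale_right_diff_distrib)
  qed
  then show "asmul (quot_alg R J) c (coset R J x) = coset R J (asmul R c x)"
    unfolding quot_alg_def kalg.simps by (intro UN_const[OF self_in_coset[OF x]])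
qed

lemma quot_neg:
  assumes x: "x \<in> acarrier R"
  shows "aneg (quot_alg R J) (coset R J x) = coset R J (aneg R x)"
proof -
  have "coset R J (aneg R x') = coset R J (aneg R x)" if x': "x' \<in> coset R J x" for x'
  proof -
    have d: "x' \<in> acarrier R" "\<rho> x' - \<rho> x \<in> \<rho> ` J" using coset_eq[OF x] x' by auto
    have "- (\<rho> x' - \<rho> x) \<in> \<rho> ` J" using subspace_neg[OF subspace_J d(2)] .
    then show ?thesis using d x RA(4) by (simp add: coset_eq_iff rho_neg)
  qed
  then show ?thesis unfolding quot_alg_def kalg.simps by (intro UN_const[OF self_in_coset[OF x]])
qed

lemma quot_carrier: "acarrier (quot_alg R J) = coset R J ` acarrier R"
  and quot_zero: "azero (quot_alg R J) = coset R J (azero R)"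
  by (simp_all add: quot_alg_def)

lemma loc_ss_J:
  assumes "locally_fdss (R\<lparr>acarrier := J\<rparr>)"
  shows "loc_ss (\<rho> ` J)"
  unfolding loc_ss_def
proof (intro allI impI, elim conjE)
  fix X assume X: "finite X" "X \<subseteq> \<rho> ` J"
  then obtain F where F: "finite F" "F \<subseteq> J" "X = \<rho> ` F" by (meson finite_subset_image)
  then obtain B where B: "subalgebra (R\<lparr>acarrier := J\<rparr>) B" "F \<subseteq> B" "fdss (R\<lparr>acarrier := B\<rparr>)"
    using assms by (auto simp: locally_fdss_def)
  have BJ: "B \<subseteq> J" using B(1) by (auto simp: subalgebra_def ksubspace_def)
  then have "subalgebra R B" using B(1) JR by (auto simp: subalgebra_def ksubspace_def)
  then have "ssalg (\<rho> ` B)" using ssalg_image B(3) by blast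
  then show "\<exists>T. ssalg T \<and> X \<subseteq> T \<and> T \<subseteq> \<rho> ` J" using F(3) B(2) BJ by blast
qed

theorem extension_locally_fdss:
  assumes perf: "perfect_field TYPE('k)" and lJ: "locally_fdss (R\<lparr>acarrier := J\<rparr>)"
    and lQ: "locally_fdss (quot_alg R J)"
  shows "locally_fdss R"
  unfolding locally_fdss_def
proof (intro allI impI, elim conjE)
  fix F assume F: "finite F" "F \<subseteq> acarrier R"
  let ?Q = "quot_alg R J" and ?c = "coset R J"
  have "finite (?c ` F)" "?c ` F \<subseteq> acarrier ?Q" using F by (auto simp: quot_carrier)
  then obtain S where S: "subalgebra ?Q S" "?c ` F \<subseteq> S" "fdss (?Q\<lparr>acarrier := S\<rparr>)"
    using lQ unfolding locally_fdss_def by meson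
  have SQ: "S \<subseteq> ?c ` acarrier R" "?c (azero R) \<in> S" "\<And>X Y. X \<in> S \<Longrightarrow> Y \<in> S \<Longrightarrow> aadd ?Q X Y \<in> S"
    "\<And>X. X \<in> S \<Longrightarrow> aneg ?Q X \<in> S" "\<And>X c. X \<in> S \<Longrightarrow> asmul ?Q c X \<in> S" "\<And>X Y. X \<in> S \<Longrightarrow> Y \<in> S \<Longrightarrow> amul ?Q X Y \<in> S"
    using S(1) by (auto simp: subalgebra_def ksubspace_def quot_carrier quot_zero)
  define A0 where "A0 = {x\<in>acarrier R. ?c x \<in> S}"
  have A0R: "x \<in> acarrier R" if "x \<in> A0" for x using that by (simp add: A0_def)
  have A0: "subalgebra R A0"
    unfolding subalgebra_def ksubspace_def
  proof (intro conjI ballI allI)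
    fix x y assume "x \<in> A0" "y \<in> A0"
    then have xy: "x \<in> acarrier R" "y \<in> acarrier R" "?c x \<in> S" "?c y \<in> S" by (auto simp: A0_def)
    show "aadd R x y \<in> A0" using SQ(3)[OF xy(3,4)] RA(2) xy by (simp add: A0_def quot_ops)
    show "amul R x y \<in> A0" using SQ(6)[OF xy(3,4)] RA(3) xy by (simp add: A0_def quot_ops)
  next
    fix x c assume "x \<in> A0"
    then have x: "x \<in> acarrier R" "?c x \<in> S" by (auto simp: A0_def)
    show "aneg R x \<in> A0" using SQ(4)[OF x(2)] RA(4) x by (simp add: A0_def quot_neg)
    show "asmul R c x \<in> A0" using SQ(5)[OF x(2), of c] RA(5) x quot_ops(3)[OF x(1) x(1)] by (simp add: A0_def)
  qed (use SQ(2) RA(1) in \<open>auto simp: A0_def\<close>)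
  have JA0: "j \<in> A0" if j: "j \<in> J" for j
  proof -
    have "?c j = ?c (azero R)" using j JR RA(1) by (simp add: coset_eq_iff)
    then show ?thesis using SQ(2) JR[OF j] by (simp add: A0_def)
  qed
  let ?A = "\<rho> ` A0" and ?J = "\<rho> ` J"
  have lid: "left_ideal ?A ?J" unfolding left_ideal_def
    using subspace_J JA0 J_mult(1) A0R by (auto simp del: image_iff)
  have rid: "right_ideal ?A ?J" unfolding right_ideal_def
    using subspace_J JA0 J_mult(2) A0R by (auto simp del: image_iff)
  obtain S0 where S0: "finite S0" "S0 \<subseteq> S" "S \<subseteq> lin_span (?Q\<lparr>acarrier := S\<rparr>) S0"
    using S(3) by (auto simp: fdss_def fin_dim_def)
  have "\<forall>X\<in>S0. \<exists>r\<in>acarrier R. ?c r = X" using S0(2) SQ(1) by blast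
  then obtain r where r: "\<And>X. X \<in> S0 \<Longrightarrow> r X \<in> acarrier R" "\<And>X. X \<in> S0 \<Longrightarrow> ?c (r X) = X" by metis
  \<comment> \<open>Lifts of a finite spanning set of \<open>S\<close>; together with
    \<open>J\<close> they span the preimage.\<close>
  define G where "G = (\<lambda>X. \<rho> (r X)) ` S0"
  have span: "\<exists>x\<in>acarrier R. ?c x = X \<and> \<rho> x \<in> span G" if "X \<in> lin_span (?Q\<lparr>acarrier := S\<rparr>) S0" for X
    using that
  proof (induction rule: lin_span.induct)
    case span_zero
    then show ?case using RA(1) by (intro bexI[of _ "azero R"]) (auto simp: quot_zero span_clauses(2))
  next
    case (span_base X)
    then show ?case using r by (intro bexI[of _ "r X"]) (auto simp: G_def intro: span_clauses(1))
  next
    case (span_add X Y)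
    then obtain x y where "x \<in> acarrier R" "?c x = X" "\<rho> x \<in> span G" "y \<in> acarrier R" "?c y = Y" "\<rho> y \<in> span G"
      by blast
    then show ?case using RA(2)
      by (intro bexI[of _ "aadd R x y"]) (auto simp: rho_add quot_ops(1)[symmetric] intro: span_clauses(3))
  next
    case (span_smul X c)
    then obtain x where "x \<in> acarrier R" "?c x = X" "\<rho> x \<in> span G" by blast
    then show ?case using RA(5)
      by (intro bexI[of _ "asmul R c x"]) (auto simp: rho_scl quot_ops(3)[symmetric] intro: span_clauses(4))
  qed
  have fG: "finite G" using S0(1) by (simp add: G_def)
  have AG: "?A \<subseteq> span (G \<union> ?J)"
  proof
    fix v assume "v \<in> ?A"
    then obtain a where a: "v = \<rho> a" "a \<in> acarrier R" "?c a \<in> S" by (auto simp: A0_def)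
    then obtain x where x: "x \<in> acarrier R" "?c x = ?c a" "\<rho> x \<in> span G" using span S0(3) by blast
    then have "\<rho> a - \<rho> x \<in> ?J" using coset_eq_iff[OF a(2) x(1)] by simp
    then have "\<rho> a - \<rho> x \<in> span (G \<union> ?J)" by (intro span_base) blast
    moreover have "\<rho> x \<in> span (G \<union> ?J)" using x(3) span_mono[of G "G \<union> ?J"] by blast
    ultimately have "\<rho> a - \<rho> x + \<rho> x \<in> span (G \<union> ?J)" by (rule span_add)
    then show "v \<in> span (G \<union> ?J)" using a(1) by simp
  qed
  \<comment> \<open>The image of \<open>I\<close> in \<open>S\<close> is an ideal of square zero, so
    it is nilpotent with exponent two and vanishes.\<close>
  have ssq: "I \<subseteq> ?J" if I: "left_ideal ?A I" "right_ideal ?A I" "?J \<subseteq> I" "\<And>x y. x \<in> I \<Longrightarrow> y \<in> I \<Longrightarrow> x * y \<in> ?J" for I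
  proof
    fix v assume v: "v \<in> I"
    note lI = left_idealD[OF I(1)] and rI = right_idealD[OF I(2)]
    let ?I = "?c ` {x\<in>A0. \<rho> x \<in> I}"
    have "kideal (?Q\<lparr>acarrier := S\<rparr>) ?I"
      unfolding kideal_def ksubspace_def
    proof (intro conjI ballI allI)
      show "?I \<subseteq> acarrier (?Q\<lparr>acarrier := S\<rparr>)" by (auto simp: A0_def)
      have "azero R \<in> {x\<in>A0. \<rho> x \<in> I}" using A0 subspace_0[OF lI(1)] by (auto simp: subalgebra_def ksubspace_def)
      then show "azero (?Q\<lparr>acarrier := S\<rparr>) \<in> ?I" by (auto simp: quot_zero)
    next
      fix X Y assume "X \<in> ?I" "Y \<in> ?I"
      then obtain x y where xy: "X = ?c x" "Y = ?c y" "x \<in> A0" "y \<in> A0" "\<rho> x \<in> I" "\<rho> y \<in> I" by blast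
      then have "aadd R x y \<in> A0" "\<rho> (aadd R x y) \<in> I"
        using A0 A0R rho_add subspace_add[OF lI(1)] by (auto simp: subalgebra_def ksubspace_def)
      then show "aadd (?Q\<lparr>acarrier := S\<rparr>) X Y \<in> ?I" using xy A0R by (simp add: quot_ops)
    next
      fix X assume "X \<in> ?I"
      then obtain x where x: "X = ?c x" "x \<in> A0" "\<rho> x \<in> I" by blast
      then have "aneg R x \<in> A0" "\<rho> (aneg R x) \<in> I"
        using A0 A0R rho_neg subspace_neg[OF lI(1)] by (auto simp: subalgebra_def ksubspace_def)
      then show "aneg (?Q\<lparr>acarrier := S\<rparr>) X \<in> ?I" using x A0R by (simp add: quot_neg)
    next
      fix X c assume "X \<in> ?I"
      then obtain x where x: "X = ?c x" "x \<in> A0" "\<rho> x \<in> I" by blast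
      then have "asmul R c x \<in> A0" "\<rho> (asmul R c x) \<in> I"
        using A0 A0R rho_scl subspace_scale[OF lI(1)] by (auto simp: subalgebra_def ksubspace_def)
      then show "asmul (?Q\<lparr>acarrier := S\<rparr>) c X \<in> ?I" using x A0R by (simp add: quot_ops(3)[of x x])
    next
      fix X Y assume "X \<in> acarrier (?Q\<lparr>acarrier := S\<rparr>)" "Y \<in> ?I"
      then obtain x y where xy: "X = ?c x" "Y = ?c y" "x \<in> A0" "y \<in> A0" "\<rho> y \<in> I" using SQ(1) by (auto simp: A0_def)
      have "amul R x y \<in> A0" "amul R y x \<in> A0" using A0 xy by (auto simp: subalgebra_def)
      moreover have "\<rho> (amul R x y) \<in> I" "\<rho> (amul R y x) \<in> I"
        using xy A0R lI(3)[of "\<rho> x" "\<rho> y"] rI(3)[of "\<rho> x" "\<rho> y"] by (auto simp: rho_mul)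
      ultimately show "amul (?Q\<lparr>acarrier := S\<rparr>) X Y \<in> ?I" "amul (?Q\<lparr>acarrier := S\<rparr>) Y X \<in> ?I"
        using xy A0R by (simp_all add: quot_ops)
    qed
    moreover have "nilpotent_ideal (?Q\<lparr>acarrier := S\<rparr>) ?I"
      unfolding nilpotent_ideal_def
    proof (intro exI[of _ 2] conjI allI impI)
      fix Xs assume "length Xs = 2 \<and> set Xs \<subseteq> ?I"
      then obtain X Y where Xs: "Xs = [X, Y]" "X \<in> ?I" "Y \<in> ?I" by (auto simp: numeral_2_eq_2 length_Suc_conv)
      then obtain x y where xy: "X = ?c x" "Y = ?c y" "x \<in> A0" "y \<in> A0" "\<rho> x \<in> I" "\<rho> y \<in> I" by blast
      have "?c (amul R x y) = ?c (azero R)"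
        using xy A0R RA(1,3) I(4) by (simp add: coset_eq_iff rho_mul)
      then show "aprod (?Q\<lparr>acarrier := S\<rparr>) Xs = azero (?Q\<lparr>acarrier := S\<rparr>)"
        using xy A0R by (simp add: Xs(1) quot_ops quot_zero)
    qed simp
    ultimately have "?I = {?c (azero R)}" using S(3) by (auto simp: fdss_def semisimple_def quot_zero)
    moreover obtain x where x: "v = \<rho> x" "x \<in> A0" using lI(2)[OF v] by blast
    ultimately have "?c x = ?c (azero R)" using v by blast
    then show "v \<in> ?J" using coset_eq_iff[OF A0R[OF x(2)] RA(1)] x(1) by simp
  qed
  have FA: "finite (\<rho> ` F)" "\<rho> ` F \<subseteq> ?A" using F S(2) by (auto simp: A0_def)
  obtain B where B: "ssalg B" "\<rho> ` F \<subseteq> B" "B \<subseteq> ?A"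
    by (rule extension_loc_ss[OF perf subalg_image[OF A0] lid rid loc_ss_J[OF lJ] fG AG ssq FA]) blast+
  have BR: "B \<subseteq> \<rho> ` acarrier R" using B(3) A0R by blast
  show "\<exists>B. subalgebra R B \<and> F \<subseteq> B \<and> fdss (R\<lparr>acarrier := B\<rparr>)"
  proof (intro exI conjI)
    show "subalgebra R {x\<in>acarrier R. \<rho> x \<in> B}" "fdss (R\<lparr>acarrier := {x\<in>acarrier R. \<rho> x \<in> B}\<rparr>)"
      using fdss_preimage[OF B(1) BR] .
    show "F \<subseteq> {x\<in>acarrier R. \<rho> x \<in> B}" using F(2) B(2) by blast
  qed
qed

end

end

theorem theorem4p6:
  fixes R :: "('k::field, 'a) kalg" and J :: "'a set"
  assumes "perfect_field TYPE('k)"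
    and "is_kalgebra R"
    and "kideal R J"
    and "locally_fdss (R\<lparr>acarrier := J\<rparr>)"
    and "locally_fdss (quot_alg R J)"
  shows "locally_fdss R"
proof -
  obtain \<rho> :: "'a \<Rightarrow> ('k \<times> ('a \<Rightarrow>\<^sub>0 'k)) endo" where "kalg_rep emb0 R \<rho>"
    using kalgebra_embedding[OF assms(2)] .
  then show ?thesis by (rule kalg_rep.extension_locally_fdss[OF _ assms(3,1,4,5)])
qed

end
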